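(* There exists an infinitely differentiable function $a_*:(2,\infty)\to(0,\infty)$ that is monotone decreasing and satisfies $a_*(\lambda)\to+\infty$ as $\lambda\to 2$ and $a_*(\lambda)\to 0$ as $\lambda\to+\infty$, such that the following holds. Let $h_1,h_2,c\in\mathbb{R}$ satisfy $-h_2\le 0<2c<h_1$, let $\{u_n(t)\}_{n\in\mathbb{Z}}$ be the solution on $(0,\infty)$ of $$\dot u_n=\Delta u_n+\mathcal{H}(u_n),\quad t>0,\ n\in\mathbb{Z},\qquad u_n(0)=-cn^2,\quad n\in\mathbb{Z},$$ and let $\mathcal{K}$, $k_i$, $t_k$, $p(n)$, $q(n)$ be the associated objects defined in the context. Assume that the quasi-uniformity condition and the quadratic growth condition (both formulated in the context) hold, the latter with coefficient $a>0$ in $t_k=ak^2+\omega_k$. Then: 1. There exist limits $$p_*:=\lim_{n\to\infty}\frac{p(n)}{n},\qquad q_*:=\lim_{n\to\infty}\frac{q(n)}{n},$$ and moreover $$p_*=\frac{h_1}{h_1+h_2},\qquad q_*=\frac{h_2}{h_1+h_2},\qquad \frac{q_*}{p_*}=\frac{h_2}{h_1}.$$ 2. The coefficient $a$ is given by $a=a_*(h_1/c)$. In particular, $a$ does not depend on $h_2$.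
   Context: Notation: for a sequence $\{w_n\}_{n\in\mathbb{Z}}$, $\Delta w_n:=w_{n-1}-2w_n+w_{n+1}$; $\dot{}=d/dt$. Hysteresis operator (with $h_1>0$, $h_2\ge 0$): for $r\in C[0,\infty)$, $\mathcal{H}(r)(t):=h_1$ if $r(s)<0$ for all $s\in[0,t]$, and $\mathcal{H}(r)(t):=-h_2$ if $r(s)\ge 0$ for some $s\in[0,t]$. Solution: $\{u_n(t)\}_{n\in\mathbb{Z}}$ is a solution of the problem on $(0,T)$, $T>0$, if (1) $u_n\in C[0,T]$ for all $n$; (2) for each $t\in[0,T]$ there are constants $A,\alpha\ge 0$ such that $\sup_{s\in[0,t]}|u_n(s)|\le Ae^{\alpha|n|}$ for all $n$; (3) there is a finite sequence $0=\theta_0<\theta_1<\dots<\theta_J=T$, $J\ge1$, such that $u_n\in C^1[\theta_j,\theta_{j+1}]$ for all $n$ and $j=0,\dots,J-1$; (4) the equations $\dot u_n=\Delta u_n+\mathcal{H}(u_n)$ hold in $(\theta_j,\theta_{j+1})$ for all $n$ and $j=0,\dots,J-1$; (5) $u_n(0)=-cn^2$ for all $n$. It is a solution on $(0,\infty)$ if it is a solution on $(0,T)$ for all $T>0$. If $-h_2\le 0<2c<h_1$, there is a unique solution on $(0,\infty)$, and $u_n=u_{-n}$. Switching: a node $n\in\mathbb{Z}$ is a switching node if $u_n(t)\ge 0$ for some $t\in[0,\infty)$; its switching moment $t_n$ is the smallest such $t$ (the moment since which $\mathcal{H}(u_n)=-h_2$; node $0$ is a switching node with $t_0=0$). The set of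 all switching nodes is infinite, symmetric, with $t_{-n}=t_n$, and is written $\mathcal{K}=\{k_0,\pm k_1,\pm k_2,\dots\}$ with $0=k_0<k_1<k_2<\dots$ and $k_{-i}:=-k_i$. For $n\in\mathbb{N}$, $p(n):=\#(\mathcal{K}\cap[1,n-1])$ and $q(n):=n-p(n)$. Quasi-uniformity condition: $\displaystyle\sup_{i=-p(n),\dots,p(n)}\left|\frac{k_i}{n}-\frac{i}{p(n)}\right|\to 0$ as $n\in\mathcal{K}$, $n\to\infty$. Quadratic growth condition: (i) there exist $a>0$ and $A>0$ such that for each $k\in\mathcal{K}$ one has $t_k=ak^2+\omega_k$ with $|\omega_k|\le A|k|$; (ii) there exist $N_0\in\mathbb{N}$ and $\varepsilon_0>0$ such that for any $n\in\mathcal{K}$ with $|n|>N_0$ and any $k\in\mathcal{K}$ with $|k|\le|n|-1$ one has $t_n-t_k\ge\varepsilon_0(n^2-k^2)$. *)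

theory Defs
  imports "HOL-Analysis.Analysis" "HOL-Library.Infinite_Set"
begin

definition lattice_laplacian :: "(int \<Rightarrow> real) \<Rightarrow> int \<Rightarrow> real" where
  "lattice_laplacian w n = w (n - 1) - 2 * w n + w (n + 1)"

definition hysteresis :: "real \<Rightarrow> real \<Rightarrow> (real \<Rightarrow> real) \<Rightarrow> real \<Rightarrow> real" where
  "hysteresis h1 h2 r t = (if \<forall>s\<in>{0..t}. r s < 0 then h1 else - h2)"

(* C^1 up to the end points, with one-sided derivatives there. The library's
   C1_differentiable_on uses two-sided derivatives also at the end points, which
   would be too strong at the times where the right-hand side jumps. *)
definition C1_closed_interval :: "real \<Rightarrow> real \<Rightarrow> (real \<Rightarrow> real) \<Rightarrow> bool" where
  "C1_closed_interval a b f \<longleftrightarrow>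
     (\<exists>f'. (\<forall>t\<in>{a..b}. (f has_real_derivative f' t) (at t within {a..b})) \<and>
           continuous_on {a..b} f')"

(* Values of u at negative times are irrelevant. *)
definition solution_on :: "real \<Rightarrow> real \<Rightarrow> real \<Rightarrow> real \<Rightarrow> (int \<Rightarrow> real \<Rightarrow> real) \<Rightarrow> bool" where
  "solution_on h1 h2 c T u \<longleftrightarrow>
     (\<forall>n. continuous_on {0..T} (u n)) \<and>
     (\<forall>t\<in>{0..T}. \<exists>A\<ge>0. \<exists>\<alpha>\<ge>0. \<forall>n.
        (SUP s\<in>{0..t}. \<bar>u n s\<bar>) \<le> A * exp (\<alpha> * real_of_int \<bar>n\<bar>)) \<and>
     (\<exists>(J::nat) (\<theta>::nat \<Rightarrow> real). J \<ge> 1 \<and> \<theta> 0 = 0 \<and> \<theta> J = T \<and>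
        (\<forall>j<J. \<theta> j < \<theta> (Suc j)) \<and>
        (\<forall>n. \<forall>j<J. C1_closed_interval (\<theta> j) (\<theta> (Suc j)) (u n)) \<and>
        (\<forall>n. \<forall>j<J. \<forall>t\<in>{\<theta> j<..<\<theta> (Suc j)}.
           (u n has_real_derivative
              lattice_laplacian (\<lambda>m. u m t) n + hysteresis h1 h2 (u n) t) (at t))) \<and>
     (\<forall>n. u n 0 = - c * (real_of_int n)\<^sup>2)"

definition global_solution :: "real \<Rightarrow> real \<Rightarrow> real \<Rightarrow> (int \<Rightarrow> real \<Rightarrow> real) \<Rightarrow> bool" where
  "global_solution h1 h2 c u \<longleftrightarrow> (\<forall>T>0. solution_on h1 h2 c T u)"

definition switching_nodes :: "(int \<Rightarrow> real \<Rightarrow> real) \<Rightarrow> int set" where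
  "switching_nodes u = {n. \<exists>t\<ge>0. u n t \<ge> 0}"

(* The least element exists for switching nodes when u n is continuous on [0,\<infinity>). *)
definition switching_moment :: "(int \<Rightarrow> real \<Rightarrow> real) \<Rightarrow> int \<Rightarrow> real" where
  "switching_moment u n = (LEAST t. t \<ge> 0 \<and> u n t \<ge> 0)"

(* k_i for i \<ge> 0 is the i-th nonnegative switching node in increasing order, counted
   from 0 (k_0 = 0, since u_0(0) = 0), and k_{-i} = - k_i. *)
definition switching_node :: "(int \<Rightarrow> real \<Rightarrow> real) \<Rightarrow> int \<Rightarrow> int" where
  "switching_node u i = sgn i * int (enumerate {m::nat. int m \<in> switching_nodes u} (nat \<bar>i\<bar>))"

definition switch_count :: "(int \<Rightarrow> real \<Rightarrow> real) \<Rightarrow> nat \<Rightarrow> nat" where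
  "switch_count u n = card (switching_nodes u \<inter> {1..int n - 1})"

definition nonswitch_count :: "(int \<Rightarrow> real \<Rightarrow> real) \<Rightarrow> nat \<Rightarrow> int" where
  "nonswitch_count u n = int n - int (switch_count u n)"

definition quasi_uniform :: "(int \<Rightarrow> real \<Rightarrow> real) \<Rightarrow> bool" where
  "quasi_uniform u \<longleftrightarrow>
     ((\<lambda>n::nat. SUP i\<in>{- int (switch_count u n)..int (switch_count u n)}.
         \<bar>real_of_int (switching_node u i) / real n - real_of_int i / real (switch_count u n)\<bar>)
       \<longlongrightarrow> 0) (inf sequentially (principal {n. int n \<in> switching_nodes u}))"

definition quadratic_growth :: "(int \<Rightarrow> real \<Rightarrow> real) \<Rightarrow> real \<Rightarrow> bool" where
  "quadratic_growth u a \<longleftrightarrow>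
     a > 0 \<and>
     (\<exists>A>0. \<exists>\<omega>::int \<Rightarrow> real. \<forall>k\<in>switching_nodes u.
        switching_moment u k = a * (real_of_int k)\<^sup>2 + \<omega> k \<and>
        \<bar>\<omega> k\<bar> \<le> A * real_of_int \<bar>k\<bar>) \<and>
     (\<exists>N0::nat. \<exists>\<epsilon>0>0. \<forall>n\<in>switching_nodes u. \<forall>k\<in>switching_nodes u.
        \<bar>n\<bar> > int N0 \<longrightarrow> \<bar>k\<bar> \<le> \<bar>n\<bar> - 1 \<longrightarrow>
        switching_moment u n - switching_moment u k
          \<ge> \<epsilon>0 * ((real_of_int n)\<^sup>2 - (real_of_int k)\<^sup>2))"

(* For open S only, as in the use below: deriv is the two-sided derivative. *)
definition infinitely_differentiable_on :: "(real \<Rightarrow> real) \<Rightarrow> real set \<Rightarrow> bool" where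
  "infinitely_differentiable_on f S \<longleftrightarrow> (\<forall>m::nat. \<forall>x\<in>S. (deriv ^^ m) f differentiable at x)"

end

theory Submission
  imports Defs
begin

text \<open>
  Subtracting the solution without switching, \<open>- c n\<^sup>2 + (h1 - 2 c) t\<close>, turns the problem into
  the lattice heat equation for a nonnegative deficit that starts at zero and has a source of
  strength \<open>h1 + h2\<close> at each switching node from its switching moment on.  If the switching nodes
  have density \<open>p\<close> and \<open>t\<^sub>k\<close> is close to \<open>a k\<^sup>2\<close>, then on large scales the deficit should be
  that of the continuous heat equation with the source \<open>s = (h1 + h2) p\<close> in the region
  \<open>\<bar>x\<bar> \<le> \<xi>\<^sub>0 \<surd>t\<close> behind the front, where \<open>\<xi>\<^sub>0 = 1 / \<surd>a\<close>.  This problem is invariant under parabolic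
  scaling and has the explicit solution \<open>s t \<chi>(x / \<surd>t)\<close> (\<open>profile'\<close> is \<open>\<chi>\<close>), in terms of the
  Gaussian, its tail and the coefficient \<open>C\<^sub>1\<close> (\<open>inner_coeff\<close>) of \<open>\<chi> = 1 - C\<^sub>1 (\<xi>\<^sup>2 + 2)\<close> behind
  the front.

  The sources are close to their density only after summation in space.  Sums of the deficit over
  windows of \<open>r\<close> nodes again solve the lattice heat equation, with a source that is a difference of
  counting functions, and quasi-uniformity makes the latter uniformly close to linear
  (\<open>source_count_linear\<close>).  The maximum principle on the lattice then compares window sums
  with increments of the primitive of \<open>t \<chi>(x / \<surd>t)\<close> (\<open>window_comparison\<close>).  Window sums give
  point values back because the deficit is Lipschitz in space: it grows in time, hence is
  semiconvex by the equation, and it is bounded (\<open>deficit_lipschitz\<close>).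
  The negative nodes are controlled by the symmetry of the solution, which is proved along the
  partition of the time interval, since the hysteresis can only jump at partition points
  (\<open>u_symmetric\<close>).

  Consequently \<open>u\<^sub>n(t) / t\<close> approaches \<open>U(n / \<surd>t)\<close> with
  \<open>U(\<xi>) = - c \<xi>\<^sup>2 + h1 - 2 c - s \<chi>(\<xi>)\<close>.  At its switching moment the solution vanishes, so
  \<open>U(\<xi>\<^sub>0) = 0\<close>; this makes the density converge and gives
  \<open>h1 - s = (c - s C\<^sub>1) (\<xi>\<^sub>0\<^sup>2 + 2)\<close>.  Ahead of the front no node has switched, so \<open>U\<close> cannot
  increase through \<open>\<xi>\<^sub>0\<close>, which means \<open>s C\<^sub>1 \<le> c\<close> (\<open>strength_upper\<close>).  If \<open>s C\<^sub>1 < c\<close>, then \<open>U > 0\<close>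
  near the origin, so all nodes switch and \<open>s = h1 + h2\<close>, contradicting the relation for \<open>h1 - s\<close>
  (\<open>strength_lower\<close>).  Therefore \<open>s C\<^sub>1 = c\<close> and \<open>s = h1\<close>.  The second identity is the density
  \<open>p = h1 / (h1 + h2)\<close>; together they say \<open>C\<^sub>1 = c / h1\<close>, an equation for \<open>\<xi>\<^sub>0\<close> alone:
  \<open>tail_ratio \<xi>\<^sub>0 = 1 - 2 c / h1\<close>.  Since \<open>tail_ratio\<close> increases from 0 to 1 on \<open>(0, \<infinity>)\<close>, it
  determines \<open>a = 1 / \<xi>\<^sub>0\<^sup>2\<close> as a decreasing function of \<open>h1 / c\<close>.  Smoothness follows from a
  first-order differential equation with rational right-hand side for the inverse of
  \<open>tail_ratio\<close>.
\<close>

section \<open>Iterated tails of the Gaussian\<close>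

definition gauss :: "real \<Rightarrow> real" where
  "gauss x = exp (- x\<^sup>2 / 4)"

lemma gauss_pos: "gauss x > 0"
  by (simp add: gauss_def)

lemma gauss_deriv: "(gauss has_real_derivative - (x / 2) * gauss x) (at x)"
  unfolding gauss_def by (auto intro!: derivative_eq_intros simp: power2_eq_square)

lemma gauss_le_one: "gauss x \<le> 1"
  by (simp add: gauss_def)

lemma x_gauss_tendsto_0: "((\<lambda>x. x * gauss x) \<longlongrightarrow> 0) at_top"
proof (rule tendsto_sandwich[of "\<lambda>x. 0" _ _ "\<lambda>x. 4 / x"])
  show "eventually (\<lambda>x. 0 \<le> x * gauss x) at_top"
    using eventually_ge_at_top[of 0] by eventually_elim (simp add: gauss_def)
  show "eventually (\<lambda>x. x * gauss x \<le> 4 / x) at_top"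
    using eventually_gt_at_top[of 0]
  proof eventually_elim
    case (elim x)
    have "x\<^sup>2 / 4 \<le> exp (x\<^sup>2 / 4)"
      using exp_ge_add_one_self[of "x\<^sup>2 / 4"] by linarith
    then have "x\<^sup>2 / 4 * gauss x \<le> 1"
      by (simp add: gauss_def exp_minus field_simps)
    then show ?case
      using elim by (simp add: field_simps power2_eq_square)
  qed
  show "((\<lambda>x::real. 4 / x) \<longlongrightarrow> 0) at_top"
    by (intro tendsto_divide_0[OF tendsto_const] filterlim_at_top_imp_at_infinity filterlim_ident)
qed auto

lemma gauss_tendsto_0: "(gauss \<longlongrightarrow> 0) at_top"
proof (rule tendsto_sandwich[of "\<lambda>x. 0" _ _ "\<lambda>x. x * gauss x"])
  show "eventually (\<lambda>x. 0 \<le> gauss x) at_top"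
    by (simp add: gauss_def)
  show "eventually (\<lambda>x. gauss x \<le> x * gauss x) at_top"
    using eventually_ge_at_top[of 1]
  proof eventually_elim
    case (elim x)
    show ?case using mult_right_mono[OF elim less_imp_le[OF gauss_pos[of x]]] by simp
  qed
qed (use x_gauss_tendsto_0 in auto)

text \<open>The tail \<open>\<integral>\<^sub>x\<^sup>\<infinity> gauss\<close> for \<open>x \<ge> 0\<close>, written as total mass minus
  head so that only integrals over bounded intervals occur.\<close>
definition gtail0 :: "real \<Rightarrow> real" where
  "gtail0 x = (SUP y\<in>{0..}. integral {0..y} gauss) - integral {0..x} gauss"

text \<open>For \<open>k = 1, 2, 3\<close> these are the moments \<open>\<integral>\<^sub>x\<^sup>\<infinity> (y - x)\<^sup>k gauss y dy\<close>, reduced by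
  integration by parts to the tail and the Gaussian itself.  The second one spans the
  solutions of \<open>\<psi> - (x/2) \<psi>' = \<psi>''\<close> that decay at infinity.\<close>
definition gtail1 :: "real \<Rightarrow> real" where
  "gtail1 x = 2 * gauss x - x * gtail0 x"

definition gtail2 :: "real \<Rightarrow> real" where
  "gtail2 x = (2 + x\<^sup>2) * gtail0 x - 2 * x * gauss x"

definition gtail3 :: "real \<Rightarrow> real" where
  "gtail3 x = 4 * gtail1 x - x * gtail2 x"

lemma continuous_on_gauss: "continuous_on A gauss"
  unfolding gauss_def by (intro continuous_intros) auto

lemma gauss_integral_deriv:
  assumes "x > 0"
  shows "((\<lambda>x. integral {0..x} gauss) has_real_derivative gauss x) (at x)"
proof -
  have "((\<lambda>x. integral {0..x} gauss) has_real_derivative gauss x) (at x within {0..x+1})"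
    by (rule integral_has_real_derivative[OF continuous_on_gauss]) (use assms in auto)
  moreover have "at x within {0..x+1} = at x"
    using assms by (intro at_within_Icc_at) auto
  ultimately show ?thesis by simp
qed

text \<open>The total mass is finite by comparison with \<open>1 / (1 + x\<^sup>2/4)\<close>, whose integral is an
  arctangent.\<close>
lemma gauss_integral_le: 
  assumes "x \<ge> 0"
  shows "integral {0..x} gauss \<le> pi"
proof -
  have "((\<lambda>y. 1 / (1 + y\<^sup>2 / 4)) has_integral (2 * arctan (x / 2) - 2 * arctan (0 / 2))) {0..x}"
  proof (rule fundamental_theorem_of_calculus[OF assms])
    fix y :: real
    have "((\<lambda>x. 2 * arctan (x / 2)) has_real_derivative 1 / (1 + y\<^sup>2 / 4)) (at y within {0..x})"
      by (auto intro!: derivative_eq_intros simp: power_divide field_simps)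
    then show "((\<lambda>x. 2 * arctan (x / 2)) has_vector_derivative 1 / (1 + y\<^sup>2 / 4)) (at y within {0..x})"
      by (simp add: has_real_derivative_iff_has_vector_derivative)
  qed
  moreover have "(gauss has_integral integral {0..x} gauss) {0..x}"
    by (intro integrable_integral integrable_continuous_interval continuous_on_gauss)
  moreover have "gauss y \<le> 1 / (1 + y\<^sup>2 / 4)" for y
  proof -
    have "1 + y\<^sup>2 / 4 \<le> exp (y\<^sup>2 / 4)" by (rule exp_ge_add_one_self)
    moreover have "0 < 1 + y\<^sup>2 / 4"
      by (rule add_pos_nonneg) simp_all
    ultimately have "inverse (exp (y\<^sup>2 / 4)) \<le> inverse (1 + y\<^sup>2 / 4)"
      by (intro le_imp_inverse_le)
    then show ?thesis
      by (simp add: gauss_def exp_minus inverse_eq_divide)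
  qed
  ultimately have "integral {0..x} gauss \<le> 2 * arctan (x / 2) - 2 * arctan (0 / 2)"
    by (meson has_integral_le)
  also have "\<dots> \<le> pi"
    using arctan_ubound[of "x/2"] by simp
  finally show ?thesis .
qed

lemma gtail0_deriv:
  assumes "x > 0"
  shows "(gtail0 has_real_derivative - gauss x) (at x)"
  unfolding gtail0_def using gauss_integral_deriv[OF assms]
  by (auto intro!: derivative_eq_intros)

lemma gtail1_deriv: "x > 0 \<Longrightarrow> (gtail1 has_real_derivative - gtail0 x) (at x)"
  unfolding gtail1_def
  by (auto intro!: derivative_eq_intros gauss_deriv gtail0_deriv simp: field_simps)

lemma gtail2_deriv: "x > 0 \<Longrightarrow> (gtail2 has_real_derivative - 2 * gtail1 x) (at x)"
  unfolding gtail2_def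
  by (auto intro!: derivative_eq_intros gauss_deriv gtail0_deriv 
      simp: gtail1_def field_simps power2_eq_square)

lemma gtail3_deriv: "x > 0 \<Longrightarrow> (gtail3 has_real_derivative - 3 * gtail2 x) (at x)"
  unfolding gtail3_def
  by (rule derivative_eq_intros gtail1_deriv gtail2_deriv refl | assumption)+
     (simp add: gtail1_def gtail2_def field_simps power2_eq_square)

lemma gtail0_tendsto_0: "(gtail0 \<longlongrightarrow> 0) at_top"
proof (rule tendstoI)
  fix e :: real assume "e > 0"
  define G where "G = (\<lambda>x. integral {0..x} gauss)"
  have bdd: "bdd_above (G ` {0..})"
    by (rule bdd_aboveI2[where M = pi]) (auto simp: G_def gauss_integral_le)
  have mono: "G x \<le> G y" if "0 \<le> x" "x \<le> y" for x y
    unfolding G_def using that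
    by (intro integral_subset_le integrable_continuous_interval continuous_on_gauss)
       (auto simp: less_imp_le[OF gauss_pos])
  have "\<exists>y\<in>{0..}. (SUP y\<in>{0..}. G y) - e < G y"
    using \<open>e > 0\<close> by (subst less_cSUP_iff[OF _ bdd, symmetric]) auto
  then obtain y where y: "y \<ge> 0" "(SUP y\<in>{0..}. G y) - e < G y"
    by auto
  show "eventually (\<lambda>x. dist (gtail0 x) 0 < e) at_top"
    using eventually_ge_at_top[of y]
  proof eventually_elim
    case (elim x)
    have "G x \<le> (SUP y\<in>{0..}. G y)"
      using elim y by (intro cSUP_upper[OF _ bdd]) auto
    moreover have "G y \<le> G x" using mono y elim by auto
    ultimately show ?case
      using y by (simp add: gtail0_def dist_real_def G_def)
  qed
qed

text \<open>The sharp bounds for the tail below are instances: the difference of the two sides tends to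
  zero and has a derivative of known sign.\<close>
lemma pos_if_decreasing_to_0:
  fixes f :: "real \<Rightarrow> real"
  assumes "\<And>x. x > 0 \<Longrightarrow> (f has_real_derivative f' x) (at x)" "\<And>x. x > 0 \<Longrightarrow> f' x < 0"
    and "(f \<longlongrightarrow> 0) at_top" "x > 0"
  shows "f x > 0"
proof (rule DERIV_neg_imp_decreasing_at_top[OF _ assms(3)])
  show "\<exists>y. (f has_real_derivative y) (at z) \<and> y < 0" if "x \<le> z" for z
    using assms that by (intro exI[of _ "f' z"]) auto
qed

lemma gtail0_pos: "x > 0 \<Longrightarrow> gtail0 x > 0"
  by (rule pos_if_decreasing_to_0[OF gtail0_deriv _ gtail0_tendsto_0]) (use gauss_pos in auto)

lemma gtail1_pos:
  assumes "x > 0"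
  shows "gtail1 x > 0"
proof -
  have "2 * gauss x / x - gtail0 x > 0"
  proof (rule pos_if_decreasing_to_0[where f = "\<lambda>x. 2 * gauss x / x - gtail0 x" 
        and f' = "\<lambda>x. - 2 * gauss x / x\<^sup>2"])
    show "((\<lambda>x. 2 * gauss x / x - gtail0 x) has_real_derivative - 2 * gauss x / x\<^sup>2) (at x)"
      if "x > 0" for x
      using that
      by (auto intro!: derivative_eq_intros gauss_deriv gtail0_deriv simp: field_simps power2_eq_square)
    have "((\<lambda>x. 2 * gauss x / x) \<longlongrightarrow> 0) at_top"
      by (rule real_tendsto_divide_at_top[of _ "2 * 0"])
         (intro tendsto_intros gauss_tendsto_0 filterlim_ident)+
    from tendsto_diff[OF this gtail0_tendsto_0]
    show "((\<lambda>x. 2 * gauss x / x - gtail0 x) \<longlongrightarrow> 0) at_top" by simp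
  qed (use assms gauss_pos in auto)
  then show ?thesis
    using assms by (simp add: gtail1_def field_simps)
qed

lemma gtail_identity: "(2 + x\<^sup>2) * gtail1 x + x * gtail2 x = 4 * gauss x"
  by (simp add: gtail1_def gtail2_def algebra_simps power2_eq_square)

lemma gtail2_pos:
  assumes "x > 0"
  shows "gtail2 x > 0"
proof -
  have nz: "2 + y\<^sup>2 > 0" for y :: real
    by (rule add_pos_nonneg) simp_all
  have "gtail2 x / (2 + x\<^sup>2) > 0"
  proof (rule pos_if_decreasing_to_0[where f = "\<lambda>x. gtail2 x / (2 + x\<^sup>2)" 
        and f' = "\<lambda>x. - 8 * gauss x / (2 + x\<^sup>2)\<^sup>2"])
    show "((\<lambda>x. gtail2 x / (2 + x\<^sup>2)) has_real_derivative - 8 * gauss x / (2 + x\<^sup>2)\<^sup>2) (at x)"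
      if "x > 0" for x
    proof -
      have "((\<lambda>x. gtail2 x / (2 + x\<^sup>2)) has_real_derivative
          (- 2 * gtail1 x * (2 + x\<^sup>2) - gtail2 x * (2 * x)) / (2 + x\<^sup>2)\<^sup>2) (at x)"
        using that nz[of x]
        by (auto intro!: derivative_eq_intros gtail2_deriv simp: power2_eq_square)
      moreover have "- 2 * gtail1 x * (2 + x\<^sup>2) - gtail2 x * (2 * x) = - 8 * gauss x"
        using gtail_identity[of x] by (simp add: algebra_simps)
      ultimately show ?thesis by simp
    qed
    have eq: "gtail2 x / (2 + x\<^sup>2) = gtail0 x - 2 * (x * gauss x) * inverse (2 + x\<^sup>2)" for x
      using nz[of x] by (simp add: gtail2_def field_simps)
    have "((\<lambda>x. gtail0 x - 2 * (x * gauss x) * inverse (2 + x\<^sup>2)) \<longlongrightarrow> 0 - 2 * 0 * 0) at_top"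
    proof (intro tendsto_intros gtail0_tendsto_0 x_gauss_tendsto_0 tendsto_inverse_0_at_top)
      show "filterlim (\<lambda>x::real. 2 + x\<^sup>2) at_top at_top"
        by (intro filterlim_tendsto_add_at_top[OF tendsto_const] filterlim_pow_at_top filterlim_ident)
           auto
    qed
    then show "((\<lambda>x. gtail2 x / (2 + x\<^sup>2)) \<longlongrightarrow> 0) at_top"
      by (simp add: eq)
    show "- 8 * gauss x / (2 + x\<^sup>2)\<^sup>2 < 0" if "x > 0" for x
      using gauss_pos[of x] nz[of x] by simp
  qed (use assms in auto)
  then show ?thesis
    using nz[of x] by (simp add: zero_less_divide_iff)
qed

lemma antimono_if_nonpos_deriv:
  fixes f :: "real \<Rightarrow> real"
  assumes "\<And>x. x > 0 \<Longrightarrow> (f has_real_derivative f' x) (at x)" "\<And>x. x > 0 \<Longrightarrow> f' x \<le> 0"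
    and "0 < x" "x \<le> y"
  shows "f y \<le> f x"
proof (rule DERIV_nonpos_imp_nonincreasing[OF \<open>x \<le> y\<close>])
  show "\<exists>d. (f has_real_derivative d) (at z) \<and> d \<le> 0" if "x \<le> z" for z
    using assms that by (intro exI[of _ "f' z"]) auto
qed

lemma gtail0_antimono: "0 < x \<Longrightarrow> x \<le> y \<Longrightarrow> gtail0 y \<le> gtail0 x"
  by (rule antimono_if_nonpos_deriv[OF gtail0_deriv]) (auto simp: less_imp_le[OF gauss_pos])

lemma gtail1_antimono: "0 < x \<Longrightarrow> x \<le> y \<Longrightarrow> gtail1 y \<le> gtail1 x"
  by (rule antimono_if_nonpos_deriv[OF gtail1_deriv]) (auto simp: less_imp_le[OF gtail0_pos])

lemma gtail2_antimono: "0 < x \<Longrightarrow> x \<le> y \<Longrightarrow> gtail2 y \<le> gtail2 x"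
  by (rule antimono_if_nonpos_deriv[OF gtail2_deriv]) (auto simp: less_imp_le[OF gtail1_pos])


section \<open>The switching coefficient as a function of the ratio of the parameters\<close>

text \<open>Substituting \<open>y = x + 2 z / x\<close> in the tail shows that for \<open>x > 0\<close> this ratio is
  \<open>\<integral>\<^sub>0\<^sup>\<infinity> exp (- z\<^sup>2 / x\<^sup>2 - z) dz\<close>: an increasing function with limits 0 and 1.\<close>
definition tail_ratio :: "real \<Rightarrow> real" where
  "tail_ratio x = x * gtail0 x / (2 * gauss x)"

lemma tail_ratio_deriv:
  assumes "x > 0"
  shows "(tail_ratio has_real_derivative gtail2 x / (4 * gauss x)) (at x)"
  unfolding tail_ratio_def
  using gauss_pos[of x] assms
  by (auto intro!: derivative_eq_intros gauss_deriv gtail0_deriv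
      simp: gtail2_def field_simps power2_eq_square)

lemma one_minus_tail_ratio: "1 - tail_ratio x = gtail1 x / (2 * gauss x)"
  using gauss_pos[of x] by (simp add: tail_ratio_def gtail1_def field_simps)

lemma tail_ratio_less_1: "x > 0 \<Longrightarrow> tail_ratio x < 1"
  using one_minus_tail_ratio[of x] divide_pos_pos[OF gtail1_pos, of x "2 * gauss x"]
    gauss_pos[of x] by linarith

lemma tail_ratio_pos: "x > 0 \<Longrightarrow> tail_ratio x > 0"
  using gauss_pos[of x] gtail0_pos[of x] by (simp add: tail_ratio_def)

lemma tail_ratio_strict_mono:
  assumes "0 < x" "x < y"
  shows "tail_ratio x < tail_ratio y"
proof (rule DERIV_pos_imp_increasing[OF assms(2)])
  fix z assume "x \<le> z" "z \<le> y"
  then have "z > 0" using assms by simp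
  then show "\<exists>d. (tail_ratio has_real_derivative d) (at z) \<and> 0 < d"
    using tail_ratio_deriv[of z] gtail2_pos[of z] gauss_pos[of z]
    by (intro exI[of _ "gtail2 z / (4 * gauss z)"]) auto
qed

lemma tail_ratio_less_iff: "0 < x \<Longrightarrow> 0 < y \<Longrightarrow> tail_ratio x < tail_ratio y \<longleftrightarrow> x < y"
  by (metis linorder_cases order_less_asym tail_ratio_strict_mono)

text \<open>A reformulation of the positivity of the second tail; it forces the limit 1 at infinity.\<close>
lemma tail_ratio_lower:
  assumes "x > 0"
  shows "x\<^sup>2 / (2 + x\<^sup>2) < tail_ratio x"
proof -
  have "x * gtail2 x > 0" using assms gtail2_pos by simp
  then have "x\<^sup>2 * (2 * gauss x) < x * gtail0 x * (2 + x\<^sup>2)"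
    by (simp add: gtail2_def algebra_simps power2_eq_square)
  moreover have "2 + x\<^sup>2 > 0" by (rule add_pos_nonneg) simp_all
  ultimately show ?thesis
    unfolding tail_ratio_def using gauss_pos[of x] by (simp add: divide_simps)
qed

lemma tail_ratio_upper:
  assumes "0 < x" "x \<le> 1"
  shows "tail_ratio x \<le> x * (gtail0 1 + 1) / (2 * gauss 1)"
proof -
  have "gauss 1 \<le> gauss x"
    using assms by (auto simp: gauss_def power_le_one)
  moreover have "gtail0 x \<le> gtail0 1 + 1"
  proof (cases "x = 1")
    case False
    then have "\<exists>z>x. z < 1 \<and> gtail0 1 - gtail0 x = (1 - x) * (- gauss z)"
      using assms by (intro MVT2) (auto intro!: gtail0_deriv)
    then obtain z where "gtail0 1 - gtail0 x = (1 - x) * (- gauss z)" by blast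
    then have "gtail0 x = gtail0 1 + (1 - x) * gauss z" by simp
    moreover have "(1 - x) * gauss z \<le> 1 * 1"
      using assms gauss_le_one[of z] gauss_pos[of z] by (intro mult_mono) auto
    ultimately show ?thesis by simp
  qed auto
  ultimately show ?thesis
    unfolding tail_ratio_def using assms gauss_pos gtail0_pos[of x]
    by (intro frac_le mult_left_mono mult_nonneg_nonneg) (auto intro: less_imp_le)
qed

lemma tail_ratio_surj:
  assumes "0 < y" "y < 1"
  shows "\<exists>x>0. tail_ratio x = y"
proof -
  define C where "C = (gtail0 1 + 1) / (2 * gauss 1)"
  have "C > 0" using gtail0_pos[of 1] gauss_pos[of 1] by (simp add: C_def)
  define x0 where "x0 = min 1 (y / C)"
  have x0: "0 < x0" "x0 \<le> 1" using assms \<open>C > 0\<close> by (auto simp: x0_def)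
  have "tail_ratio x0 \<le> x0 * C"
    using tail_ratio_upper[OF x0] by (simp add: C_def)
  also have "\<dots> \<le> y"
    using \<open>C > 0\<close> by (auto simp: x0_def min_def field_simps)
  finally have lo: "tail_ratio x0 \<le> y" .
  (* the point at which the lower bound for tail_ratio takes the value y *)
  define x1 where "x1 = sqrt (2 * y / (1 - y))"
  have "x1 > 0" "x1\<^sup>2 = 2 * y / (1 - y)" using assms by (auto simp: x1_def)
  moreover have "x1\<^sup>2 / (2 + x1\<^sup>2) = y"
    unfolding \<open>x1\<^sup>2 = _\<close> using assms by (simp add: field_simps)
  ultimately have hi: "y < tail_ratio x1"
    using tail_ratio_lower by metis
  have "x0 < x1"
    using lo hi tail_ratio_less_iff[of x0 x1] x0 \<open>x1 > 0\<close> by simp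
  have "continuous_on {x0..x1} tail_ratio"
    using x0 by (intro DERIV_continuous_on[OF DERIV_subset[OF tail_ratio_deriv]]) auto
  from IVT'[OF lo less_imp_le[OF hi] less_imp_le[OF \<open>x0 < x1\<close>] this]
  obtain x where "x0 \<le> x" "tail_ratio x = y" by (elim exE conjE)
  then show ?thesis using x0(1) by (intro exI[of _ x]) auto
qed

definition inv_tail_ratio :: "real \<Rightarrow> real" where
  "inv_tail_ratio y = (THE x. x > 0 \<and> tail_ratio x = y)"

lemma inv_tail_ratio_eq:
  assumes "x > 0"
  shows "inv_tail_ratio (tail_ratio x) = x"
  unfolding inv_tail_ratio_def
proof (rule the_equality)
  fix z assume "z > 0 \<and> tail_ratio z = tail_ratio x"
  then show "z = x"
    using assms tail_ratio_strict_mono[of x z] tail_ratio_strict_mono[of z x] 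
    by (cases z x rule: linorder_cases) auto
qed (use assms in auto)

lemma inv_tail_ratio:
  assumes "0 < y" "y < 1"
  shows "inv_tail_ratio y > 0" "tail_ratio (inv_tail_ratio y) = y"
  using tail_ratio_surj[OF assms] inv_tail_ratio_eq by auto

text \<open>The derivative of the inverse is rational in the inverse and its argument, because the
  Gaussian factor cancels.\<close>
lemma inv_tail_ratio_deriv:
  assumes y: "0 < y" "y < 1"
  defines "x \<equiv> inv_tail_ratio y"
  shows "(inv_tail_ratio has_real_derivative 2 * x / ((2 + x\<^sup>2) * y - x\<^sup>2)) (at y)"
    and "(2 + x\<^sup>2) * y - x\<^sup>2 > 0"
proof -
  have x: "x > 0" "tail_ratio x = y"
    using inv_tail_ratio[OF y] by (auto simp: x_def)
  have "tail_ratio x * (2 * gauss x) = x * gtail0 x"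
    using gauss_pos[of x] by (simp add: tail_ratio_def)
  then have "gtail2 x * x = (2 + x\<^sup>2) * (y * (2 * gauss x)) - 2 * x\<^sup>2 * gauss x"
    unfolding gtail2_def x(2) by (simp add: algebra_simps power2_eq_square)
  then have eq: "gtail2 x * x = 2 * gauss x * ((2 + x\<^sup>2) * y - x\<^sup>2)"
    by (simp add: algebra_simps)
  have "gtail2 x * x > 0" using gtail2_pos x by simp
  then show pos: "(2 + x\<^sup>2) * y - x\<^sup>2 > 0"
    unfolding eq using gauss_pos[of x] by (simp add: zero_less_mult_iff)
  have "(inv_tail_ratio has_real_derivative inverse (gtail2 x / (4 * gauss x))) (at (tail_ratio x))"
  proof (rule DERIV_inverse_function[where a = 0 and b = 1 and f = tail_ratio])
    show "(tail_ratio has_real_derivative gtail2 x / (4 * gauss x)) (at (inv_tail_ratio (tail_ratio x)))"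
      using tail_ratio_deriv[OF x(1)] x(1) by (simp add: inv_tail_ratio_eq)
    show "gtail2 x / (4 * gauss x) \<noteq> 0"
      using gtail2_pos[OF x(1)] gauss_pos[of x] by simp
    show "isCont inv_tail_ratio (tail_ratio x)"
    proof (rule isCont_inverse_function[where d = "x / 2" and f = tail_ratio and x = x])
      have pos: "z > 0" if "\<bar>z - x\<bar> \<le> x / 2" for z
        using that x(1) by linarith
      show "inv_tail_ratio (tail_ratio z) = z" if "\<bar>z - x\<bar> \<le> x / 2" for z
        by (rule inv_tail_ratio_eq[OF pos[OF that]])
      show "isCont tail_ratio z" if "\<bar>z - x\<bar> \<le> x / 2" for z
        by (rule DERIV_isCont[OF tail_ratio_deriv[OF pos[OF that]]])
    qed (use x in simp)
    show "0 < tail_ratio x" "tail_ratio x < 1" using x y by simp_all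
    show "tail_ratio (inv_tail_ratio z) = z" if "0 < z" "z < 1" for z
      by (rule inv_tail_ratio(2)[OF that])
  qed
  moreover have "inverse (gtail2 x / (4 * gauss x)) = 2 * x / ((2 + x\<^sup>2) * y - x\<^sup>2)"
    using x(1) eq gtail2_pos[OF x(1)] pos gauss_pos[of x] by (simp add: field_simps)
  ultimately show "(inv_tail_ratio has_real_derivative 2 * x / ((2 + x\<^sup>2) * y - x\<^sup>2)) (at y)"
    using x(2) by simp
qed

text \<open>For \<open>h1 / c = l\<close> the scaling limit forces the front to the position \<open>\<xi>\<close> in the variable
  \<open>x / \<surd>t\<close> with \<open>tail_ratio \<xi> = 1 - 2/l\<close>; such a front reaches \<open>x\<close> at time \<open>x\<^sup>2 / \<xi>\<^sup>2\<close>.\<close>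
definition switching_coeff :: "real \<Rightarrow> real" where
  "switching_coeff l = 1 / (inv_tail_ratio (1 - 2 / l))\<^sup>2"

lemma switching_coeff_eqI:
  assumes "a > 0" "tail_ratio (1 / sqrt a) = 1 - 2 / l"
  shows "switching_coeff l = a"
  using assms inv_tail_ratio_eq[of "1 / sqrt a"]
  by (simp add: switching_coeff_def power_divide flip: assms(2))

lemma switching_coeff_pos: 
  assumes "l > 2"
  shows "switching_coeff l > 0"
  using inv_tail_ratio(1)[of "1 - 2 / l"] assms by (simp add: switching_coeff_def field_simps)

lemma switching_coeff_at:
  assumes "x > 0"
  shows "2 / (1 - tail_ratio x) > 2" "switching_coeff (2 / (1 - tail_ratio x)) = 1 / x\<^sup>2"
  using tail_ratio_less_1[OF assms] tail_ratio_pos[OF assms] inv_tail_ratio_eq[OF assms]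
  by (auto simp: switching_coeff_def field_simps)

lemma switching_coeff_strict_antimono: "strict_antimono_on {2<..} switching_coeff"
proof (rule monotone_onI)
  fix k l :: real assume kl: "k \<in> {2<..}" "l \<in> {2<..}" "k < l"
  define x y where "x = inv_tail_ratio (1 - 2 / k)" and "y = inv_tail_ratio (1 - 2 / l)"
  have "0 < x" "0 < y" "tail_ratio x = 1 - 2 / k" "tail_ratio y = 1 - 2 / l"
    using inv_tail_ratio[of "1 - 2 / k"] inv_tail_ratio[of "1 - 2 / l"] kl
    by (auto simp: x_def y_def field_simps)
  moreover have "1 - 2 / k < 1 - 2 / l" using kl by (simp add: field_simps)
  ultimately have "x < y" by (metis tail_ratio_less_iff)
  then have "x\<^sup>2 < y\<^sup>2" using \<open>0 < x\<close> by (intro power_strict_mono) auto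
  then show "switching_coeff l < switching_coeff k"
    using \<open>0 < x\<close> 
    by (simp add: switching_coeff_def x_def[symmetric] y_def[symmetric] frac_less2)
qed

lemma switching_coeff_at_right_2: "filterlim switching_coeff at_top (at_right 2)"
proof (rule filterlim_at_top_gt[THEN iffD2], intro allI impI)
  fix Z :: real assume "Z > 0"
  define x where "x = 1 / sqrt Z"
  have x: "x > 0" using \<open>Z > 0\<close> by (simp add: x_def)
  have "eventually (\<lambda>l. l \<in> {2<..<2 / (1 - tail_ratio x)}) (at_right 2)"
    using switching_coeff_at(1)[OF x] by (rule eventually_at_right_real)
  then show "eventually (\<lambda>l. Z \<le> switching_coeff l) (at_right 2)"
  proof eventually_elim
    case (elim l)
    then have "switching_coeff (2 / (1 - tail_ratio x)) < switching_coeff l"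
      by (intro monotone_onD[OF switching_coeff_strict_antimono]) auto
    then show ?case
      using \<open>Z > 0\<close> by (simp add: switching_coeff_at(2)[OF x]) (simp add: x_def power_divide)
  qed
qed

lemma switching_coeff_at_top: "(switching_coeff \<longlongrightarrow> 0) at_top"
proof (rule tendstoI)
  fix e :: real assume "e > 0"
  define x where "x = 1 / sqrt e"
  have x: "x > 0" using \<open>e > 0\<close> by (simp add: x_def)
  show "eventually (\<lambda>l. dist (switching_coeff l) 0 < e) at_top"
    using eventually_gt_at_top[of "2 / (1 - tail_ratio x)"]
  proof eventually_elim
    case (elim l)
    then have "switching_coeff l < switching_coeff (2 / (1 - tail_ratio x))" "l > 2"
      using switching_coeff_at(1)[OF x]
      by (auto intro!: monotone_onD[OF switching_coeff_strict_antimono])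
    then show ?case
      using \<open>e > 0\<close> switching_coeff_pos[of l]
      by (simp add: switching_coeff_at(2)[OF x]) (simp add: x_def power_divide)
  qed
qed

text \<open>By induction every iterated derivative of a member agrees on \<open>S\<close> with a member.\<close>
lemma infinitely_differentiable_on_if_closed_family:
  assumes "open S" "f \<in> C"
    and closed: "\<And>f. f \<in> C \<Longrightarrow> \<exists>f'\<in>C. \<forall>x\<in>S. (f has_real_derivative f' x) (at x)"
  shows "infinitely_differentiable_on f S"
proof -
  have "\<exists>g\<in>C. \<forall>x\<in>S. (deriv ^^ m) f x = g x" for m
  proof (induction m)
    case (Suc m)
    then obtain g where g: "g \<in> C" "\<And>x. x \<in> S \<Longrightarrow> (deriv ^^ m) f x = g x" by auto
    obtain g' where g': "g' \<in> C" "\<And>x. x \<in> S \<Longrightarrow> (g has_real_derivative g' x) (at x)"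
      using closed[OF g(1)] by auto
    have "((deriv ^^ m) f has_real_derivative g' x) (at x)" if "x \<in> S" for x
      by (rule has_field_derivative_transform_within_open[OF g'(2)[OF that] \<open>open S\<close> that])
         (simp add: g(2))
    then show ?case
      using g' by (auto intro!: DERIV_imp_deriv)
  qed (use assms in auto)
  moreover have "(deriv ^^ m) f differentiable at x" 
    if "x \<in> S" and g: "g \<in> C" "\<forall>x\<in>S. (deriv ^^ m) f x = g x" for m g x
  proof -
    obtain g' where "(g has_real_derivative g' x) (at x)"
      using closed[OF g(1)] \<open>x \<in> S\<close> by auto
    then have "((deriv ^^ m) f has_real_derivative g' x) (at x)"
      by (rule has_field_derivative_transform_within_open[OF _ \<open>open S\<close> \<open>x \<in> S\<close>]) (use g in auto)
    then show ?thesis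
      by (auto simp: real_differentiable_def)
  qed
  ultimately show ?thesis
    unfolding infinitely_differentiable_on_def by blast
qed

text \<open>The algebra of rational expressions in \<open>l\<close> and \<open>r\<close> without poles in \<open>S\<close>; it is closed under
  differentiation as soon as it contains the derivative of \<open>r\<close>.\<close>
inductive_set rational_algebra :: "real set \<Rightarrow> (real \<Rightarrow> real) \<Rightarrow> (real \<Rightarrow> real) set"
  for S :: "real set" and r :: "real \<Rightarrow> real" where
  const: "(\<lambda>l. k) \<in> rational_algebra S r"
| ident: "(\<lambda>l. l) \<in> rational_algebra S r"
| gen: "r \<in> rational_algebra S r"
| recip: "f \<in> rational_algebra S r \<Longrightarrow> (\<And>l. l \<in> S \<Longrightarrow> f l \<noteq> 0) \<Longrightarrow> (\<lambda>l. 1 / f l) \<in> rational_algebra S r"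
| add: "f \<in> rational_algebra S r \<Longrightarrow> g \<in> rational_algebra S r \<Longrightarrow> (\<lambda>l. f l + g l) \<in> rational_algebra S r"
| mult: "f \<in> rational_algebra S r \<Longrightarrow> g \<in> rational_algebra S r \<Longrightarrow> (\<lambda>l. f l * g l) \<in> rational_algebra S r"

lemma rational_algebra_closed:
  assumes f: "f \<in> rational_algebra S r" and r': "r' \<in> rational_algebra S r"
    and r: "\<And>l. l \<in> S \<Longrightarrow> (r has_real_derivative r' l) (at l)"
  shows "\<exists>f'\<in>rational_algebra S r. \<forall>l\<in>S. (f has_real_derivative f' l) (at l)"
  using f
proof induction
  case (const k)
  show ?case
    by (rule bexI[of _ "\<lambda>l. 0"]) (simp_all add: rational_algebra.const)
next
  case ident
  show ?case
    by (rule bexI[of _ "\<lambda>l. 1"]) (simp_all add: rational_algebra.const)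
next
  case gen
  show ?case by (rule bexI[OF _ r']) (simp add: r)
next
  case (recip f)
  obtain f' where f': "f' \<in> rational_algebra S r" "\<forall>l\<in>S. (f has_real_derivative f' l) (at l)"
    using recip.IH by blast
  show ?case
  proof (intro bexI[of _ "\<lambda>l. - 1 * (f' l * (1 / f l * (1 / f l)))"] ballI)
    show "(\<lambda>l. - 1 * (f' l * (1 / f l * (1 / f l)))) \<in> rational_algebra S r"
      using rational_algebra.recip[OF recip.hyps]
      by (intro rational_algebra.mult[OF rational_algebra.const] rational_algebra.mult[OF f'(1)] rational_algebra.mult)
    fix l assume l: "l \<in> S"
    have "- (inverse (f l) * f' l * inverse (f l)) = - 1 * (f' l * (1 / f l * (1 / f l)))"
      by (simp add: divide_inverse ac_simps)
    then show "((\<lambda>l. 1 / f l) has_real_derivative - 1 * (f' l * (1 / f l * (1 / f l)))) (at l)"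
      using DERIV_inverse'[OF bspec[OF f'(2) l] recip.hyps(2)[OF l]] by (simp only: inverse_eq_divide)
  qed
next
  case (add f g)
  obtain f' where f': "f' \<in> rational_algebra S r" "\<forall>l\<in>S. (f has_real_derivative f' l) (at l)"
    using add.IH(1) by blast
  obtain g' where g': "g' \<in> rational_algebra S r" "\<forall>l\<in>S. (g has_real_derivative g' l) (at l)"
    using add.IH(2) by blast
  show ?case
  proof (intro bexI[of _ "\<lambda>l. f' l + g' l"] ballI)
    show "(\<lambda>l. f' l + g' l) \<in> rational_algebra S r"
      by (rule rational_algebra.add[OF f'(1) g'(1)])
    show "((\<lambda>l. f l + g l) has_real_derivative f' l + g' l) (at l)" if "l \<in> S" for l
      by (rule DERIV_add[OF bspec[OF f'(2) that] bspec[OF g'(2) that]])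
  qed
next
  case (mult f g)
  obtain f' where f': "f' \<in> rational_algebra S r" "\<forall>l\<in>S. (f has_real_derivative f' l) (at l)"
    using mult.IH(1) by blast
  obtain g' where g': "g' \<in> rational_algebra S r" "\<forall>l\<in>S. (g has_real_derivative g' l) (at l)"
    using mult.IH(2) by blast
  show ?case
  proof (intro bexI[of _ "\<lambda>l. f' l * g l + g' l * f l"] ballI)
    show "(\<lambda>l. f' l * g l + g' l * f l) \<in> rational_algebra S r"
      by (rule rational_algebra.add[OF rational_algebra.mult[OF f'(1) mult.hyps(2)] 
            rational_algebra.mult[OF g'(1) mult.hyps(1)]])
    show "((\<lambda>l. f l * g l) has_real_derivative f' l * g l + g' l * f l) (at l)" if "l \<in> S" for l
      by (rule DERIV_mult[OF bspec[OF f'(2) that] bspec[OF g'(2) that]])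
  qed
qed

lemma switching_coeff_smooth: "infinitely_differentiable_on switching_coeff {2<..}"
proof -
  define r where "r l = inv_tail_ratio (1 - 2 / l)" for l :: real
  define D where "D l = (2 + r l * r l) * (1 + - 2 * (1 / l)) + - 1 * (r l * r l)" for l
  define r' where "r' l = 4 * (r l * ((1 / D l) * ((1 / l) * (1 / l))))" for l
  have r: "r l > 0" "D l > 0" "(r has_real_derivative r' l) (at l)" if "l > 2" for l
  proof -
    have *: "0 < 1 - 2 / l" "1 - 2 / l < 1" using that by (auto simp: field_simps)
    have D: "D l = (2 + (r l)\<^sup>2) * (1 - 2 / l) - (r l)\<^sup>2" by (simp add: D_def power2_eq_square)
    show "r l > 0" using inv_tail_ratio(1)[OF *] by (simp add: r_def)
    show "D l > 0" using inv_tail_ratio_deriv(2)[OF *] unfolding D r_def .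
    have "((\<lambda>l. 1 - 2 / l) has_real_derivative 2 / l\<^sup>2) (at l)"
      using that by (auto intro!: derivative_eq_intros simp: power2_eq_square)
    from DERIV_chain2[OF inv_tail_ratio_deriv(1)[OF *] this]
    have "(r has_real_derivative 2 * r l / D l * (2 / l\<^sup>2)) (at l)"
      unfolding D unfolding r_def .
    then show "(r has_real_derivative r' l) (at l)"
      by (rule DERIV_cong) (simp add: r'_def power2_eq_square)
  qed
  let ?A = "rational_algebra {2<..} r"
  note ra = rational_algebra.const rational_algebra.gen rational_algebra.add rational_algebra.mult
  have recip_mem: "(\<lambda>l. 1 / l) \<in> ?A" and recip_r: "(\<lambda>l. 1 / r l) \<in> ?A"
    by (rule rational_algebra.recip[OF rational_algebra.ident] rational_algebra.recip[OF rational_algebra.gen];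
        use r in force)+
  have "D \<in> ?A" unfolding D_def[abs_def] by (intro ra recip_mem)
  then have "(\<lambda>l. 1 / D l) \<in> ?A" by (rule rational_algebra.recip) (use r in force)
  then have r': "r' \<in> ?A" unfolding r'_def[abs_def] by (intro ra recip_mem)
  have "(\<lambda>l. 1 / r l * (1 / r l)) \<in> ?A"
    by (rule rational_algebra.mult[OF recip_r recip_r])
  also have "(\<lambda>l. 1 / r l * (1 / r l)) = switching_coeff"
    by (simp add: switching_coeff_def[abs_def] r_def power2_eq_square)
  finally show ?thesis
    by (rule infinitely_differentiable_on_if_closed_family[OF open_greaterThan _ rational_algebra_closed[OF _ r' r(3)]])
       simp_all
qed

section \<open>The self-similar solution with a parabolic source\<close>

text \<open>The continuous counterpart of the problem, with all space points \<open>x\<close> switching at time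
  \<open>x\<^sup>2 / x0\<^sup>2\<close> and a unit source behind the switching front, is solved by
  \<open>t \<chi>(x / \<surd>t)\<close>.  Here \<open>\<chi>\<close> is \<open>1 - C\<^sub>1 (\<xi>\<^sup>2 + 2)\<close> behind the front and \<open>C\<^sub>2\<close> times the second
  Gaussian tail ahead of it; continuity of \<open>\<chi>\<close> and \<open>\<chi>'\<close> at the front fixes \<open>C\<^sub>1\<close> and \<open>C\<^sub>2\<close>.\<close>

definition inner_coeff :: "real \<Rightarrow> real" where
  "inner_coeff x0 = gtail1 x0 / (4 * gauss x0)"

definition outer_coeff :: "real \<Rightarrow> real" where
  "outer_coeff x0 = x0 / (4 * gauss x0)"

text \<open>The odd primitive of \<open>\<chi>\<close> is written as the polynomial valid behind the front plus a
  correction ahead of it, so that only one gluing point with zero data occurs.\<close>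
definition front_correction :: "real \<Rightarrow> real \<Rightarrow> real" where
  "front_correction x0 x = (if x \<ge> x0 then 2 * x0 / 3 - outer_coeff x0 * gtail3 x / 3
     - (x - inner_coeff x0 * (x ^ 3 / 3 + 2 * x)) else 0)"

definition front_correction' :: "real \<Rightarrow> real \<Rightarrow> real" where
  "front_correction' x0 x = (if x \<ge> x0 then outer_coeff x0 * gtail2 x
     - 1 + inner_coeff x0 * (x\<^sup>2 + 2) else 0)"

definition front_correction'' :: "real \<Rightarrow> real \<Rightarrow> real" where
  "front_correction'' x0 x = (if x \<ge> x0 then 2 * inner_coeff x0 * x - 2 * outer_coeff x0 * gtail1 x
     else 0)"

definition profile :: "real \<Rightarrow> real \<Rightarrow> real" where
  "profile x0 x = x - inner_coeff x0 * (x ^ 3 / 3 + 2 * x)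
     + front_correction x0 x - front_correction x0 (- x)"

definition profile' :: "real \<Rightarrow> real \<Rightarrow> real" where
  "profile' x0 x = 1 - inner_coeff x0 * (x\<^sup>2 + 2)
     + front_correction' x0 x + front_correction' x0 (- x)"

definition profile'' :: "real \<Rightarrow> real \<Rightarrow> real" where
  "profile'' x0 x = - 2 * inner_coeff x0 * x + front_correction'' x0 x - front_correction'' x0 (- x)"

lemma inner_coeff_pos: "x0 > 0 \<Longrightarrow> inner_coeff x0 > 0"
  using gauss_pos[of x0] gtail1_pos[of x0] by (simp add: inner_coeff_def)

lemma outer_coeff_pos: "x0 > 0 \<Longrightarrow> outer_coeff x0 > 0"
  using gauss_pos[of x0] by (simp add: outer_coeff_def)

lemma inner_coeff_eq: "inner_coeff x0 = (1 - tail_ratio x0) / 2"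
  by (simp add: one_minus_tail_ratio inner_coeff_def)

lemma matching:
  "outer_coeff x0 * gtail1 x0 = inner_coeff x0 * x0"
  "outer_coeff x0 * gtail2 x0 = 1 - inner_coeff x0 * (x0\<^sup>2 + 2)"
  "outer_coeff x0 * gtail3 x0 = 3 * (2 * x0 / 3 - (x0 - inner_coeff x0 * (x0 ^ 3 / 3 + 2 * x0)))"
proof -
  show 1: "outer_coeff x0 * gtail1 x0 = inner_coeff x0 * x0"
    by (simp add: outer_coeff_def inner_coeff_def)
  have "x0 * gtail2 x0 + (x0\<^sup>2 + 2) * gtail1 x0 = 4 * gauss x0"
    using gtail_identity[of x0] by (simp add: algebra_simps)
  then show 2: "outer_coeff x0 * gtail2 x0 = 1 - inner_coeff x0 * (x0\<^sup>2 + 2)"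
    using gauss_pos[of x0] by (simp add: outer_coeff_def inner_coeff_def field_simps)
  have "outer_coeff x0 * gtail3 x0 = 4 * (outer_coeff x0 * gtail1 x0) - x0 * (outer_coeff x0 * gtail2 x0)"
    by (simp add: gtail3_def algebra_simps)
  then show "outer_coeff x0 * gtail3 x0 = 3 * (2 * x0 / 3 - (x0 - inner_coeff x0 * (x0 ^ 3 / 3 + 2 * x0)))"
    unfolding 1 2 by (simp add: field_simps power2_eq_square power3_eq_cube)
qed

lemma DERIV_glue_zero:
  fixes f :: "real \<Rightarrow> real"
  assumes f: "\<And>x. x \<ge> x0 \<Longrightarrow> (f has_real_derivative f' x) (at x)" and 0: "f x0 = 0" "f' x0 = 0"
  shows "((\<lambda>x. if x \<ge> x0 then f x else 0) has_real_derivative (if x \<ge> x0 then f' x else 0)) (at x)"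
proof (cases x x0 rule: linorder_cases)
  case greater
  show ?thesis
    by (rule has_field_derivative_transform_within_open[of f _ _ "{x0<..}"])
       (use f[of x] greater in auto)
next
  case less
  show ?thesis
    by (rule has_field_derivative_transform_within_open[of "\<lambda>x. 0" _ _ "{..<x0}"])
       (use less in auto)
next
  case equal
  have "((\<lambda>y. (f y - f x0) / (y - x0)) \<longlongrightarrow> 0) (at x0)"
    using f[of x0] 0 by (simp add: has_field_derivative_iff)
  then have "((\<lambda>y. ((if y \<ge> x0 then f y else 0) - (if x0 \<ge> x0 then f x0 else 0)) / (y - x0)) \<longlongrightarrow> 0) (at x0)"
    by (rule Lim_null_comparison[OF _ tendsto_rabs_zero, rotated]) (simp add: 0)
  then show ?thesis
    using equal 0 by (simp add: has_field_derivative_iff)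
qed

context
  fixes x0 :: real
  assumes x0: "x0 > 0"
begin

lemma front_correction_deriv: 
  "(front_correction x0 has_real_derivative front_correction' x0 x) (at x)"
proof -
  define P where "P = (\<lambda>x. 2 * x0 / 3 - outer_coeff x0 * gtail3 x / 3 
    - (x - inner_coeff x0 * (x ^ 3 / 3 + 2 * x)))"
  define P' where "P' = (\<lambda>x. outer_coeff x0 * gtail2 x - 1 + inner_coeff x0 * (x\<^sup>2 + 2))"
  have "(P has_real_derivative P' x) (at x)" if "x \<ge> x0" for x
    unfolding P_def P'_def using that x0
    by (auto intro!: derivative_eq_intros gtail3_deriv simp: field_simps)
  moreover have "P x0 = 0" "P' x0 = 0"
    unfolding P_def P'_def matching by (simp_all add: field_simps)
  ultimately have "((\<lambda>x. if x \<ge> x0 then P x else 0) has_real_derivative (if x \<ge> x0 then P' x else 0)) (at x)"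
    by (rule DERIV_glue_zero)
  also have "(\<lambda>x. if x \<ge> x0 then P x else 0) = front_correction x0"
    by (simp add: fun_eq_iff front_correction_def P_def)
  also have "(if x \<ge> x0 then P' x else 0) = front_correction' x0 x"
    by (simp add: front_correction'_def P'_def)
  finally show ?thesis .
qed

lemma front_correction'_deriv: 
  "(front_correction' x0 has_real_derivative front_correction'' x0 x) (at x)"
proof -
  define P where "P = (\<lambda>x. outer_coeff x0 * gtail2 x - 1 + inner_coeff x0 * (x\<^sup>2 + 2))"
  define P' where "P' = (\<lambda>x. 2 * inner_coeff x0 * x - 2 * outer_coeff x0 * gtail1 x)"
  have "(P has_real_derivative P' x) (at x)" if "x \<ge> x0" for x
    unfolding P_def P'_def using that x0
    by (auto intro!: derivative_eq_intros gtail2_deriv simp: field_simps)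
  moreover have "P x0 = 0" "P' x0 = 0"
    unfolding P_def P'_def using matching[of x0] by (auto simp: algebra_simps)
  ultimately have "((\<lambda>x. if x \<ge> x0 then P x else 0) has_real_derivative (if x \<ge> x0 then P' x else 0)) (at x)"
    by (rule DERIV_glue_zero)
  also have "(\<lambda>x. if x \<ge> x0 then P x else 0) = front_correction' x0"
    by (simp add: fun_eq_iff front_correction'_def P_def)
  also have "(if x \<ge> x0 then P' x else 0) = front_correction'' x0 x"
    by (simp add: front_correction''_def P'_def)
  finally show ?thesis .
qed

lemma profile_deriv: "(profile x0 has_real_derivative profile' x0 x) (at x)"
proof -
  have *: "((\<lambda>x. front_correction x0 (- x)) has_real_derivative - front_correction' x0 (- x)) (at x)"
    using DERIV_chain2[OF front_correction_deriv[of "- x"] DERIV_minus[OF DERIV_ident]] by simp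
  have "((\<lambda>x. x - inner_coeff x0 * (x ^ 3 / 3 + 2 * x)) has_real_derivative
      1 - inner_coeff x0 * (x\<^sup>2 + 2)) (at x)"
    by (auto intro!: derivative_eq_intros)
  from DERIV_diff[OF DERIV_add[OF this front_correction_deriv] *]
  show ?thesis
    by (simp add: profile_def[abs_def] profile'_def)
qed

lemma profile'_deriv: "(profile' x0 has_real_derivative profile'' x0 x) (at x)"
proof -
  have *: "((\<lambda>x. front_correction' x0 (- x)) has_real_derivative - front_correction'' x0 (- x)) (at x)"
    using DERIV_chain2[OF front_correction'_deriv[of "- x"] DERIV_minus[OF DERIV_ident]] by simp
  have "((\<lambda>x. 1 - inner_coeff x0 * (x\<^sup>2 + 2)) has_real_derivative - 2 * inner_coeff x0 * x) (at x)"
    by (auto intro!: derivative_eq_intros)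
  from DERIV_add[OF DERIV_add[OF this front_correction'_deriv] *]
  show ?thesis
    by (simp add: profile'_def[abs_def] profile''_def)
qed

lemma front_correction_ode:
  "3 / 2 * front_correction x0 x - x / 2 * front_correction' x0 x 
    = front_correction'' x0 x - max 0 (x - x0)"
  by (simp add: front_correction_def front_correction'_def front_correction''_def gtail3_def
      field_simps power2_eq_square power3_eq_cube)

text \<open>The similarity form of the heat equation for the primitive; the source has become the
  length of the part of \<open>[0, x]\<close> behind the front.\<close>
lemma profile_ode:
  "3 / 2 * profile x0 x - x / 2 * profile' x0 x = profile'' x0 x + max (- x0) (min x x0)"
proof -
  have "3 / 2 * profile x0 x - x / 2 * profile' x0 x = x - 2 * inner_coeff x0 * x
    + (3 / 2 * front_correction x0 x - x / 2 * front_correction' x0 x)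
    - (3 / 2 * front_correction x0 (- x) - (- x) / 2 * front_correction' x0 (- x))"
    by (simp add: profile_def profile'_def field_simps power2_eq_square power3_eq_cube)
  also have "\<dots> = profile'' x0 x + (x - max 0 (x - x0) + max 0 (- x - x0))"
    unfolding front_correction_ode by (simp add: profile''_def)
  also have "x - max 0 (x - x0) + max 0 (- x - x0) = max (- x0) (min x x0)"
    using x0 by (auto simp: max_def min_def)
  finally show ?thesis .
qed

lemma profile'_inner:
  assumes "\<bar>x\<bar> \<le> x0"
  shows "profile' x0 x = 1 - inner_coeff x0 * (x\<^sup>2 + 2)"
proof -
  have "front_correction' x0 y = 0" if "y \<le> x0" for y
    using matching(2)[of x0] that by (cases "y = x0") (auto simp: front_correction'_def)
  then show ?thesis using assms by (simp add: profile'_def abs_le_iff)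
qed

lemma profile'_outer:
  assumes "x0 \<le> \<bar>x\<bar>"
  shows "profile' x0 x = outer_coeff x0 * gtail2 \<bar>x\<bar>"
  using assms x0 by (auto simp: profile'_def front_correction'_def abs_if)

lemma profile'_front_pos: "profile' x0 x0 > 0"
  using profile'_outer[of x0] x0 outer_coeff_pos[OF x0] gtail2_pos[OF x0] by simp

lemma profile''_inner:
  assumes "\<bar>x\<bar> \<le> x0"
  shows "profile'' x0 x = - 2 * inner_coeff x0 * x"
proof -
  have "front_correction'' x0 y = 0" if "y \<le> x0" for y
    using matching(1)[of x0] that by (cases "y = x0") (auto simp: front_correction''_def)
  then show ?thesis using assms by (simp add: profile''_def abs_le_iff)
qed

lemma profile''_outer:
  assumes "x0 \<le> \<bar>x\<bar>"
  shows "\<bar>profile'' x0 x\<bar> = 2 * outer_coeff x0 * gtail1 \<bar>x\<bar>"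
proof -
  have "outer_coeff x0 * gtail1 \<bar>x\<bar> > 0"
    using gtail1_pos[of "\<bar>x\<bar>"] outer_coeff_pos[OF x0] assms x0 by auto
  then show ?thesis using assms x0 outer_coeff_pos[OF x0]
    by (auto simp: profile''_def front_correction''_def abs_if mult.commute)
qed

lemma front_correction''_lipschitz:
  "\<bar>front_correction'' x0 x - front_correction'' x0 y\<bar>
     \<le> (2 * inner_coeff x0 + 2 * outer_coeff x0 * gtail0 x0) * \<bar>x - y\<bar>" (is "_ \<le> ?L * _")
proof -
  have C: "inner_coeff x0 > 0" "outer_coeff x0 > 0" "gtail0 x0 > 0"
    using inner_coeff_pos outer_coeff_pos gtail0_pos x0 by auto
  then have "?L \<ge> 0" by simp
  have main: "\<bar>front_correction'' x0 y - front_correction'' x0 x\<bar> \<le> ?L * (y - x)" 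
    if "x0 \<le> x" "x \<le> y" for x y
  proof (cases "x = y")
    case False
    then have "x < y" using that by simp
    then have "\<exists>z>x. z < y \<and> gtail1 y - gtail1 x = (y - x) * (- gtail0 z)"
      by (rule MVT2) (rule gtail1_deriv, use x0 that in linarith)
    then obtain z where z: "x < z" "gtail1 y - gtail1 x = (y - x) * (- gtail0 z)"
      by (elim exE conjE)
    have "gtail0 z \<le> gtail0 x0" "0 < gtail0 z"
      using gtail0_antimono[of x0 z] gtail0_pos[of z] x0 z that by auto
    then have "\<bar>gtail1 y - gtail1 x\<bar> \<le> (y - x) * gtail0 x0"
      using \<open>x < y\<close> unfolding z(2) by (auto simp: abs_mult intro!: mult_left_mono)
    then have "2 * outer_coeff x0 * \<bar>gtail1 y - gtail1 x\<bar> \<le> 2 * outer_coeff x0 * ((y - x) * gtail0 x0)"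
      using C by (intro mult_left_mono) auto
    moreover have "front_correction'' x0 y - front_correction'' x0 x
       = 2 * inner_coeff x0 * (y - x) - 2 * outer_coeff x0 * (gtail1 y - gtail1 x)"
      using that by (simp add: front_correction''_def algebra_simps)
    moreover have "\<bar>2 * outer_coeff x0 * (gtail1 y - gtail1 x)\<bar> = 2 * outer_coeff x0 * \<bar>gtail1 y - gtail1 x\<bar>"
      "\<bar>2 * inner_coeff x0 * (y - x)\<bar> = 2 * inner_coeff x0 * (y - x)"
      using C \<open>x < y\<close> by (simp_all add: abs_mult)
    moreover have "?L * (y - x) = 2 * inner_coeff x0 * (y - x) + 2 * outer_coeff x0 * ((y - x) * gtail0 x0)"
      by (simp add: algebra_simps)
    ultimately show ?thesis by linarith
  qed auto
  have zero: "front_correction'' x0 y = 0" if "y \<le> x0" for y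
    using matching(1)[of x0] that by (cases "y = x0") (auto simp: front_correction''_def)
  have ord: "\<bar>front_correction'' x0 y - front_correction'' x0 x\<bar> \<le> ?L * (y - x)" if "x \<le> y" for x y
  proof -
    consider "x0 \<le> x" | "y \<le> x0" | "x \<le> x0" "x0 \<le> y" by linarith
    then show ?thesis
    proof cases
      case 1 then show ?thesis using main that by auto
    next
      case 2 then show ?thesis using zero that \<open>?L \<ge> 0\<close> by auto
    next
      case 3
      have "\<bar>front_correction'' x0 y - front_correction'' x0 x\<bar> = \<bar>front_correction'' x0 y - front_correction'' x0 x0\<bar>"
        using zero[of x] zero[of x0] 3 by simp
      also have "\<dots> \<le> ?L * (y - x0)" using main[of x0 y] 3 by simp
      also have "\<dots> \<le> ?L * (y - x)" using 3 \<open>?L \<ge> 0\<close> by (intro mult_left_mono) auto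
      finally show ?thesis .
    qed
  qed
  show ?thesis
    using ord[of x y] ord[of y x] by (cases "x \<le> y") (auto simp: abs_minus_commute)
qed

lemma profile_bounds:
  obtains B where "B > 0" "\<And>x. \<bar>profile' x0 x\<bar> \<le> B" "\<And>x. \<bar>profile'' x0 x\<bar> \<le> B"
    "\<And>x y. \<bar>profile'' x0 x - profile'' x0 y\<bar> \<le> B * \<bar>x - y\<bar>"
proof -
  define c d where "c = inner_coeff x0" and "d = outer_coeff x0"
  have C: "c > 0" "d > 0" "gtail0 x0 > 0" "gtail1 x0 > 0" "gtail2 x0 > 0"
    using inner_coeff_pos outer_coeff_pos gtail0_pos gtail1_pos gtail2_pos x0 by (auto simp: c_def d_def)
  define B1 where "B1 = 1 + c * (x0\<^sup>2 + 2) + d * gtail2 x0"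
  define B2 where "B2 = 2 * c * x0 + 2 * d * gtail1 x0"
  define B3 where "B3 = 2 * c + 2 * (2 * c + 2 * d * gtail0 x0)"
  have 1: "\<bar>profile' x0 x\<bar> \<le> B1" for x
  proof (cases "\<bar>x\<bar> \<le> x0")
    case True
    have "x\<^sup>2 \<le> x0\<^sup>2" using True x0 by (metis abs_le_square_iff abs_of_pos)
    then have "0 \<le> c * (x\<^sup>2 + 2)" "c * (x\<^sup>2 + 2) \<le> c * (x0\<^sup>2 + 2)" "0 \<le> d * gtail2 x0"
      using C by (auto intro!: mult_left_mono)
    then show ?thesis
      using profile'_inner[OF True] unfolding B1_def c_def by linarith
  next
    case False
    have "0 < gtail2 \<bar>x\<bar>" "gtail2 \<bar>x\<bar> \<le> gtail2 x0"
      using gtail2_pos[of "\<bar>x\<bar>"] gtail2_antimono[of x0 "\<bar>x\<bar>"] False x0 by auto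
    then have "0 \<le> d * gtail2 \<bar>x\<bar>" "d * gtail2 \<bar>x\<bar> \<le> d * gtail2 x0" "0 \<le> c * (x0\<^sup>2 + 2)"
      using C by (auto intro!: mult_left_mono)
    then show ?thesis
      using profile'_outer[of x] False unfolding B1_def d_def by linarith
  qed
  have 2: "\<bar>profile'' x0 x\<bar> \<le> B2" for x
  proof (cases "\<bar>x\<bar> \<le> x0")
    case True
    then have "\<bar>profile'' x0 x\<bar> \<le> 2 * c * x0"
      using C profile''_inner[OF True] by (auto simp: abs_mult c_def)
    then show ?thesis using C mult_pos_pos[of d "gtail1 x0"] unfolding B2_def by linarith
  next
    case False
    have "0 < gtail1 \<bar>x\<bar>" "gtail1 \<bar>x\<bar> \<le> gtail1 x0"
      using gtail1_pos[of "\<bar>x\<bar>"] gtail1_antimono[of x0 "\<bar>x\<bar>"] False x0 by auto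
    then have "d * gtail1 \<bar>x\<bar> \<le> d * gtail1 x0" "0 \<le> c * x0"
      using C x0 by (auto intro!: mult_left_mono)
    then show ?thesis
      using profile''_outer[of x] False unfolding B2_def d_def by linarith
  qed
  have 3: "\<bar>profile'' x0 x - profile'' x0 y\<bar> \<le> B3 * \<bar>x - y\<bar>" for x y
  proof -
    have "profile'' x0 x - profile'' x0 y = - (2 * c * (x - y)) 
        + (front_correction'' x0 x - front_correction'' x0 y)
        - (front_correction'' x0 (- x) - front_correction'' x0 (- y))"
      by (simp add: profile''_def c_def algebra_simps)
    moreover have "\<bar>2 * c * (x - y)\<bar> = 2 * c * \<bar>x - y\<bar>"
      using C by (simp add: abs_mult)
    moreover have "\<bar>- x - - y\<bar> = \<bar>x - y\<bar>" by simp
    moreover note front_correction''_lipschitz[of x y] front_correction''_lipschitz[of "- x" "- y"]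
    moreover have "B3 * \<bar>x - y\<bar> = 2 * c * \<bar>x - y\<bar> + (2 * c + 2 * d * gtail0 x0) * \<bar>x - y\<bar>
       + (2 * c + 2 * d * gtail0 x0) * \<bar>x - y\<bar>"
      by (simp add: B3_def algebra_simps)
    ultimately show ?thesis unfolding c_def d_def by (simp only:) linarith
  qed
  have pos: "B1 > 0" "B2 > 0" "B3 > 0"
    unfolding B1_def B2_def B3_def using C x0 by (auto intro!: add_pos_pos add_pos_nonneg mult_pos_pos)
  show ?thesis
  proof (rule that[of "B1 + B2 + B3"])
    show "\<bar>profile' x0 x\<bar> \<le> B1 + B2 + B3" "\<bar>profile'' x0 x\<bar> \<le> B1 + B2 + B3" for x
      using 1[of x] 2[of x] pos by linarith+
    show "\<bar>profile'' x0 x - profile'' x0 y\<bar> \<le> (B1 + B2 + B3) * \<bar>x - y\<bar>" for x y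
      by (rule order_trans[OF 3]) (use pos in \<open>intro mult_right_mono, auto\<close>)
  qed (use pos in auto)
qed

end

text \<open>The second derivative is only Lipschitz because the third one of \<open>profile\<close> jumps at the front.\<close>
lemma second_difference_bound:
  fixes f :: "real \<Rightarrow> real"
  assumes f: "\<And>x. (f has_real_derivative f' x) (at x)" "\<And>x. (f' has_real_derivative f'' x) (at x)"
    and lip: "\<And>x y. \<bar>f'' x - f'' y\<bar> \<le> B * \<bar>x - y\<bar>" and "B \<ge> 0"
  shows "\<bar>f (x + 1) - 2 * f x + f (x - 1) - f'' x\<bar> \<le> 2 * B"
proof -
  define g where "g h = f (x + h) + f (x - h) - h\<^sup>2 * f'' x" for h
  define g' where "g' h = f' (x + h) - f' (x - h) - 2 * h * f'' x" for h
  have "(g has_real_derivative g' h) (at h)" for h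
  proof -
    have "((\<lambda>h. f (x + h)) has_real_derivative f' (x + h) * 1) (at h)"
      by (rule DERIV_chain2[OF f(1)]) (auto intro!: derivative_eq_intros)
    moreover have "((\<lambda>h. f (x - h)) has_real_derivative f' (x - h) * (- 1)) (at h)"
      by (rule DERIV_chain2[OF f(1)]) (auto intro!: derivative_eq_intros)
    moreover have "((\<lambda>h. h\<^sup>2 * f'' x) has_real_derivative 2 * h * f'' x) (at h)"
      by (auto intro!: derivative_eq_intros)
    ultimately have "(g has_real_derivative f' (x + h) * 1 + f' (x - h) * (- 1) - 2 * h * f'' x) (at h)"
      unfolding g_def by (intro DERIV_diff DERIV_add)
    then show ?thesis by (simp add: g'_def)
  qed
  then obtain h where h: "0 < h" "h < 1" "g 1 - g 0 = (1 - 0) * g' h"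
    using MVT2[of 0 1 g g'] by auto
  obtain z where z: "x - h < z" "z < x + h" "f' (x + h) - f' (x - h) = (x + h - (x - h)) * f'' z"
    using MVT2[of "x - h" "x + h" f' f''] f(2) h by auto
  have "g' h = 2 * h * (f'' z - f'' x)"
    unfolding g'_def z(3) by (simp add: algebra_simps)
  then have "\<bar>g' h\<bar> = 2 * h * \<bar>f'' z - f'' x\<bar>" using h by (simp add: abs_mult)
  also have "\<dots> \<le> 2 * 1 * (B * 1)"
  proof (intro mult_mono)
    have "\<bar>f'' z - f'' x\<bar> \<le> B * \<bar>z - x\<bar>" by (rule lip)
    also have "\<dots> \<le> B * 1" using z h \<open>B \<ge> 0\<close> by (intro mult_left_mono) auto
    finally show "\<bar>f'' z - f'' x\<bar> \<le> B * 1" .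
  qed (use h in auto)
  finally show ?thesis
    using h(3) by (simp add: g_def)
qed

text \<open>The parabolic rescaling of the profile; its space derivative is the self-similar solution.\<close>
definition spread :: "real \<Rightarrow> real \<Rightarrow> real \<Rightarrow> real" where
  "spread x0 x t = t * sqrt t * profile x0 (x / sqrt t)"

lemma spread_space_deriv:
  assumes "x0 > 0" "t > 0"
  shows "((\<lambda>x. spread x0 x t) has_real_derivative t * profile' x0 (x / sqrt t)) (at x)"
    and "((\<lambda>x. t * profile' x0 (x / sqrt t)) has_real_derivative sqrt t * profile'' x0 (x / sqrt t)) (at x)"
proof -
  have d: "((\<lambda>x. x / sqrt t) has_real_derivative 1 / sqrt t) (at x)"
    by (rule DERIV_cdivide[OF DERIV_ident])
  define w where "w = sqrt t"
  have w: "w > 0" "t = w * w" using assms(2) by (auto simp: w_def)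
  have "((\<lambda>x. spread x0 x t) has_real_derivative t * sqrt t * (profile' x0 (x / sqrt t) * (1 / sqrt t))) (at x)"
    unfolding spread_def
    by (rule DERIV_cmult[OF DERIV_chain2[OF profile_deriv[OF assms(1)] d]])
  moreover have "t * sqrt t * (profile' x0 (x / sqrt t) * (1 / sqrt t)) = t * profile' x0 (x / sqrt t)"
    unfolding w_def[symmetric] using w(1) by simp
  ultimately show "((\<lambda>x. spread x0 x t) has_real_derivative t * profile' x0 (x / sqrt t)) (at x)"
    by (rule DERIV_cong)
  have "((\<lambda>x. t * profile' x0 (x / sqrt t)) has_real_derivative 
      t * (profile'' x0 (x / sqrt t) * (1 / sqrt t))) (at x)"
    by (rule DERIV_cmult[OF DERIV_chain2[OF profile'_deriv[OF assms(1)] d]])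
  moreover have "t * (profile'' x0 (x / sqrt t) * (1 / sqrt t)) = sqrt t * profile'' x0 (x / sqrt t)"
    unfolding w_def[symmetric] using w(1) by (simp add: w(2) mult.assoc)
  ultimately show "((\<lambda>x. t * profile' x0 (x / sqrt t)) has_real_derivative sqrt t * profile'' x0 (x / sqrt t)) (at x)"
    by (rule DERIV_cong)
qed

lemma spread_time_deriv:
  assumes "x0 > 0" "t > 0"
  shows "((\<lambda>t. spread x0 x t) has_real_derivative
     sqrt t * profile'' x0 (x / sqrt t) + max (- (x0 * sqrt t)) (min x (x0 * sqrt t))) (at t)"
proof -
  define w y where "w = sqrt t" and "y = x / w"
  have w: "w > 0" "t = w * w" using assms by (auto simp: w_def)
  have x: "x = y * w" using w by (simp add: y_def)
  have d: "(sqrt has_real_derivative inverse w / 2) (at t)"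
    using DERIV_real_sqrt[OF assms(2)] by (simp only: w_def)
  have "((\<lambda>t. x * inverse (sqrt t)) has_real_derivative x * - (inverse w * (inverse w / 2) * inverse w)) (at t)"
    using DERIV_cmult[OF DERIV_inverse'[OF d]] w(1) by (simp only: w_def)
  moreover have "x * - (inverse w * (inverse w / 2) * inverse w) = - y / (2 * (w * w))"
    unfolding x using w(1) by (simp add: field_simps)
  ultimately have "((\<lambda>t. x / sqrt t) has_real_derivative - y / (2 * (w * w))) (at t)"
    by (simp only: divide_inverse[of x])
  from DERIV_chain2[OF profile_deriv[OF assms(1)] this]
  have p: "((\<lambda>t. profile x0 (x / sqrt t)) has_real_derivative profile' x0 y * (- y / (2 * (w * w)))) (at t)"
    by (simp only: y_def w_def)
  have "((\<lambda>t. spread x0 x t) has_real_derivative 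
     (1 * w + inverse w / 2 * t) * profile x0 y + profile' x0 y * (- y / (2 * (w * w))) * (t * w)) (at t)"
    unfolding spread_def using DERIV_mult[OF DERIV_mult[OF DERIV_ident d] p] by (simp only: y_def w_def)
  also have "(1 * w + inverse w / 2 * t) * profile x0 y + profile' x0 y * (- y / (2 * (w * w))) * (t * w)
     = w * (3 / 2 * profile x0 y - y / 2 * profile' x0 y)"
    unfolding w(2) using w(1) by (simp add: field_simps)
  also have "\<dots> = w * profile'' x0 y + w * max (- x0) (min y x0)"
    unfolding profile_ode[OF assms(1)] by (simp only: distrib_left)
  also have "w * max (- x0) (min y x0) = max (- (x0 * w)) (min x (x0 * w))"
  proof -
    have "w * max u v = max (u * w) (v * w)" "min u v * w = min (u * w) (v * w)" for u v
      using w(1) by (simp_all add: max_def min_def)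
    then show ?thesis by (simp only: x mult_minus_left)
  qed
  finally show ?thesis unfolding y_def w_def .
qed

text \<open>The last two bounds control the discretisation error and the replacement of averages over
  windows of length \<open>r\<close> by point values.\<close>
lemma spread_bounds:
  assumes x0: "x0 > 0"
  obtains B where "B > 0" 
    "\<And>x y t. t > 0 \<Longrightarrow> \<bar>spread x0 x t - spread x0 y t\<bar> \<le> B * t * \<bar>x - y\<bar>"
    "\<And>x t. t > 0 \<Longrightarrow> \<bar>spread x0 (x + 1) t - 2 * spread x0 x t + spread x0 (x - 1) t 
                - sqrt t * profile'' x0 (x / sqrt t)\<bar> \<le> 2 * B"
    "\<And>x r t. t > 0 \<Longrightarrow> r \<ge> 0 \<Longrightarrow> \<bar>spread x0 (x + r) t - spread x0 x t - r * (t * profile' x0 (x / sqrt t))\<bar>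
                 \<le> B * r\<^sup>2 * sqrt t"
proof -
  obtain A where A: "A > 0" "\<And>x. \<bar>profile' x0 x\<bar> \<le> A" "\<And>x. \<bar>profile'' x0 x\<bar> \<le> A"
    "\<And>x y. \<bar>profile'' x0 x - profile'' x0 y\<bar> \<le> A * \<bar>x - y\<bar>"
    using profile_bounds[OF x0] by metis
  have lip: "\<bar>f x - f y\<bar> \<le> C * \<bar>x - y\<bar>" 
    if "\<And>x. (f has_real_derivative f' x) (at x)" "\<And>x. \<bar>f' x\<bar> \<le> C" 
    for f f' :: "real \<Rightarrow> real" and C x y
    using field_differentiable_bound[of UNIV f f' C x y] that by (simp add: has_field_derivative_at_within)
  have 1: "\<bar>profile' x0 x - profile' x0 y\<bar> \<le> A * \<bar>x - y\<bar>" for x y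
    by (rule lip[OF profile'_deriv[OF x0] A(3)])
  have 2: "\<bar>spread x0 x t - spread x0 y t\<bar> \<le> A * t * \<bar>x - y\<bar>" if "t > 0" for x y t
  proof (rule lip[OF spread_space_deriv(1)[OF x0 that]])
    show "\<bar>t * profile' x0 (z / sqrt t)\<bar> \<le> A * t" for z
      using A(2)[of "z / sqrt t"] that by (simp add: abs_mult mult.commute)
  qed
  have 3: "\<bar>spread x0 (x + 1) t - 2 * spread x0 x t + spread x0 (x - 1) t 
                - sqrt t * profile'' x0 (x / sqrt t)\<bar> \<le> 2 * A" if "t > 0" for x t
  proof (rule second_difference_bound[OF spread_space_deriv[OF x0 that]])
    fix y z
    define w where "w = sqrt t"
    have w: "w > 0" using that by (simp add: w_def)
    have "\<bar>w * profile'' x0 (y / w) - w * profile'' x0 (z / w)\<bar> = w * \<bar>profile'' x0 (y / w) - profile'' x0 (z / w)\<bar>"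
      using w by (simp add: abs_mult flip: right_diff_distrib)
    also have "\<dots> \<le> w * (A * \<bar>y / w - z / w\<bar>)"
      using w A(4) by (intro mult_left_mono) auto
    also have "\<bar>y / w - z / w\<bar> = \<bar>y - z\<bar> / w"
      using w by (simp add: abs_divide flip: diff_divide_distrib)
    also have "w * (A * (\<bar>y - z\<bar> / w)) = A * \<bar>y - z\<bar>"
      using w by simp
    finally show "\<bar>sqrt t * profile'' x0 (y / sqrt t) - sqrt t * profile'' x0 (z / sqrt t)\<bar> \<le> A * \<bar>y - z\<bar>"
      unfolding w_def .
  qed (use A in simp)
  have 4: "\<bar>spread x0 (x + r) t - spread x0 x t - r * (t * profile' x0 (x / sqrt t))\<bar> \<le> A * r\<^sup>2 * sqrt t"
    if "t > 0" "r \<ge> 0" for x r t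
  proof (cases "r = 0")
    case False
    then have "r > 0" using that by simp
    define w where "w = sqrt t"
    have w: "w > 0" "t = w * w" using that by (simp_all add: w_def)
    have "\<exists>z>x. z < x + r \<and> spread x0 (x + r) t - spread x0 x t = (x + r - x) * (t * profile' x0 (z / sqrt t))"
      using \<open>r > 0\<close> by (intro MVT2 spread_space_deriv(1)[OF x0 \<open>t > 0\<close>]) auto
    then obtain z where z: "x < z" "z < x + r" 
      "spread x0 (x + r) t - spread x0 x t = r * (t * profile' x0 (z / w))"
      unfolding w_def by auto
    have "\<bar>spread x0 (x + r) t - spread x0 x t - r * (t * profile' x0 (x / w))\<bar>
       = \<bar>(r * t) * (profile' x0 (z / w) - profile' x0 (x / w))\<bar>"
      unfolding z(3) by (simp add: algebra_simps)
    also have "\<dots> = (r * t) * \<bar>profile' x0 (z / w) - profile' x0 (x / w)\<bar>"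
      using that by (simp add: abs_mult)
    also have "\<dots> \<le> (r * t) * (A * (r / w))"
    proof (intro mult_left_mono)
      have "\<bar>profile' x0 (z / w) - profile' x0 (x / w)\<bar> \<le> A * \<bar>z / w - x / w\<bar>" by (rule 1)
      also have "\<bar>z / w - x / w\<bar> = (z - x) / w"
        using w z by (simp add: abs_divide flip: diff_divide_distrib)
      also have "A * ((z - x) / w) \<le> A * (r / w)"
        using w z A by (intro mult_left_mono divide_right_mono) auto
      finally show "\<bar>profile' x0 (z / w) - profile' x0 (x / w)\<bar> \<le> A * (r / w)" .
    qed (use that in auto)
    also have "(r * t) * (A * (r / w)) = A * r\<^sup>2 * w"
      using w by (simp add: field_simps power2_eq_square)
    finally show ?thesis unfolding w_def .
  qed auto
  show ?thesis by (rule that[OF A(1) 2 3 4])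
qed

section \<open>A maximum principle on the lattice\<close>

lemma nonincreasing_off_finite:
  fixes f :: "real \<Rightarrow> real"
  assumes "finite F" "a \<le> b" "continuous_on {a..b} f"
    and der: "\<And>t. t \<in> {a<..<b} - F \<Longrightarrow> \<exists>D. (f has_real_derivative D) (at t) \<and> D \<le> 0"
  shows "f b \<le> f a"
proof -
  obtain D where D: "\<And>t. t \<in> {a<..<b} - F \<Longrightarrow> (f has_real_derivative D t) (at t) \<and> D t \<le> 0"
    using der by metis
  define f' where "f' t = (if t \<in> {a<..<b} - F then D t else 0)" for t
  have "(f' has_integral (f b - f a)) {a..b}"
  proof (rule fundamental_theorem_of_calculus_interior_strong[OF assms(1,2) _ assms(3)])
    fix t assume "t \<in> {a<..<b} - F"
    then show "(f has_vector_derivative f' t) (at t)"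
      using D[of t] by (simp add: f'_def has_real_derivative_iff_has_vector_derivative)
  qed
  from has_integral_neg[OF this] have "0 \<le> - (f b - f a)"
    by (rule has_integral_nonneg) (use D in \<open>auto simp: f'_def\<close>)
  then show ?thesis by simp
qed

lemma exp_abs_shift:
  fixes n :: int
  assumes "\<alpha> \<ge> 0" "\<bar>m - n\<bar> \<le> 1"
  shows "exp (\<alpha> * real_of_int \<bar>m\<bar>) \<le> exp \<alpha> * exp (\<alpha> * real_of_int \<bar>n\<bar>)"
proof -
  have "\<alpha> * real_of_int \<bar>m\<bar> \<le> \<alpha> * (1 + real_of_int \<bar>n\<bar>)"
    using assms by (intro mult_left_mono) linarith+
  then show ?thesis by (simp add: algebra_simps flip: exp_add)
qed

text \<open>Since \<open>e\<^bsup>2t\<^esup> w\<close> grows at most at the rate of the sum of its two neighbours, an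
  exponential bound in space improves under iteration by factors \<open>(C t)\<^sup>k / k!\<close>.  The integration
  in time behind each step does not see the finitely many exceptional times.\<close>
lemma lattice_maximum_principle:
  fixes w :: "int \<Rightarrow> real \<Rightarrow> real"
  assumes "finite F" and cont: "\<And>n. continuous_on {t0..t1} (w n)"
    and der: "\<And>n t. t \<in> {t0<..<t1} - F \<Longrightarrow>
      \<exists>D. (w n has_real_derivative D) (at t) \<and> D \<le> lattice_laplacian (\<lambda>m. w m t) n"
    and init: "\<And>n. w n t0 \<le> 0"
    and growth: "\<And>n t. t \<in> {t0..t1} \<Longrightarrow> w n t \<le> A * exp (\<alpha> * real_of_int \<bar>n\<bar>)"
    and "A \<ge> 0" "\<alpha> \<ge> 0" and t: "t \<in> {t0..t1}"
  shows "w n t \<le> 0"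
proof -
  define z where "z n t = exp (2 * (t - t0)) * w n t" for n t
  define B where "B = exp (2 * (t1 - t0)) * A"
  define C where "C = 2 * exp \<alpha>"
  define g where "g n = B * exp (\<alpha> * real_of_int \<bar>n\<bar>)" for n :: int
  have "B \<ge> 0" using \<open>A \<ge> 0\<close> by (simp add: B_def)
  have g: "g (n - 1) + g (n + 1) \<le> C * g n" for n
  proof -
    have "g (n - 1) \<le> B * (exp \<alpha> * exp (\<alpha> * real_of_int \<bar>n\<bar>))"
      "g (n + 1) \<le> B * (exp \<alpha> * exp (\<alpha> * real_of_int \<bar>n\<bar>))"
      unfolding g_def by (rule mult_left_mono[OF exp_abs_shift[OF \<open>\<alpha> \<ge> 0\<close>] \<open>B \<ge> 0\<close>], simp)+
    then show ?thesis by (simp add: g_def C_def algebra_simps)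
  qed
  have z_cont: "continuous_on {t0..t1} (z n)" for n
    unfolding z_def by (intro continuous_intros cont)
  have bound: "z n t \<le> g n * (C * (t - t0)) ^ k / fact k" if "t \<in> {t0..t1}" for n k t
    using that
  proof (induction k arbitrary: n t)
    case 0
    have "z n t \<le> exp (2 * (t - t0)) * (A * exp (\<alpha> * real_of_int \<bar>n\<bar>))"
      unfolding z_def using growth[OF 0] by (intro mult_left_mono) auto
    also have "\<dots> \<le> exp (2 * (t1 - t0)) * (A * exp (\<alpha> * real_of_int \<bar>n\<bar>))"
      using 0 \<open>A \<ge> 0\<close> by (intro mult_right_mono) auto
    finally show ?case by (simp add: g_def B_def)
  next
    case (Suc k)
    define f where "f s = z n s - g n * (C * (s - t0)) ^ Suc k / fact (Suc k)" for s
    have "f t \<le> f t0"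
    proof (rule nonincreasing_off_finite[where f = f and a = t0 and b = t, OF \<open>finite F\<close>])
      show "continuous_on {t0..t} f"
        unfolding f_def using Suc.prems
        by (intro continuous_intros continuous_on_subset[OF z_cont]) auto
      fix s assume s: "s \<in> {t0<..<t} - F"
      with Suc.prems have s': "s \<in> {t0<..<t1} - F" by auto
      obtain D where D: "(w n has_real_derivative D) (at s)" "D \<le> lattice_laplacian (\<lambda>m. w m s) n"
        using der[OF s'] by blast
      define p where "p = (C * (s - t0)) ^ k / fact k"
      have "p \<ge> 0" using s by (simp add: p_def C_def)
      have 1: "(z n has_real_derivative 2 * exp (2 * (s - t0)) * w n s + D * exp (2 * (s - t0))) (at s)"
      proof -
        have "((\<lambda>s. exp (2 * (s - t0))) has_real_derivative 2 * exp (2 * (s - t0))) (at s)"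
          by (auto intro!: derivative_eq_intros)
        from DERIV_mult[OF this D(1)] show ?thesis by (simp add: z_def[abs_def])
      qed
      have 2: "((\<lambda>s. g n * (C * (s - t0)) ^ Suc k / fact (Suc k)) has_real_derivative g n * (C * p)) (at s)"
      proof -
        have "((\<lambda>s. C * (s - t0)) has_real_derivative C) (at s)"
          by (auto intro!: derivative_eq_intros)
        from DERIV_power[OF this, of "Suc k"]
        have "((\<lambda>s. (C * (s - t0)) ^ Suc k) has_real_derivative 
            real (Suc k) * (C * (C * (s - t0)) ^ k)) (at s)" by simp
        from DERIV_cdivide[OF DERIV_cmult[OF this, of "g n"], of "fact (Suc k)"]
        show ?thesis
          by (rule DERIV_cong) (simp add: p_def field_simps del: of_nat_Suc)
      qed
      have "2 * exp (2 * (s - t0)) * w n s + D * exp (2 * (s - t0)) 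
         \<le> 2 * exp (2 * (s - t0)) * w n s + lattice_laplacian (\<lambda>m. w m s) n * exp (2 * (s - t0))"
        using D(2) by (intro add_left_mono mult_right_mono) auto
      also have "\<dots> = z (n - 1) s + z (n + 1) s"
        by (simp add: lattice_laplacian_def z_def algebra_simps)
      also have "\<dots> \<le> g (n - 1) * p + g (n + 1) * p"
        using Suc.IH[of s "n - 1"] Suc.IH[of s "n + 1"] s' by (simp add: p_def)
      also have "\<dots> \<le> C * g n * p"
        using mult_right_mono[OF g[of n] \<open>p \<ge> 0\<close>] by (simp add: algebra_simps)
      finally have "2 * exp (2 * (s - t0)) * w n s + D * exp (2 * (s - t0)) - g n * (C * p) \<le> 0"
        by (simp add: algebra_simps)
      then show "\<exists>D. (f has_real_derivative D) (at s) \<and> D \<le> 0"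
        unfolding f_def using DERIV_diff[OF 1 2] by blast
    qed (use Suc.prems in auto)
    also have "f t0 \<le> 0" using init[of n] by (simp add: f_def z_def)
    finally show ?case by (simp add: f_def)
  qed
  have "(\<lambda>k. g n * ((C * (t - t0)) ^ k /\<^sub>R fact k)) \<longlonglongrightarrow> g n * 0"
    by (intro tendsto_mult tendsto_const summable_LIMSEQ_zero summable_exp_generic)
  then have "(\<lambda>k. g n * (C * (t - t0)) ^ k / fact k) \<longlonglongrightarrow> 0"
    by (simp add: divide_inverse mult_ac)
  then have "z n t \<le> 0"
    by (rule LIMSEQ_le_const) (use bound[OF t] in auto)
  then show ?thesis by (simp add: z_def mult_le_0_iff)
qed

lemma lattice_comparison:
  fixes w :: "int \<Rightarrow> real \<Rightarrow> real"
  assumes "finite F" and cont: "\<And>n. continuous_on {t0..t1} (w n)"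
    and der: "\<And>n t. t \<in> {t0<..<t1} - F \<Longrightarrow>
      \<exists>D. (w n has_real_derivative D) (at t) \<and> D \<le> lattice_laplacian (\<lambda>m. w m t) n + \<kappa>"
    and init: "\<And>n. w n t0 \<le> 0"
    and growth: "\<And>n t. t \<in> {t0..t1} \<Longrightarrow> w n t \<le> A * exp (\<alpha> * real_of_int \<bar>n\<bar>)"
    and "A \<ge> 0" "\<alpha> \<ge> 0" "\<kappa> \<ge> 0" and t: "t \<in> {t0..t1}"
  shows "w n t \<le> \<kappa> * (t - t0)"
proof -
  have "w n t - \<kappa> * (t - t0) \<le> 0"
  proof (rule lattice_maximum_principle[where w = "\<lambda>n t. w n t - \<kappa> * (t - t0)", 
        OF \<open>finite F\<close> _ _ _ _ \<open>A \<ge> 0\<close> \<open>\<alpha> \<ge> 0\<close> t])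
    show "continuous_on {t0..t1} (\<lambda>t. w n t - \<kappa> * (t - t0))" for n
      by (intro continuous_intros cont)
    show "w n t0 - \<kappa> * (t0 - t0) \<le> 0" for n using init by simp
    show "w n t - \<kappa> * (t - t0) \<le> A * exp (\<alpha> * real_of_int \<bar>n\<bar>)" if "t \<in> {t0..t1}" for n t
    proof -
      have "\<kappa> * (t - t0) \<ge> 0" using that \<open>\<kappa> \<ge> 0\<close> by simp
      with growth[OF that, of n] show ?thesis by linarith
    qed
    fix n t assume "t \<in> {t0<..<t1} - F"
    then obtain D where D: "(w n has_real_derivative D) (at t)" "D \<le> lattice_laplacian (\<lambda>m. w m t) n + \<kappa>"
      using der by blast
    have "((\<lambda>t. \<kappa> * (t - t0)) has_real_derivative \<kappa>) (at t)"
      by (auto intro!: derivative_eq_intros)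
    from DERIV_diff[OF D(1) this]
    have "((\<lambda>t. w n t - \<kappa> * (t - t0)) has_real_derivative D - \<kappa>) (at t)" .
    moreover have "D - \<kappa> \<le> lattice_laplacian (\<lambda>m. w m t - \<kappa> * (t - t0)) n"
      using D(2) by (simp add: lattice_laplacian_def)
    ultimately show "\<exists>D. ((\<lambda>t. w n t - \<kappa> * (t - t0)) has_real_derivative D) (at t) \<and>
        D \<le> lattice_laplacian (\<lambda>m. w m t - \<kappa> * (t - t0)) n"
      by blast
  qed
  then show ?thesis by simp
qed


section \<open>Solutions with hysteresis\<close>

text \<open>A jump of the hysteresis inside an interval where the solution is continuously
  differentiable would make the derivative jump; so switching happens only at partition points.\<close>
lemma hysteresis_constant:
  assumes "0 \<le> a" "a < t" "t < b" "h1 > 0" "h2 \<ge> 0"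
    and C1: "C1_closed_interval a b r" and r: "continuous_on {0..b} r" and g: "continuous_on {a..b} g"
    and der: "\<And>t. t \<in> {a<..<b} \<Longrightarrow> (r has_real_derivative g t + hysteresis h1 h2 r t) (at t)"
  shows "hysteresis h1 h2 r t = hysteresis h1 h2 r a"
proof (cases "\<forall>s\<in>{0..a}. r s < 0")
  case False
  then have "\<not> (\<forall>s\<in>{0..t}. r s < 0)" using assms(2) by force
  then show ?thesis using False by (simp only: hysteresis_def if_False)
next
  case neg: True
  have "\<forall>s\<in>{0..t}. r s < 0"
  proof (rule ccontr)
    assume "\<not> (\<forall>s\<in>{0..t}. r s < 0)"
    then obtain s0 where s0: "s0 \<in> {0..t}" "r s0 \<ge> 0" by force
    define S where "S = {s \<in> {0..t}. r s \<ge> 0}"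
    have "compact S"
    proof -
      have "continuous_on {0..t} r" by (rule continuous_on_subset[OF r]) (use assms in auto)
      then have "closed ({0..t} \<inter> r -` {0..})"
        by (intro continuous_closed_preimage closed_atLeast closed_atLeastAtMost)
      moreover have "S = {0..t} \<inter> ({0..t} \<inter> r -` {0..})" by (auto simp: S_def)
      ultimately show ?thesis using compact_Int_closed[OF compact_Icc] by metis
    qed
    moreover have "S \<noteq> {}" using s0 by (auto simp: S_def)
    ultimately obtain \<tau> where \<tau>: "\<tau> \<in> S" "\<And>s. s \<in> S \<Longrightarrow> \<tau> \<le> s"
      using compact_attains_inf[of S] by blast
    have "a < \<tau>"
    proof (rule ccontr)
      assume "\<not> a < \<tau>"
      then have "r \<tau> < 0" using neg \<tau>(1) by (auto simp: S_def)
      then show False using \<tau>(1) by (simp add: S_def)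
    qed
    have "\<tau> < b" using \<tau>(1) assms by (auto simp: S_def)
    obtain f' where f': "\<And>t. t \<in> {a..b} \<Longrightarrow> (r has_real_derivative f' t) (at t within {a..b})"
      "continuous_on {a..b} f'"
      using C1 unfolding C1_closed_interval_def by blast
    have eq: "f' s - g s = hysteresis h1 h2 r s" if "s \<in> {a<..<b}" for s
    proof -
      have "(r has_real_derivative f' s) (at s)"
        using f'(1)[of s] that at_within_Icc_at[of a s b] by simp
      from DERIV_unique[OF this der[OF that]] show ?thesis by simp
    qed
    have closure: "closure {a<..<\<tau>} = {a..\<tau>}" using \<open>a < \<tau>\<close> by simp
    have "continuous_on (closure {a<..<\<tau>}) (\<lambda>s. f' s - g s)"
      unfolding closure using \<open>\<tau> < b\<close>
      by (intro continuous_intros continuous_on_subset[OF f'(2)] continuous_on_subset[OF g]) auto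
    moreover have "f' s - g s = h1" if "s \<in> {a<..<\<tau>}" for s
    proof -
      have "r s' < 0" if "s' \<in> {0..s}" for s'
      proof (rule ccontr)
        assume "\<not> r s' < 0"
        then have "s' \<in> S" using that \<open>s \<in> {a<..<\<tau>}\<close> \<tau>(1) by (auto simp: S_def)
        then show False using \<tau>(2)[of s'] that \<open>s \<in> {a<..<\<tau>}\<close> by simp
      qed
      then show ?thesis using eq[of s] that \<open>\<tau> < b\<close> by (simp add: hysteresis_def)
    qed
    moreover have "\<tau> \<in> closure {a<..<\<tau>}" unfolding closure using \<open>a < \<tau>\<close> by simp
    ultimately have "f' \<tau> - g \<tau> = h1"
      by (rule continuous_constant_on_closure)
    moreover have "hysteresis h1 h2 r \<tau> = - h2"
    proof -
      have "\<tau> \<in> {0..\<tau>}" "\<not> r \<tau> < 0" using \<tau>(1) by (auto simp: S_def)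
      then have "\<not> (\<forall>s\<in>{0..\<tau>}. r s < 0)" by blast
      then show ?thesis by (simp only: hysteresis_def if_False)
    qed
    ultimately show False
      using eq[of \<tau>] \<open>a < \<tau>\<close> \<open>\<tau> < b\<close> \<open>h1 > 0\<close> \<open>h2 \<ge> 0\<close> by simp
  qed
  then show ?thesis using neg by (simp add: hysteresis_def)
qed

locale hysteresis_lattice =
  fixes h1 h2 c :: real and u :: "int \<Rightarrow> real \<Rightarrow> real"
  assumes h2: "0 \<le> h2" and c: "0 < c" and h1: "2 * c < h1"
    and sol: "global_solution h1 h2 c u"
begin

lemma h1_pos: "h1 > 0" and h12_pos: "h1 + h2 > 0"
  using c h1 h2 by auto

lemma u_cont: "continuous_on {0..T} (u n)"
proof (cases "T > 0")
  case True
  then show ?thesis using sol by (auto simp: global_solution_def solution_on_def)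
next
  case False
  have "continuous_on {0..1} (u n)" using sol by (auto simp: global_solution_def solution_on_def)
  then show ?thesis by (rule continuous_on_subset) (use False in auto)
qed

lemma u_init: "u n 0 = - c * (real_of_int n)\<^sup>2"
proof -
  have "solution_on h1 h2 c 1 u" using sol by (auto simp: global_solution_def)
  then show ?thesis by (auto simp: solution_on_def)
qed

lemma u_growth:
  assumes "T > 0"
  obtains A \<alpha> where "A \<ge> 0" "\<alpha> \<ge> 0" 
    "\<And>n t. t \<in> {0..T} \<Longrightarrow> \<bar>u n t\<bar> \<le> A * exp (\<alpha> * real_of_int \<bar>n\<bar>)"
proof -
  have "solution_on h1 h2 c T u" using sol assms by (auto simp: global_solution_def)
  then obtain A \<alpha> where A: "A \<ge> 0" "\<alpha> \<ge> 0" 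
    "\<And>n. (SUP s\<in>{0..T}. \<bar>u n s\<bar>) \<le> A * exp (\<alpha> * real_of_int \<bar>n\<bar>)"
    using assms unfolding solution_on_def by (metis atLeastAtMost_iff less_imp_le order_refl)
  have "\<bar>u n t\<bar> \<le> A * exp (\<alpha> * real_of_int \<bar>n\<bar>)" if "t \<in> {0..T}" for n t
  proof (rule order_trans[OF cSUP_upper[OF that] A(3)])
    have "compact ((\<lambda>s. \<bar>u n s\<bar>) ` {0..T})"
      by (intro compact_continuous_image continuous_intros u_cont compact_Icc)
    then show "bdd_above ((\<lambda>s. \<bar>u n s\<bar>) ` {0..T})"
      by (intro bounded_imp_bdd_above compact_imp_bounded)
  qed
  with A show ?thesis using that by blast
qed

text \<open>Finitely many times, common to all nodes, off which the equations hold; a choice is fixed for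
  each \<open>T\<close> so that the equations derived below share it.\<close>
definition exceptional_times :: "real \<Rightarrow> real set" where
  "exceptional_times T = (SOME F. finite F \<and> (\<forall>n. \<forall>t\<in>{0<..<T} - F.
    (u n has_real_derivative lattice_laplacian (\<lambda>m. u m t) n + hysteresis h1 h2 (u n) t) (at t)))"

lemma u_deriv:
  assumes "T > 0"
  shows "finite (exceptional_times T)" and "t \<in> {0<..<T} - exceptional_times T \<Longrightarrow>
    (u n has_real_derivative lattice_laplacian (\<lambda>m. u m t) n + hysteresis h1 h2 (u n) t) (at t)"
proof -
  have "solution_on h1 h2 c T u" using sol assms by (auto simp: global_solution_def)
  then obtain J :: nat and \<theta> :: "nat \<Rightarrow> real" where \<theta>: "\<theta> 0 = 0" "\<theta> J = T" and
    der: "\<And>n j t. j < J \<Longrightarrow> t \<in> {\<theta> j<..<\<theta> (Suc j)} \<Longrightarrow>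
      (u n has_real_derivative lattice_laplacian (\<lambda>m. u m t) n + hysteresis h1 h2 (u n) t) (at t)"
    unfolding solution_on_def by blast
  have "\<exists>F. finite F \<and> (\<forall>n. \<forall>t\<in>{0<..<T} - F.
    (u n has_real_derivative lattice_laplacian (\<lambda>m. u m t) n + hysteresis h1 h2 (u n) t) (at t))"
  proof (intro exI[of _ "\<theta> ` {..J}"] conjI allI ballI)
    fix n t assume t: "t \<in> {0<..<T} - \<theta> ` {..J}"
    define i where "i = (LEAST j. t < \<theta> j)"
    have i: "t < \<theta> i" "i \<le> J"
      unfolding i_def using t \<theta> by (auto intro: LeastI[of _ J] Least_le)
    then obtain j where j: "i = Suc j" using t \<theta> by (cases i) auto
    have "\<not> t < \<theta> j" using not_less_Least[of j "\<lambda>j. t < \<theta> j"] j by (simp add: i_def)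
    moreover have "t \<noteq> \<theta> j" using t i j by auto
    ultimately show "(u n has_real_derivative lattice_laplacian (\<lambda>m. u m t) n + hysteresis h1 h2 (u n) t) (at t)"
      using i j by (intro der[of j]) auto
  qed auto
  note * = someI_ex[OF this, folded exceptional_times_def]
  show "finite (exceptional_times T)" using * by blast
  show "t \<in> {0<..<T} - exceptional_times T \<Longrightarrow>
    (u n has_real_derivative lattice_laplacian (\<lambda>m. u m t) n + hysteresis h1 h2 (u n) t) (at t)"
    using * by blast
qed

text \<open>The reflected solution has the same partition and, inductively, the same history at each
  partition point; hence the same constant hysteresis until the next one, so that the
  difference solves the homogeneous linear equation.\<close>
lemma u_symmetric:
  assumes "t \<ge> 0"
  shows "u (- n) t = u n t"
proof -
  define T where "T = t + 1"
  have "T > 0" using assms by (simp add: T_def)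
  then have "solution_on h1 h2 c T u" using sol by (auto simp: global_solution_def)
  then obtain J :: nat and \<theta> :: "nat \<Rightarrow> real" where \<theta>: "\<theta> 0 = 0" "\<theta> J = T" "\<forall>j<J. \<theta> j < \<theta> (Suc j)" and
    C1: "\<And>n j. j < J \<Longrightarrow> C1_closed_interval (\<theta> j) (\<theta> (Suc j)) (u n)" and
    der: "\<And>n j t. j < J \<Longrightarrow> t \<in> {\<theta> j<..<\<theta> (Suc j)} \<Longrightarrow>
      (u n has_real_derivative lattice_laplacian (\<lambda>m. u m t) n + hysteresis h1 h2 (u n) t) (at t)"
    unfolding solution_on_def by blast
  obtain A \<alpha> where A: "A \<ge> 0" "\<alpha> \<ge> 0" 
    "\<And>n t. t \<in> {0..T} \<Longrightarrow> \<bar>u n t\<bar> \<le> A * exp (\<alpha> * real_of_int \<bar>n\<bar>)"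
    using u_growth[OF \<open>T > 0\<close>] by blast
  have \<theta>_mono: "\<theta> i \<le> \<theta> j" if "i \<le> j" "j \<le> J" for i j
    using that
  proof (induction j rule: dec_induct)
    case (step n)
    then have "\<theta> i \<le> \<theta> n" "\<theta> n < \<theta> (Suc n)" using \<theta>(3) by auto
    then show ?case by simp
  qed auto
  have main: "\<forall>n. \<forall>s\<in>{0..\<theta> j}. u (- n) s = u n s" if "j \<le> J" for j
    using that
  proof (induction j)
    case 0
    then show ?case using \<theta> by (simp add: u_init)
  next
    case (Suc j)
    define a b where "a = \<theta> j" and "b = \<theta> (Suc j)"
    have j: "j < J" and ab: "0 \<le> a" "a < b" "b \<le> T"
      using Suc.prems \<theta> \<theta>_mono[of 0 j] \<theta>_mono[of "Suc j" J] by (auto simp: a_def b_def)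
    have IH: "u (- n) s = u n s" if "s \<in> {0..a}" for n s
      using Suc that by (auto simp: a_def)
    have const: "hysteresis h1 h2 (u n) s = hysteresis h1 h2 (u n) a" if "s \<in> {a<..<b}" for n s
    proof (rule hysteresis_constant[OF ab(1) _ _ h1_pos h2])
      show "C1_closed_interval a b (u n)" using C1[OF j] by (simp add: a_def b_def)
      show "continuous_on {a..b} (\<lambda>s. lattice_laplacian (\<lambda>m. u m s) n)"
        unfolding lattice_laplacian_def using ab
        by (intro continuous_intros continuous_on_subset[OF u_cont[of b]]) auto
      show "(u n has_real_derivative lattice_laplacian (\<lambda>m. u m t) n + hysteresis h1 h2 (u n) t) (at t)"
        if "t \<in> {a<..<b}" for t
        by (rule der[OF j]) (use that in \<open>simp add: a_def b_def\<close>)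
    qed (use that u_cont in auto)
    have hyst: "hysteresis h1 h2 (u (- n)) s = hysteresis h1 h2 (u n) s" if "s \<in> {a<..<b}" for n s
      unfolding const[OF that] using IH[of _ n] by (simp add: hysteresis_def)
    have le: "u (- n) s - u n s \<le> 0" if "s \<in> {a..b}" for n s
    proof (rule lattice_maximum_principle[where w = "\<lambda>n s. u (- n) s - u n s" and A = "2 * A" and
        \<alpha> = \<alpha> and F = "{}" and ?t0.0 = a and ?t1.0 = b])
      show "continuous_on {a..b} (\<lambda>s. u (- n) s - u n s)" for n
        using ab by (intro continuous_intros continuous_on_subset[OF u_cont[of b]]) auto
      show "u (- n) a - u n a \<le> 0" for n using IH[of a n] ab by simp
      show "u (- n) s - u n s \<le> 2 * A * exp (\<alpha> * real_of_int \<bar>n\<bar>)" if "s \<in> {a..b}" for n s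
        using A(3)[of s n] A(3)[of s "- n"] that ab by (simp add: abs_le_iff)
      fix n s assume "s \<in> {a<..<b} - {}"
      then have s: "s \<in> {a<..<b}" by simp
      then have s': "s \<in> {\<theta> j<..<\<theta> (Suc j)}" by (simp add: a_def b_def)
      have "lattice_laplacian (\<lambda>m. u m s) (- n) + hysteresis h1 h2 (u (- n)) s - 
          (lattice_laplacian (\<lambda>m. u m s) n + hysteresis h1 h2 (u n) s)
        = lattice_laplacian (\<lambda>m. u (- m) s - u m s) n"
        by (simp add: hyst[OF s] lattice_laplacian_def)
      then show "\<exists>D. ((\<lambda>s. u (- n) s - u n s) has_real_derivative D) (at s) \<and> 
          D \<le> lattice_laplacian (\<lambda>m. u (- m) s - u m s) n"
        using DERIV_diff[OF der[OF j s', of "- n"] der[OF j s', of n]] by (metis order_refl)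
    qed (use A that in auto)
    show ?case
    proof (intro allI ballI)
      fix n s assume s: "s \<in> {0..\<theta> (Suc j)}"
      show "u (- n) s = u n s"
      proof (cases "s \<le> a")
        case True
        then show ?thesis using IH s by auto
      next
        case False
        then have "s \<in> {a..b}" using s by (simp add: b_def)
        then show ?thesis using le[of s n] le[of s "- n"] by simp
      qed
    qed
  qed
  show ?thesis using main[of J] assms \<theta> by (simp add: T_def)
qed


text \<open>Without switching the solution would be \<open>- c n\<^sup>2 + (h1 - 2 c) t\<close>.  The deficit with respect to
  it solves the heat equation with zero initial data and a source that is switched on at each
  switching node.\<close>

definition source :: "int \<Rightarrow> real \<Rightarrow> real" where
  "source n t = (if \<exists>s\<in>{0..t}. u n s \<ge> 0 then 1 else 0)"

definition deficit :: "int \<Rightarrow> real \<Rightarrow> real" where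
  "deficit n t = - c * (real_of_int n)\<^sup>2 + (h1 - 2 * c) * t - u n t"

lemma source_01: "0 \<le> source n t" "source n t \<le> 1"
  by (auto simp: source_def)

lemma source_mono: "s \<le> t \<Longrightarrow> source n s \<le> source n t"
proof -
  assume "s \<le> t"
  then have "{0..s} \<subseteq> {0..t}" by simp
  then have "\<exists>r\<in>{0..t}. u n r \<ge> 0" if "\<exists>r\<in>{0..s}. u n r \<ge> 0"
    using that by blast
  then show ?thesis by (simp add: source_def)
qed

lemma hysteresis_source: "hysteresis h1 h2 (u n) t = h1 - (h1 + h2) * source n t"
proof -
  have "source n t = (if \<forall>s\<in>{0..t}. u n s < 0 then 0 else 1)"
    by (simp add: source_def not_less)
  then show ?thesis by (simp add: hysteresis_def)
qed

lemma deficit_symmetric: "t \<ge> 0 \<Longrightarrow> deficit (- n) t = deficit n t"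
  by (simp add: deficit_def u_symmetric)

lemma source_symmetric: "source (- n) t = source n t"
  by (simp add: source_def u_symmetric)

lemma deficit_init: "deficit n 0 = 0"
  by (simp add: deficit_def u_init)

lemma deficit_cont: "continuous_on {0..T} (deficit n)"
  unfolding deficit_def by (intro continuous_intros u_cont)

lemma deficit_deriv:
  assumes "T > 0" and t: "t \<in> {0<..<T} - exceptional_times T"
  shows "(deficit n has_real_derivative lattice_laplacian (\<lambda>m. deficit m t) n + (h1 + h2) * source n t) (at t)"
proof -
  have "((\<lambda>t. - c * (real_of_int n)\<^sup>2 + (h1 - 2 * c) * t) has_real_derivative (h1 - 2 * c)) (at t)"
    by (auto intro!: derivative_eq_intros)
  from DERIV_diff[OF this u_deriv(2)[OF assms, of n]]
  have "(deficit n has_real_derivative (h1 - 2 * c) - 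
     (lattice_laplacian (\<lambda>m. u m t) n + hysteresis h1 h2 (u n) t)) (at t)"
    by (simp add: deficit_def[abs_def])
  then show ?thesis
    by (rule DERIV_cong)
       (simp add: hysteresis_source lattice_laplacian_def deficit_def algebra_simps power2_eq_square)
qed

lemma deficit_bounds:
  assumes "t \<ge> 0"
  shows "0 \<le> deficit n t" "deficit n t \<le> (h1 + h2) * t"
proof -
  define T where "T = t + 1"
  have T: "T > 0" "t \<in> {0..T}" using assms by (auto simp: T_def)
  define F where "F = exceptional_times T"
  note F = u_deriv(1)[OF T(1), folded F_def] deficit_deriv[OF T(1), folded F_def]
  obtain A \<alpha> where A: "A \<ge> 0" "\<alpha> \<ge> 0" 
    "\<And>n t. t \<in> {0..T} \<Longrightarrow> \<bar>u n t\<bar> \<le> A * exp (\<alpha> * real_of_int \<bar>n\<bar>)"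
    using u_growth[OF T(1)] by blast
  have "- deficit n t \<le> 0"
  proof (rule lattice_maximum_principle[where w = "\<lambda>n t. - deficit n t" and A = "A + 2 * c" and \<alpha> = "\<alpha> + 1", OF F(1) _ _ _ _ _ _ T(2)])
    show "continuous_on {0..T} (\<lambda>t. - deficit n t)" for n
      by (intro continuous_intros deficit_cont)
    fix n t assume t: "t \<in> {0<..<T} - F"
    have "- (lattice_laplacian (\<lambda>m. deficit m t) n + (h1 + h2) * source n t)
        \<le> lattice_laplacian (\<lambda>m. - deficit m t) n"
      using h12_pos source_01[of n t] by (simp add: lattice_laplacian_def)
    then show "\<exists>D. ((\<lambda>t. - deficit n t) has_real_derivative D) (at t) \<and> 
        D \<le> lattice_laplacian (\<lambda>m. - deficit m t) n"
      using DERIV_minus[OF F(2)[OF t, of n]] by blast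
  next
    fix n t assume t: "t \<in> {0..T}"
    define x where "x = real_of_int \<bar>n\<bar>"
    have "x \<ge> 0" by (simp add: x_def)
    have "x\<^sup>2 \<le> 2 * exp x"
      using exp_lower_Taylor_quadratic[OF \<open>x \<ge> 0\<close>] \<open>x \<ge> 0\<close> by simp
    also have "\<dots> \<le> 2 * exp ((\<alpha> + 1) * x)"
      using \<open>x \<ge> 0\<close> A(2) by (simp add: algebra_simps)
    finally have "c * x\<^sup>2 \<le> c * (2 * exp ((\<alpha> + 1) * x))"
      using c by (intro mult_left_mono) auto
    moreover have "u n t \<le> A * exp ((\<alpha> + 1) * x)"
    proof -
      have "u n t \<le> A * exp (\<alpha> * x)" using A(3)[OF t, of n] by (simp add: x_def)
      also have "\<dots> \<le> A * exp ((\<alpha> + 1) * x)"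
        using A \<open>x \<ge> 0\<close> by (intro mult_left_mono) (auto simp: algebra_simps)
      finally show ?thesis .
    qed
    moreover have "(h1 - 2 * c) * t \<ge> 0" using h1 t by simp
    moreover have "- deficit n t = c * x\<^sup>2 - (h1 - 2 * c) * t + u n t"
      by (simp add: x_def deficit_def)
    moreover have "(A + 2 * c) * exp ((\<alpha> + 1) * x) = A * exp ((\<alpha> + 1) * x) + c * (2 * exp ((\<alpha> + 1) * x))"
      by (simp add: distrib_right)
    ultimately have "- deficit n t \<le> (A + 2 * c) * exp ((\<alpha> + 1) * x)"
      by linarith
    then show "- deficit n t \<le> (A + 2 * c) * exp ((\<alpha> + 1) * real_of_int \<bar>n\<bar>)"
      by (simp only: x_def)
  next
    show "- deficit n 0 \<le> 0" for n by (simp add: deficit_init)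
    show "0 \<le> A + 2 * c" "0 \<le> \<alpha> + 1" using A(1,2) c by simp_all
  qed
  then show "0 \<le> deficit n t" by simp
  have "deficit n t \<le> (h1 + h2) * (t - 0)"
  proof (rule lattice_comparison[where w = deficit and A = "A + (h1 - 2 * c) * T" and \<alpha> = \<alpha>, OF F(1) deficit_cont _ _ _ _ _ _ T(2)])
    fix n t assume t: "t \<in> {0<..<T} - F"
    have "(h1 + h2) * source n t \<le> (h1 + h2) * 1"
      using h12_pos source_01[of n t] by (intro mult_left_mono) auto
    then show "\<exists>D. (deficit n has_real_derivative D) (at t) \<and> 
        D \<le> lattice_laplacian (\<lambda>m. deficit m t) n + (h1 + h2)"
      using F(2)[OF t, of n] 
      by (intro exI[of _ "lattice_laplacian (\<lambda>m. deficit m t) n + (h1 + h2) * source n t"] conjI) simp_all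
  next
    fix n t assume t: "t \<in> {0..T}"
    have "(h1 - 2 * c) * t \<le> (h1 - 2 * c) * T * 1" using t h1 by simp
    also have "\<dots> \<le> (h1 - 2 * c) * T * exp (\<alpha> * real_of_int \<bar>n\<bar>)"
      using h1 T A(2) by (intro mult_left_mono) auto
    finally have "(h1 - 2 * c) * t \<le> (h1 - 2 * c) * T * exp (\<alpha> * real_of_int \<bar>n\<bar>)" .
    moreover have "c * (real_of_int n)\<^sup>2 \<ge> 0" using c by simp
    moreover note A(3)[OF t, of n]
    ultimately show "deficit n t \<le> (A + (h1 - 2 * c) * T) * exp (\<alpha> * real_of_int \<bar>n\<bar>)"
      unfolding deficit_def distrib_right by linarith
  next
    show "deficit n 0 \<le> 0" for n by (simp add: deficit_init)
    show "0 \<le> A + (h1 - 2 * c) * T" using A(1) h1 T(1) by simp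
    show "0 \<le> \<alpha>" "0 \<le> h1 + h2" using A(2) h12_pos by simp_all
  qed
  then show "deficit n t \<le> (h1 + h2) * t" by simp
qed

text \<open>The source only ever grows, so a time shift produces a larger deficit.\<close>
lemma deficit_mono:
  assumes "0 \<le> s" "s \<le> t"
  shows "deficit n s \<le> deficit n t"
proof (cases "s = t")
  case False
  define h where "h = t - s"
  have h: "h > 0" "t = s + h" using assms False by (auto simp: h_def)
  define T where "T = s + 1"
  have T: "T > 0" "s \<in> {0..T}" using assms by (auto simp: T_def)
  have "T + h > 0" using T h by simp
  define F where "F = exceptional_times (T + h)"
  note F = u_deriv(1)[OF \<open>T + h > 0\<close>, folded F_def] deficit_deriv[OF \<open>T + h > 0\<close>, folded F_def]
  have "deficit n s - deficit n (s + h) \<le> 0"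
  proof (rule lattice_maximum_principle[where w = "\<lambda>n s. deficit n s - deficit n (s + h)" and 
      F = "F \<union> (\<lambda>x. x - h) ` F" and A = "(h1 + h2) * T" and \<alpha> = 0, OF _ _ _ _ _ _ _ T(2)])
    show "continuous_on {0..T} (\<lambda>s. deficit n s - deficit n (s + h))" for n
    proof (intro continuous_intros deficit_cont)
      show "continuous_on {0..T} (\<lambda>s. deficit n (s + h))"
        by (rule continuous_on_compose2[OF deficit_cont[of "T + h"]]) (use h in \<open>auto intro!: continuous_intros\<close>)
    qed
    show "deficit n s - deficit n (s + h) \<le> (h1 + h2) * T * exp (0 * real_of_int \<bar>n\<bar>)" 
      if "s \<in> {0..T}" for n s
    proof -
      have "(h1 + h2) * s \<le> (h1 + h2) * T" using h12_pos that by (intro mult_left_mono) auto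
      then show ?thesis using deficit_bounds[of s n] deficit_bounds[of "s + h" n] that h by simp
    qed
    show "deficit n 0 - deficit n (0 + h) \<le> 0" for n
      using deficit_bounds[of h n] h by (simp add: deficit_init)
    fix n s assume s: "s \<in> {0<..<T} - (F \<union> (\<lambda>x. x - h) ` F)"
    then have s1: "s \<in> {0<..<T + h} - F" using h by auto
    have "s + h \<notin> F"
    proof
      assume "s + h \<in> F"
      then have "(s + h) - h \<in> (\<lambda>x. x - h) ` F" by (rule imageI)
      then show False using s by simp
    qed
    then have s2: "s + h \<in> {0<..<T + h} - F" using s h by auto
    have "((\<lambda>s. deficit n (s + h)) has_real_derivative 
       lattice_laplacian (\<lambda>m. deficit m (s + h)) n + (h1 + h2) * source n (s + h)) (at s)"
      using F(2)[OF s2, of n] by (simp only: DERIV_shift)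
    from DERIV_diff[OF F(2)[OF s1, of n] this]
    have "((\<lambda>s. deficit n s - deficit n (s + h)) has_real_derivative
        lattice_laplacian (\<lambda>m. deficit m s) n + (h1 + h2) * source n s
       - (lattice_laplacian (\<lambda>m. deficit m (s + h)) n + (h1 + h2) * source n (s + h))) (at s)" .
    moreover have "(h1 + h2) * source n s \<le> (h1 + h2) * source n (s + h)"
      using h12_pos source_mono[of s "s + h" n] h by (intro mult_left_mono) auto
    then have "lattice_laplacian (\<lambda>m. deficit m s) n + (h1 + h2) * source n s
       - (lattice_laplacian (\<lambda>m. deficit m (s + h)) n + (h1 + h2) * source n (s + h))
       \<le> lattice_laplacian (\<lambda>m. deficit m s - deficit m (s + h)) n"
      by (simp add: lattice_laplacian_def)
    ultimately show "\<exists>D. ((\<lambda>s. deficit n s - deficit n (s + h)) has_real_derivative D) (at s) \<and> 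
        D \<le> lattice_laplacian (\<lambda>m. deficit m s - deficit m (s + h)) n"
      by blast
  next
    show "finite (F \<union> (\<lambda>x. x - h) ` F)" using F(1) by simp
    show "0 \<le> (h1 + h2) * T" using h12_pos T(1) by simp
  qed simp
  then show ?thesis using h by simp
qed auto

text \<open>Through the equation, monotonicity in time becomes semiconvexity in space.  It is first
  obtained where the derivative exists and extends by continuity to all times.\<close>
lemma deficit_laplacian_ge:
  assumes "t > 0"
  shows "lattice_laplacian (\<lambda>m. deficit m t) n \<ge> - (h1 + h2)"
proof (rule ccontr)
  assume neg: "\<not> ?thesis"
  define T where "T = t + 1"
  have "T > 0" using assms by (simp add: T_def)
  define F where "F = exceptional_times T"
  note F = u_deriv(1)[OF \<open>T > 0\<close>, folded F_def] deficit_deriv[OF \<open>T > 0\<close>, folded F_def]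
  define \<phi> where "\<phi> s = lattice_laplacian (\<lambda>m. deficit m s) n + (h1 + h2)" for s
  have ge: "\<phi> s \<ge> 0" if "s \<in> {0<..<T} - F" for s
  proof -
    have "mono_on {0..T} (deficit n)"
      by (intro mono_onI deficit_mono) auto
    then have "lattice_laplacian (\<lambda>m. deficit m s) n + (h1 + h2) * source n s \<ge> 0"
      by (rule mono_on_imp_deriv_nonneg[OF _ F(2)[OF that]]) (use that in auto)
    moreover have "(h1 + h2) * source n s \<le> (h1 + h2) * 1"
      using h12_pos source_01 by (intro mult_left_mono) auto
    ultimately show ?thesis by (simp add: \<phi>_def)
  qed
  have "continuous_on {0..T} \<phi>"
    unfolding \<phi>_def lattice_laplacian_def by (intro continuous_intros deficit_cont)
  then have "isCont \<phi> t"
    by (rule continuous_on_interior) (use assms in \<open>auto simp: T_def\<close>)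
  then have "eventually (\<lambda>s. \<phi> s < 0) (at t)"
    unfolding isCont_def by (rule order_tendstoD(2)) (use neg in \<open>simp add: \<phi>_def\<close>)
  moreover have "eventually (\<lambda>s. s \<in> {0<..<T}) (at t)"
    using eventually_at_in_open'[of "{0<..<T}" t] assms by (auto simp: T_def)
  moreover have "eventually (\<lambda>s. s \<notin> F) (at t)"
  proof -
    have "open (- (F - {t}))" using F(1) by (intro open_Compl finite_imp_closed) simp
    then have "eventually (\<lambda>s. s \<in> - (F - {t}) - {t}) (at t)"
      by (rule eventually_at_in_open) simp
    then show ?thesis by (rule eventually_mono) blast
  qed
  ultimately have "eventually (\<lambda>s. False) (at t)"
  proof eventually_elim
    case (elim s)
    then show ?case using ge[of s] by simp
  qed
  then show False by (simp add: eventually_False)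
qed

text \<open>Bounded and semiconvex implies Lipschitz: a large slope at \<open>n\<close> persists over \<open>\<surd>t\<close> nodes
  and would make the deficit exceed its bound.\<close>
lemma deficit_slope_le:
  assumes "t > 0"
  shows "deficit (n + 1) t - deficit n t \<le> (h1 + h2) * (2 * sqrt t + 1)"
proof -
  define g where "g j = deficit (n + int j + 1) t - deficit (n + int j) t" for j
  define r where "r = nat \<lceil>sqrt t\<rceil>"
  have r: "sqrt t \<le> real r" "real r \<le> sqrt t + 1" "real r > 0" 
    using assms by (auto simp: r_def)
  have slope: "g j \<ge> g 0 - (h1 + h2) * real j" for j
  proof (induction j)
    case (Suc j)
    have "g (Suc j) - g j = lattice_laplacian (\<lambda>m. deficit m t) (n + int j + 1)"
      by (simp add: g_def lattice_laplacian_def algebra_simps)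
    then show ?case 
      using Suc deficit_laplacian_ge[OF assms, of "n + int j + 1"] by (simp add: algebra_simps)
  qed simp
  have "deficit (n + int k) t \<ge> deficit n t + real k * g 0 - (h1 + h2) * real k * real k" for k
  proof (induction k)
    case (Suc k)
    have "deficit (n + int (Suc k)) t = deficit (n + int k) t + g k"
      by (simp add: g_def algebra_simps)
    moreover have "(h1 + h2) * real k \<ge> 0" using h12_pos by simp
    ultimately show ?case
      using Suc slope[of k] h12_pos by (simp add: algebra_simps)
  qed simp
  from this[of r] have "real r * g 0 \<le> (h1 + h2) * t + (h1 + h2) * real r * real r"
    using deficit_bounds[of t n] deficit_bounds[of t "n + int r"] assms by simp
  also have "\<dots> \<le> real r * ((h1 + h2) * (sqrt t + real r))"
  proof -
    have "t = sqrt t * sqrt t" using assms by simp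
    also have "\<dots> \<le> real r * sqrt t" using r assms by (intro mult_right_mono) auto
    finally have "(h1 + h2) * t \<le> (h1 + h2) * (real r * sqrt t)" using h12_pos by (intro mult_left_mono) auto
    then show ?thesis by (simp add: algebra_simps)
  qed
  finally have "g 0 \<le> (h1 + h2) * (sqrt t + real r)" using r by simp
  also have "\<dots> \<le> (h1 + h2) * (2 * sqrt t + 1)"
    using r h12_pos by (intro mult_left_mono) auto
  finally show ?thesis by (simp add: g_def)
qed

lemma deficit_lipschitz:
  assumes "t > 0"
  shows "\<bar>deficit (n + 1) t - deficit n t\<bar> \<le> (h1 + h2) * (2 * sqrt t + 1)"
proof -
  have "deficit (- n - 1 + 1) t - deficit (- n - 1) t \<le> (h1 + h2) * (2 * sqrt t + 1)"
    by (rule deficit_slope_le[OF assms])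
  moreover have "deficit (- n - 1) t = deficit (n + 1) t"
    using deficit_symmetric[of t "n + 1"] assms by simp
  ultimately show ?thesis
    using deficit_slope_le[OF assms, of n] deficit_symmetric[of t n] assms by simp
qed

definition window :: "nat \<Rightarrow> int \<Rightarrow> real \<Rightarrow> real" where
  "window r n t = (\<Sum>j<r. deficit (n + int j) t)"

lemma window_approx:
  assumes "t > 0"
  shows "\<bar>window r n t - real r * deficit n t\<bar> \<le> (h1 + h2) * (2 * sqrt t + 1) * (real r)\<^sup>2"
proof -
  define L where "L = (h1 + h2) * (2 * sqrt t + 1)"
  have "L \<ge> 0" using h12_pos assms by (simp add: L_def)
  have lip: "\<bar>deficit (n + int j) t - deficit n t\<bar> \<le> L * real j" for j
  proof (induction j)
    case (Suc j)
    then show ?case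
      using deficit_lipschitz[OF assms, of "n + int j"] by (simp add: L_def algebra_simps)
  qed simp
  have "\<bar>window r n t - real r * deficit n t\<bar> = \<bar>\<Sum>j<r. (deficit (n + int j) t - deficit n t)\<bar>"
    by (simp add: window_def sum_subtractf)
  also have "\<dots> \<le> (\<Sum>j<r. \<bar>deficit (n + int j) t - deficit n t\<bar>)" by (rule sum_abs)
  also have "\<dots> \<le> (\<Sum>j<r. L * real r)"
    by (intro sum_mono order_trans[OF lip] mult_left_mono \<open>L \<ge> 0\<close>) auto
  also have "\<dots> = L * (real r)\<^sup>2" by (simp add: power2_eq_square)
  finally show ?thesis unfolding L_def .
qed

lemma window_init: "window r n 0 = 0"
  by (simp add: window_def deficit_init)

lemma window_bounds: "t \<ge> 0 \<Longrightarrow> 0 \<le> window r n t" "t \<ge> 0 \<Longrightarrow> window r n t \<le> real r * ((h1 + h2) * t)"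
  unfolding window_def using deficit_bounds sum_bounded_above[of "{..<r}" "\<lambda>j. deficit (n + int j) t" "(h1 + h2) * t"]
  by (auto intro!: sum_nonneg)

lemma window_cont: "continuous_on {0..T} (window r n)"
  unfolding window_def by (intro continuous_intros deficit_cont)

lemma window_deriv:
  assumes "T > 0" and t: "t \<in> {0<..<T} - exceptional_times T"
  shows "(window r n has_real_derivative lattice_laplacian (\<lambda>m. window r m t) n 
       + (h1 + h2) * (\<Sum>j<r. source (n + int j) t)) (at t)"
proof -
  have "(window r n has_real_derivative (\<Sum>j<r. lattice_laplacian (\<lambda>m. deficit m t) (n + int j) 
      + (h1 + h2) * source (n + int j) t)) (at t)"
    unfolding window_def by (intro DERIV_sum deficit_deriv[OF assms])
  moreover have "(\<Sum>j<r. lattice_laplacian (\<lambda>m. deficit m t) (n + int j) + (h1 + h2) * source (n + int j) t)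
    = lattice_laplacian (\<lambda>m. window r m t) n + (h1 + h2) * (\<Sum>j<r. source (n + int j) t)"
    by (simp add: lattice_laplacian_def window_def sum.distrib sum_subtractf sum_distrib_left algebra_simps)
  ultimately show ?thesis by (rule DERIV_cong)
qed

end

section \<open>Switching nodes\<close>

lemma enumerate_less_iff:
  fixes S :: "nat set"
  assumes S: "infinite S"
  shows "enumerate S i < n \<longleftrightarrow> i < card (S \<inter> {..<n})"
proof
  assume less: "enumerate S i < n"
  have "inj_on (enumerate S) {..i}"
    using S by (intro inj_onI) (metis enumerate_mono linorder_cases order_less_irrefl)
  then have "card (enumerate S ` {..i}) = Suc i" by (simp add: card_image)
  moreover have "enumerate S ` {..i} \<subseteq> S \<inter> {..<n}"
  proof
    fix x assume "x \<in> enumerate S ` {..i}"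
    then obtain j where "j \<le> i" "x = enumerate S j" by auto
    moreover then have "enumerate S j \<le> enumerate S i" using S by simp
    ultimately show "x \<in> S \<inter> {..<n}" using less enumerate_in_set[OF S] by auto
  qed
  then have "card (enumerate S ` {..i}) \<le> card (S \<inter> {..<n})"
    by (intro card_mono) auto
  ultimately show "i < card (S \<inter> {..<n})" by simp
next
  assume less: "i < card (S \<inter> {..<n})"
  show "enumerate S i < n"
  proof (rule ccontr)
    assume ge: "\<not> enumerate S i < n"
    have "S \<inter> {..<n} \<subseteq> enumerate S ` {..<i}"
    proof
      fix x assume x: "x \<in> S \<inter> {..<n}"
      then obtain j where j: "enumerate S j = x" using enumerate_Ex[OF S, of x] by auto
      then have "enumerate S j < enumerate S i" using x ge by simp
      then have "j < i" using S by simp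
      then show "x \<in> enumerate S ` {..<i}" using j by auto
    qed
    then have "card (S \<inter> {..<n}) \<le> card {..<i}"
      by (meson card_image_le card_mono finite_imageI finite_lessThan order_trans)
    then show False using less by simp
  qed
qed

context hysteresis_lattice
begin

definition switching_nats :: "nat set" where
  "switching_nats = {m. int m \<in> switching_nodes u}"

text \<open>The signed number of active sources between the origin and \<open>m\<close>: a discrete primitive of the
  source, to be compared with the length of \<open>[0, m]\<close> behind the front.\<close>
definition source_count :: "real \<Rightarrow> int \<Rightarrow> real" where
  "source_count t m = (if m \<ge> 0 then (\<Sum>j\<in>{0..<m}. source j t) else - (\<Sum>j\<in>{m..<0}. source j t))"

lemma switching_moment:
  assumes "n \<in> switching_nodes u"
  shows "switching_moment u n \<ge> 0" "u n (switching_moment u n) \<ge> 0"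
    and "\<And>s. 0 \<le> s \<Longrightarrow> u n s \<ge> 0 \<Longrightarrow> switching_moment u n \<le> s"
proof -
  obtain t where t: "t \<ge> 0" "u n t \<ge> 0" using assms by (auto simp: switching_nodes_def)
  define S where "S = {s \<in> {0..t}. u n s \<ge> 0}"
  have "compact S"
  proof -
    have "closed ({0..t} \<inter> u n -` {0..})"
      by (intro continuous_closed_preimage closed_atLeast closed_atLeastAtMost u_cont)
    moreover have "S = {0..t} \<inter> ({0..t} \<inter> u n -` {0..})" by (auto simp: S_def)
    ultimately show ?thesis using compact_Int_closed[OF compact_Icc] by metis
  qed
  moreover have "S \<noteq> {}" using t by (auto simp: S_def)
  ultimately obtain \<tau> where \<tau>: "\<tau> \<in> S" "\<And>s. s \<in> S \<Longrightarrow> \<tau> \<le> s"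
    using compact_attains_inf[of S] by blast
  have least: "\<tau> \<le> s" if "0 \<le> s" "u n s \<ge> 0" for s
    using \<tau>(2)[of s] \<tau>(1) that by (cases "s \<le> t") (auto simp: S_def)
  have "switching_moment u n = \<tau>"
    unfolding switching_moment_def using \<tau>(1) least by (intro Least_equality) (auto simp: S_def)
  then show "switching_moment u n \<ge> 0" "u n (switching_moment u n) \<ge> 0"
    and "\<And>s. 0 \<le> s \<Longrightarrow> u n s \<ge> 0 \<Longrightarrow> switching_moment u n \<le> s"
    using \<tau>(1) least by (auto simp: S_def)
qed

lemma u_switching_moment:
  assumes "n \<in> switching_nodes u"
  shows "u n (switching_moment u n) = 0"
proof (rule ccontr)
  define \<tau> where "\<tau> = switching_moment u n"
  assume "u n (switching_moment u n) \<noteq> 0"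
  then have pos: "u n \<tau> > 0" using switching_moment(2)[OF assms] by (simp add: \<tau>_def)
  have "u n 0 \<le> 0" using c by (simp add: u_init)
  then obtain s where s: "0 \<le> s" "s \<le> \<tau>" "u n s = 0"
    using IVT'[of "u n" 0 0 \<tau>] u_cont pos switching_moment(1)[OF assms] by (auto simp: \<tau>_def)
  then have "\<tau> \<le> s" using switching_moment(3)[OF assms, of s] by (simp add: \<tau>_def)
  then show False using s pos by simp
qed

lemma source_eq:
  assumes "t \<ge> 0"
  shows "source n t = (if n \<in> switching_nodes u \<and> switching_moment u n \<le> t then 1 else 0)"
proof -
  have "(\<exists>s\<in>{0..t}. u n s \<ge> 0) \<longleftrightarrow> n \<in> switching_nodes u \<and> switching_moment u n \<le> t"
  proof
    assume "\<exists>s\<in>{0..t}. u n s \<ge> 0"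
    then obtain s where s: "0 \<le> s" "s \<le> t" "u n s \<ge> 0" by auto
    then have "n \<in> switching_nodes u" by (auto simp: switching_nodes_def)
    then show "n \<in> switching_nodes u \<and> switching_moment u n \<le> t"
      using switching_moment(3)[of n s] s by simp
  next
    assume *: "n \<in> switching_nodes u \<and> switching_moment u n \<le> t"
    then show "\<exists>s\<in>{0..t}. u n s \<ge> 0"
      using switching_moment(1,2)[of n] by (intro bexI[of _ "switching_moment u n"]) auto
  qed
  then show ?thesis by (simp add: source_def)
qed

lemma zero_switching: "0 \<in> switching_nodes u"
  using u_init[of 0] by (auto simp: switching_nodes_def intro!: exI[of _ 0])

lemma switching_nodes_symmetric: "- n \<in> switching_nodes u \<longleftrightarrow> n \<in> switching_nodes u"
proof -
  have "(\<exists>t\<ge>0. u (- n) t \<ge> 0) = (\<exists>t\<ge>0. u n t \<ge> 0)"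
    by (metis u_symmetric)
  then show ?thesis by (simp add: switching_nodes_def)
qed

lemma source_count_Suc: "source_count t (m + 1) = source_count t m + source m t"
proof -
  consider "m \<ge> 0" | "m = -1" | "m < -1" by linarith
  then show ?thesis
  proof cases
    case 1
    then have "{0..<m + 1} = insert m {0..<m}" by auto
    then show ?thesis using 1 by (simp add: source_count_def)
  next
    case 2
    have "{-1..<0} = {-1::int}" by auto
    then show ?thesis using 2 by (simp add: source_count_def)
  next
    case 3
    then have "{m..<0} = insert m {m + 1..<0}" by auto
    then show ?thesis using 3 by (simp add: source_count_def)
  qed
qed

lemma sum_source: "(\<Sum>j<r. source (n + int j) t) = source_count t (n + int r) - source_count t n"
proof (induction r)
  case (Suc r)
  then show ?case using source_count_Suc[of t "n + int r"] by (simp add: algebra_simps)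
qed simp

text \<open>Finitely many sources produce a deficit of order \<open>t\<^sup>3\<^sup>/\<^sup>4\<close> at most, which cannot keep the
  solution below zero forever.\<close>
lemma infinite_switching_nats: "infinite switching_nats"
proof
  assume fin: "finite switching_nats"
  have "switching_nodes u \<subseteq> int ` switching_nats \<union> (\<lambda>m. - int m) ` switching_nats"
  proof
    fix n assume n: "n \<in> switching_nodes u"
    then have "int (nat \<bar>n\<bar>) \<in> switching_nodes u"
      using switching_nodes_symmetric[of n] by (auto simp: abs_if)
    then have "nat \<bar>n\<bar> \<in> switching_nats" by (simp add: switching_nats_def)
    then show "n \<in> int ` switching_nats \<union> (\<lambda>m. - int m) ` switching_nats"
      by (cases "n \<ge> 0") (auto intro!: image_eqI[of _ _ "nat \<bar>n\<bar>"])
  qed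
  then have finK: "finite (switching_nodes u)" using fin finite_subset by blast
  define M where "M = real (card (switching_nodes u))"
  define S0 where "S0 = h1 + h2"
  have S0: "S0 > 0" using h12_pos by (simp add: S0_def)
  have sum_le: "(\<Sum>j<r. source (n + int j) t) \<le> M" if "t \<ge> 0" for n r t
  proof -
    have "(\<Sum>j<r. source (n + int j) t) = (\<Sum>k\<in>(\<lambda>j. n + int j) ` {..<r}. source k t)"
      by (subst sum.reindex) (auto intro: inj_onI)
    also have "\<dots> \<le> (\<Sum>k\<in>(\<lambda>j. n + int j) ` {..<r}. if k \<in> switching_nodes u then 1 else 0)"
      using source_eq[OF that] by (intro sum_mono) simp
    also have "\<dots> = real (card ((\<lambda>j. n + int j) ` {..<r} \<inter> switching_nodes u))"
      by (simp add: sum.If_cases)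
    also have "\<dots> \<le> M" unfolding M_def using finK by (intro of_nat_mono card_mono) auto
    finally show ?thesis .
  qed
  have window_le: "window r n T \<le> S0 * M * T" if T: "T > 0" for r n T
  proof -
    define F where "F = exceptional_times T"
    note F = u_deriv(1)[OF T, folded F_def] window_deriv[OF T, where r = r, folded F_def]
    have "window r n T \<le> S0 * M * (T - 0)"
    proof (rule lattice_comparison[where A = "real r * (S0 * T)" and \<alpha> = 0, OF F(1) window_cont])
      fix n t assume t: "t \<in> {0<..<T} - F"
      have "S0 * (\<Sum>j<r. source (n + int j) t) \<le> S0 * M"
        using t S0 by (intro mult_left_mono sum_le) auto
      then show "\<exists>D. (window r n has_real_derivative D) (at t) \<and> 
         D \<le> lattice_laplacian (\<lambda>m. window r m t) n + S0 * M"
        using F(2)[OF t, of n] unfolding S0_def by (intro exI conjI) (assumption, simp)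
    next
      fix n t assume t: "t \<in> {0..T}"
      have "window r n t \<le> real r * (S0 * t)" using window_bounds(2)[of t r n] t by (simp add: S0_def)
      also have "\<dots> \<le> real r * (S0 * T)" using t S0 by (intro mult_left_mono) auto
      finally show "window r n t \<le> real r * (S0 * T) * exp (0 * real_of_int \<bar>n\<bar>)" by simp
    qed (use window_init T S0 in \<open>auto simp: M_def\<close>)
    then show ?thesis by simp
  qed
  obtain n where n: "n \<notin> switching_nodes u"
    using finK infinite_UNIV_int by (metis UNIV_I ex_new_if_finite)
  have "(h1 - 2 * c) * real r \<le> c * (real_of_int n)\<^sup>2 + S0 * (M + 3)" if "r \<ge> 1" for r :: nat
  proof -
    (* windows of length T^(1/4) balance total mass of order T against slope of order sqrt T *)
    define x T where "x = real r" and "T = x ^ 4"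
    have x: "x \<ge> 1" and T: "T > 0" "sqrt T = x\<^sup>2"
      using that by (auto simp: x_def T_def real_sqrt_unique power_even_eq[of x 2, simplified])
    have "x * deficit n T \<le> window r n T + S0 * (2 * x\<^sup>2 + 1) * x\<^sup>2"
      using window_approx[OF T(1), of r n] by (simp add: T(2) S0_def x_def)
    also have "\<dots> \<le> S0 * M * x ^ 4 + S0 * (3 * x\<^sup>2) * x\<^sup>2"
    proof (intro add_mono mult_right_mono mult_left_mono)
      show "window r n T \<le> S0 * M * x ^ 4" using window_le[OF T(1), of r n] by (simp only: T_def)
      show "2 * x\<^sup>2 + 1 \<le> 3 * x\<^sup>2" using one_le_power[OF x, of 2] by simp
    qed (use S0 in auto)
    also have "\<dots> = x * (S0 * (M + 3) * x ^ 3)"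
      by (simp add: algebra_simps power2_eq_square power3_eq_cube power4_eq_xxxx)
    finally have "deficit n T \<le> S0 * (M + 3) * x ^ 3" using x by simp
    moreover have "u n T < 0"
    proof (rule ccontr)
      assume "\<not> u n T < 0"
      then have "T \<ge> 0 \<and> u n T \<ge> 0" using T(1) by simp
      then have "n \<in> switching_nodes u" unfolding switching_nodes_def by blast
      then show False using n by simp
    qed
    ultimately have "(h1 - 2 * c) * x * x ^ 3 \<le> c * (real_of_int n)\<^sup>2 + S0 * (M + 3) * x ^ 3"
      by (simp add: deficit_def T_def power3_eq_cube power4_eq_xxxx mult.assoc)
    also have "\<dots> \<le> (c * (real_of_int n)\<^sup>2 + S0 * (M + 3)) * x ^ 3"
    proof -
      have "c * (real_of_int n)\<^sup>2 * 1 \<le> c * (real_of_int n)\<^sup>2 * x ^ 3"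
        using c one_le_power[OF x, of 3] by (intro mult_left_mono) auto
      then show ?thesis by (simp add: distrib_right)
    qed
    finally show ?thesis using x by (simp add: x_def)
  qed
  note bound = this
  obtain r :: nat where "(c * (real_of_int n)\<^sup>2 + S0 * (M + 3)) / (h1 - 2 * c) < real r"
    using reals_Archimedean2 by blast
  also have "real r \<le> real (max 1 r)" by simp
  finally have "c * (real_of_int n)\<^sup>2 + S0 * (M + 3) < (h1 - 2 * c) * real (max 1 r)"
    using h1 by (simp add: pos_divide_less_eq mult.commute)
  then show False using bound[of "max 1 r"] by simp
qed

end

section \<open>Counting the sources\<close>

context hysteresis_lattice
begin

lemma card_switching_nats:
  assumes "m \<ge> 1"
  shows "card (switching_nats \<inter> {..<m}) = Suc (switch_count u m)"
proof -
  have 1: "switching_nodes u \<inter> {1..int m - 1} = int ` (switching_nats \<inter> {1..<m})"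
  proof
    show "switching_nodes u \<inter> {1..int m - 1} \<subseteq> int ` (switching_nats \<inter> {1..<m})"
    proof
      fix k assume k: "k \<in> switching_nodes u \<inter> {1..int m - 1}"
      then have "k = int (nat k)" by simp
      moreover have "nat k \<in> switching_nats \<inter> {1..<m}" using k by (auto simp: switching_nats_def)
      ultimately show "k \<in> int ` (switching_nats \<inter> {1..<m})" by (rule image_eqI)
    qed
  qed (auto simp: switching_nats_def)
  have "switch_count u m = card (switching_nats \<inter> {1..<m})"
    unfolding switch_count_def 1 by (simp add: card_image)
  moreover have "switching_nats \<inter> {..<m} = insert 0 (switching_nats \<inter> {1..<m})"
    using zero_switching assms by (auto simp: switching_nats_def)
  ultimately show ?thesis by simp
qed

lemma enumerate_less_switch_count:
  assumes "m \<ge> 1"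
  shows "enumerate switching_nats j < m \<longleftrightarrow> j \<le> switch_count u m"
  using enumerate_less_iff[OF infinite_switching_nats, of j m] card_switching_nats[OF assms]
  by (simp add: less_Suc_eq_le)

lemma enumerate_switching_0: "enumerate switching_nats 0 = 0"
proof -
  have "0 \<in> switching_nats" using zero_switching by (simp add: switching_nats_def)
  then show ?thesis by (simp add: enumerate_0 Least_eq_0)
qed

lemma enumerate_switching_pos: "enumerate switching_nats (Suc i) \<ge> 1"
  using enumerate_step[OF infinite_switching_nats, of i] by simp

lemma enumerate_switching_in: "int (enumerate switching_nats i) \<in> switching_nodes u"
  using enumerate_in_set[OF infinite_switching_nats, of i] by (simp add: switching_nats_def)

lemma switch_count_enumerate: "switch_count u (enumerate switching_nats (Suc i)) = i"
proof -
  let ?m = "enumerate switching_nats (Suc i)"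
  have "i \<le> switch_count u ?m"
    using enumerate_less_switch_count[of ?m i] enumerate_step[OF infinite_switching_nats, of i]
      enumerate_switching_pos[of i] by simp
  moreover have "\<not> Suc i \<le> switch_count u ?m"
    using enumerate_less_switch_count[of ?m "Suc i"] enumerate_switching_pos[of i] by simp
  ultimately show ?thesis by simp
qed

lemma switching_node_nonneg: "switching_node u (int j) = int (enumerate switching_nats j)"
  using enumerate_switching_0
  by (cases "j = 0") (simp_all add: switching_node_def switching_nats_def)

lemma switch_count_Suc_le: 
  "switch_count u m \<le> switch_count u (Suc m)" "switch_count u (Suc m) \<le> Suc (switch_count u m)"
proof -
  show "switch_count u m \<le> switch_count u (Suc m)"
    unfolding switch_count_def by (intro card_mono) auto
  have "card (switching_nodes u \<inter> {1..int (Suc m) - 1}) \<le> card (insert (int m) (switching_nodes u \<inter> {1..int m - 1}))"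
    by (intro card_mono) auto
  also have "\<dots> \<le> Suc (card (switching_nodes u \<inter> {1..int m - 1}))"
    by (rule card_insert_le_m1) auto
  finally show "switch_count u (Suc m) \<le> Suc (switch_count u m)"
    by (simp add: switch_count_def)
qed

lemma switch_count_add_le: 
  "switch_count u m \<le> switch_count u (m + k)" "switch_count u (m + k) \<le> switch_count u m + k"
proof (induction k)
  case (Suc k)
  { case 1 show ?case using Suc(1) switch_count_Suc_le(1)[of "m + k"] by simp }
  { case 2 show ?case using Suc(2) switch_count_Suc_le(2)[of "m + k"] by simp }
qed auto

text \<open>At the switching node with index \<open>i + 1\<close> the count is \<open>i\<close>, so quasi-uniformity becomes a
  statement about the enumeration alone.\<close>
lemma quasi_uniform_sequence:
  assumes "quasi_uniform u"
  obtains \<delta> :: "nat \<Rightarrow> real" where "\<delta> \<longlonglongrightarrow> 0" "\<And>i. \<delta> i \<ge> 0"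
    "\<And>i j. j \<le> i \<Longrightarrow> \<bar>real (enumerate switching_nats j) / real (enumerate switching_nats (Suc i))
        - real j / real i\<bar> \<le> \<delta> i"
proof -
  define f where "f = (\<lambda>n::nat. SUP i\<in>{- int (switch_count u n)..int (switch_count u n)}.
         \<bar>real_of_int (switching_node u i) / real n - real_of_int i / real (switch_count u n)\<bar>)"
  define N where "N i = enumerate switching_nats (Suc i)" for i
  define \<delta> where "\<delta> i = f (N i)" for i
  have "filterlim N (inf sequentially (principal {n. int n \<in> switching_nodes u})) sequentially"
  proof (rule filterlim_inf[THEN iffD2], rule conjI)
    have "strict_mono N"
      unfolding N_def using infinite_switching_nats by (intro strict_monoI) simp
    then show "filterlim N sequentially sequentially" by (rule filterlim_subseq)
    show "filterlim N (principal {n. int n \<in> switching_nodes u}) sequentially"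
      using enumerate_switching_in by (simp add: filterlim_principal N_def)
  qed
  moreover have "(f \<longlongrightarrow> 0) (inf sequentially (principal {n. int n \<in> switching_nodes u}))"
    using assms by (simp add: quasi_uniform_def f_def)
  ultimately have lim: "\<delta> \<longlonglongrightarrow> 0"
    unfolding \<delta>_def by (rule filterlim_compose[rotated])
  have bound: "\<bar>real (enumerate switching_nats j) / real (N i) - real j / real i\<bar> \<le> \<delta> i" if "j \<le> i" for i j
  proof -
    have p: "switch_count u (N i) = i" by (simp add: N_def switch_count_enumerate)
    have "\<bar>real_of_int (switching_node u (int j)) / real (N i) - real_of_int (int j) / real i\<bar> \<le> \<delta> i"
      unfolding \<delta>_def f_def p using that
      by (intro cSUP_upper[where f = "\<lambda>k. \<bar>real_of_int (switching_node u k) / real (N i) - real_of_int k / real i\<bar>"]) auto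
    then show ?thesis by (simp add: switching_node_nonneg)
  qed
  have "\<delta> i \<ge> 0" for i
    by (rule order_trans[OF abs_ge_zero bound[of 0 i]]) simp
  with lim bound show ?thesis
    using that[of \<delta>] by (simp add: N_def)
qed

end

locale quadratic_hysteresis_lattice = hysteresis_lattice +
  fixes a A :: real
  assumes a_pos: "a > 0" and A_pos: "A > 0"
    and growth: "\<And>k. k \<in> switching_nodes u \<Longrightarrow> 
      \<bar>switching_moment u k - a * (real_of_int k)\<^sup>2\<bar> \<le> A * real_of_int \<bar>k\<bar>"
    and quasi_uniform: "quasi_uniform u"
begin

definition node :: "nat \<Rightarrow> nat" where
  "node i = enumerate switching_nats (Suc i)"

context
  fixes i N :: nat and \<delta> :: real
  assumes q: "\<And>j. j \<le> i \<Longrightarrow> \<bar>real (enumerate switching_nats j) / real N - real j / real i\<bar> \<le> \<delta>"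
    and N: "N = enumerate switching_nats (Suc i)" and \<delta>: "\<delta> \<ge> 0"
begin

lemma index_bounds: "N \<ge> 1" "i \<le> N" "0 \<le> real i / real N" "real i / real N \<le> 1"
proof -
  show 1: "N \<ge> 1" using N enumerate_switching_pos by simp
  show 2: "i \<le> N" using le_enumerate[OF infinite_switching_nats, of "Suc i"] N by simp
  show "0 \<le> real i / real N" "real i / real N \<le> 1" using 1 2 by simp_all
qed

text \<open>Quasi-uniformity controls positions as a function of the index; inverting this relation
  controls the count as a function of the position, at the cost of one node.\<close>
lemma switch_count_linear:
  assumes "m < N"
  shows "\<bar>real (switch_count u (Suc m)) - real i / real N * real m\<bar> \<le> \<delta> * real N + 1"
proof -
  define s where "s = switch_count u (Suc m)"
  have iff: "enumerate switching_nats j \<le> m \<longleftrightarrow> j \<le> s" for j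
    using enumerate_less_switch_count[of "Suc m" j] by (simp add: s_def less_Suc_eq_le)
  have "s \<le> i"
    using iff[of "Suc i"] \<open>m < N\<close> N by simp
  note N1 = index_bounds(1)
  show ?thesis
  proof (cases "i = 0")
    case True
    then show ?thesis using \<open>s \<le> i\<close> \<delta> by (simp add: s_def)
  next
    case False
    then have i: "real i > 0" by simp
    have scale: "\<delta> * real i \<le> \<delta> * real N" using index_bounds(2) \<delta> by (intro mult_left_mono) auto
    have "real s / real i \<le> real (enumerate switching_nats s) / real N + \<delta>"
      using q[OF \<open>s \<le> i\<close>] by linarith
    also have "\<dots> \<le> real m / real N + \<delta>"
      using iff[of s] N1 by (intro add_right_mono divide_right_mono) auto
    finally have "real s \<le> real i * (real m / real N + \<delta>)"
      using i by (simp add: field_simps)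
    then have up: "real s \<le> real i / real N * real m + \<delta> * real N"
      using scale by (simp add: algebra_simps)
    have "real i / real N * real m - \<delta> * real N \<le> real s + 1"
    proof (cases "s = i")
      case True
      have "real i / real N * real m \<le> real i / real N * real N"
        using \<open>m < N\<close> by (intro mult_left_mono) auto
      moreover have "\<delta> * real N \<ge> 0" using \<delta> by simp
      ultimately show ?thesis using True N1 by simp
    next
      case False
      then have "Suc s \<le> i" using \<open>s \<le> i\<close> by simp
      have "real m / real N \<le> real (enumerate switching_nats (Suc s)) / real N"
        using iff[of "Suc s"] by (intro divide_right_mono) auto
      also have "\<dots> \<le> real (Suc s) / real i + \<delta>"
        using q[OF \<open>Suc s \<le> i\<close>] by linarith
      finally have "real i * (real m / real N) \<le> real i * (real (Suc s) / real i + \<delta>)"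
        using i by (intro mult_left_mono) auto
      moreover have "real i * (v / real i + \<delta>) = v + \<delta> * real i" for v
        using i by (simp add: distrib_left)
      ultimately have "real i / real N * real m \<le> real (Suc s) + \<delta> * real i"
        by (simp only: times_divide_eq_left times_divide_eq_right)
      then show ?thesis using scale by simp
    qed
    then show ?thesis using up unfolding s_def by (simp add: abs_le_iff)
  qed
qed

lemma switch_count_linear_extended:
  assumes "M \<ge> 0" "real m \<le> real N + M"
  shows "\<bar>real (switch_count u (Suc m)) - real i / real N * real m\<bar> \<le> \<delta> * real N + M + 2"
proof (cases "m < N")
  case True
  then show ?thesis using switch_count_linear[OF True] \<open>M \<ge> 0\<close> by simp
next
  case False
  define d where "d = real i / real N"
  note N1 = index_bounds(1) and d = index_bounds(3,4)[folded d_def]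
  define k where "k = m - (N - 1)"
  have m: "m = N - 1 + k" using False by (simp add: k_def)
  have k: "real k \<le> M + 1"
  proof -
    have "real m = real N - 1 + real k" unfolding m using N1 by (simp add: of_nat_diff)
    then show ?thesis using assms(2) by simp
  qed
  have "\<bar>real (switch_count u N) - d * real (N - 1)\<bar> \<le> \<delta> * real N + 1"
    using switch_count_linear[of "N - 1"] N1 by (simp add: d_def)
  moreover have "switch_count u N \<le> switch_count u (Suc m)" "switch_count u (Suc m) \<le> switch_count u N + k"
    using switch_count_add_le[of N k] m N1 by auto
  moreover have "d * real m = d * real (N - 1) + d * real k" by (simp add: m algebra_simps)
  moreover have "0 \<le> d * real k" "d * real k \<le> real k" using d by (auto simp: mult_left_le_one_le)
  ultimately show ?thesis using k unfolding d_def[symmetric] by linarith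
qed

text \<open>At time \<open>t\<close> the sources are, up to a bounded shift of the front, the switching nodes
  at distance at most \<open>\<surd>(t/a)\<close> from the origin.\<close>
lemma source_count_linear_nat:
  assumes t: "0 \<le> t" "t \<le> switching_moment u (int N)"
  defines "\<rho> \<equiv> 1 / sqrt a * sqrt t"
  shows "\<bar>source_count t (int m) - real i / real N * min (real m) \<rho>\<bar> \<le> \<delta> * real N + 3 * (A / a) + 4"
proof (cases "m = 0")
  case True
  have "\<rho> \<ge> 0" using t a_pos by (simp add: \<rho>_def)
  then show ?thesis using True \<delta> a_pos A_pos by (simp add: source_count_def)
next
  case False
  define d E where "d = real i / real N" and "E = A / a"
  have E: "E > 0" "A = a * E" using a_pos A_pos by (auto simp: E_def)
  note N1 = index_bounds(1) and d = index_bounds(3,4)[folded d_def]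
  have \<rho>: "\<rho> \<ge> 0" "t = a * \<rho>\<^sup>2" using t a_pos by (auto simp: \<rho>_def power_mult_distrib power_divide)
  have \<rho>N: "\<rho> \<le> real N + E"
  proof -
    have NK: "int N \<in> switching_nodes u" using enumerate_switching_in N by simp
    have "switching_moment u (int N) \<le> a * (real N)\<^sup>2 + A * real N"
      using growth[OF NK] unfolding of_int_of_nat_eq abs_of_nat by linarith
    then have "a * \<rho>\<^sup>2 \<le> a * (real N)\<^sup>2 + A * real N"
      using t(2) unfolding \<rho>(2)[symmetric] by linarith
    also have "\<dots> \<le> a * (real N + E)\<^sup>2"
    proof -
      have "a * (x + E)\<^sup>2 = a * x\<^sup>2 + a * E * x + (a * E * x + a * E\<^sup>2)" for x
        by (simp add: power2_eq_square algebra_simps)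
      then have "a * (real N + E)\<^sup>2 = a * (real N)\<^sup>2 + A * real N + (A * real N + a * E\<^sup>2)"
        unfolding E(2) .
      moreover have "0 \<le> A * real N + a * E\<^sup>2" using a_pos A_pos by simp
      ultimately show ?thesis by linarith
    qed
    finally have "\<rho>\<^sup>2 \<le> (real N + E)\<^sup>2" 
      by (rule mult_left_le_imp_le[OF _ a_pos])
    then show ?thesis by (rule power2_le_imp_le) (use E(1) in simp)
  qed
  define Q where "Q = {j \<in> {0..<int m}. j \<in> switching_nodes u \<and> switching_moment u j \<le> t}"
  have sc: "source_count t (int m) = real (card Q)"
  proof -
    have "{0..<int m} \<inter> {j. j \<in> switching_nodes u \<and> switching_moment u j \<le> t} = Q"
      by (auto simp: Q_def)
    then show ?thesis by (simp add: source_count_def source_eq[OF t(1)] sum.If_cases)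
  qed
  have cnt: "switch_count u (Suc y) = card (switching_nodes u \<inter> {1..int y})" for y
    by (simp add: switch_count_def)
  have upper: "real (card Q) \<le> d * min (real m) \<rho> + \<delta> * real N + 3 * E + 3"
  proof -
    define y where "y = nat \<lfloor>min (real m) (\<rho> + E)\<rfloor>"
    have y: "real y \<le> min (real m) (\<rho> + E)" using \<rho>(1) E(1) unfolding y_def by linarith
    have "Q \<subseteq> insert 0 (switching_nodes u \<inter> {1..int y})"
    proof
      fix j assume j: "j \<in> Q"
      have "j \<le> int y" if "j \<ge> 1"
      proof -
        define x where "x = real_of_int j"
        have x: "x \<ge> 1" using that by (simp add: x_def)
        have "a * x\<^sup>2 - A * x \<le> a * \<rho>\<^sup>2"
        proof -
          have "switching_moment u j \<le> t" "j \<in> switching_nodes u" using j by (simp_all add: Q_def)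
          then show ?thesis
            using growth[of j] that unfolding x_def \<rho>(2)[symmetric] by (simp add: abs_le_iff)
        qed
        then have "a * (x * (x - E)) \<le> a * \<rho>\<^sup>2" unfolding E(2) by (simp add: algebra_simps power2_eq_square)
        then have le: "x * (x - E) \<le> \<rho>\<^sup>2" using a_pos by simp
        have "x \<le> \<rho> + E"
        proof (rule ccontr)
          assume "\<not> x \<le> \<rho> + E"
          then have "\<rho> < x" "\<rho> < x - E" using E(1) by auto
          then have "\<rho> * \<rho> < x * (x - E)" using \<rho>(1) by (intro mult_strict_mono') auto
          then show False using le by (simp add: power2_eq_square)
        qed
        moreover have "x \<le> real m" using j by (simp add: Q_def x_def)
        ultimately have "j \<le> \<lfloor>min (real m) (\<rho> + E)\<rfloor>" by (simp add: x_def le_floor_iff)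
        then show ?thesis unfolding y_def by linarith
      qed
      then show "j \<in> insert 0 (switching_nodes u \<inter> {1..int y})"
        using j by (cases "j = 0") (auto simp: Q_def)
    qed
    then have "card Q \<le> card (insert 0 (switching_nodes u \<inter> {1..int y}))"
      by (intro card_mono) auto
    also have "\<dots> = Suc (switch_count u (Suc y))" by (simp add: cnt)
    finally have "real (card Q) \<le> real (switch_count u (Suc y)) + 1" by simp
    also have "real (switch_count u (Suc y)) \<le> d * real y + (\<delta> * real N + 2 * E + 2)"
      using switch_count_linear_extended[of "2 * E" y] y \<rho>N E(1)
      by (simp add: d_def abs_le_iff)
    also have "d * real y \<le> d * (min (real m) \<rho> + E)"
      using y d E(1) by (intro mult_left_mono) auto
    also have "d * (min (real m) \<rho> + E) \<le> d * min (real m) \<rho> + E"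
      using d E(1) by (simp add: distrib_left mult_left_le_one_le)
    finally show ?thesis by simp
  qed
  have lower: "d * min (real m) \<rho> - \<delta> * real N - E - 4 \<le> real (card Q)"
  proof -
    define y where "y = nat \<lfloor>min (real m - 1) (\<rho> - E)\<rfloor>"
    have y: "real y \<ge> min (real m - 1) (\<rho> - E) - 1" "real y \<le> real N"
      using \<rho>N E(1) unfolding y_def by linarith+
    have "switching_nodes u \<inter> {1..int y} \<subseteq> Q"
    proof
      fix j assume j: "j \<in> switching_nodes u \<inter> {1..int y}"
      define x where "x = real_of_int j"
      have x: "x \<ge> 1" using j by (simp add: x_def)
      have "1 \<le> j" "j \<le> int y" using j by simp_all
      then have "j \<le> \<lfloor>min (real m - 1) (\<rho> - E)\<rfloor>" unfolding y_def by linarith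
      then have x2: "x \<le> real m - 1" "x \<le> \<rho> - E" by (simp_all add: x_def le_floor_iff)
      have "switching_moment u j \<le> a * x\<^sup>2 + A * x"
        using growth[of j] j by (simp add: x_def)
      also have "\<dots> = a * (x * (x + E))" unfolding E(2) by (simp add: algebra_simps power2_eq_square)
      also have "\<dots> \<le> a * (\<rho> * \<rho>)"
        using x x2 E(1) a_pos by (intro mult_left_mono mult_mono) auto
      also have "\<dots> = t" unfolding \<rho>(2) by (simp only: power2_eq_square)
      finally show "j \<in> Q" using j x2 by (simp add: Q_def x_def)
    qed
    moreover have "finite Q" by (rule finite_subset[of _ "{0..<int m}"]) (auto simp: Q_def)
    ultimately have "switch_count u (Suc y) \<le> card Q"
      unfolding cnt by (intro card_mono)
    then have "real (switch_count u (Suc y)) \<le> real (card Q)" by simp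
    moreover have "d * real y - (\<delta> * real N + 2) \<le> real (switch_count u (Suc y))"
      using switch_count_linear_extended[of 0 y] y(2)
      by (simp add: d_def abs_le_iff)
    moreover have "d * (min (real m) \<rho> - (E + 2)) \<le> d * real y"
      using y(1) d E(1) by (intro mult_left_mono) auto
    moreover have "d * (min (real m) \<rho> - (E + 2)) \<ge> d * min (real m) \<rho> - (E + 2)"
    proof -
      have "d * (E + 2) \<le> E + 2" using d E(1) by (intro mult_left_le_one_le) auto
      then show ?thesis by (simp add: right_diff_distrib)
    qed
    ultimately show ?thesis by linarith
  qed
  show ?thesis
    using upper lower E(1) unfolding sc d_def[symmetric] E_def[symmetric] by linarith
qed

lemma source_count_linear:
  assumes t: "0 \<le> t" "t \<le> switching_moment u (int N)"
  defines "\<rho> \<equiv> 1 / sqrt a * sqrt t"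
  shows "\<bar>source_count t m - real i / real N * max (- \<rho>) (min (real_of_int m) \<rho>)\<bar> \<le> \<delta> * real N + 3 * (A / a) + 6"
proof -
  have \<rho>: "\<rho> \<ge> 0" using t a_pos by (simp add: \<rho>_def)
  note nat = source_count_linear_nat[OF t, folded \<rho>_def]
  show ?thesis
  proof (cases "m \<ge> 0")
    case True
    then obtain k where k: "m = int k" using nonneg_int_cases by blast
    have "max (- \<rho>) (min (real_of_int m) \<rho>) = min (real k) \<rho>" using \<rho> k by auto
    then show ?thesis using nat[of k] k by simp
  next
    case False
    define k where "k = nat (- m)"
    have m: "m = - int k" using False by (simp add: k_def)
    have "(\<Sum>j\<in>{m..<0}. source j t) = (\<Sum>j\<in>{1..<int k + 1}. source j t)"
      by (rule sum.reindex_bij_witness[of _ uminus uminus]) (auto simp: m source_symmetric)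
    moreover have "{0..<int (Suc k)} = insert 0 {1..<int k + 1}" by auto
    ultimately have sc: "source_count t m = - (source_count t (int (Suc k)) - source 0 t)"
      using False by (simp add: source_count_def)
    have clamp: "max (- \<rho>) (min (real_of_int m) \<rho>) = - min (real k) \<rho>" using \<rho> m by auto
    define d where "d = real i / real N"
    note d = index_bounds(3,4)[folded d_def]
    have "\<bar>d * (min (real (Suc k)) \<rho> - min (real k) \<rho>)\<bar> \<le> 1"
      unfolding abs_mult using d by (intro mult_le_one) auto
    then have "\<bar>d * min (real (Suc k)) \<rho> - d * min (real k) \<rho>\<bar> \<le> 1" by (simp add: right_diff_distrib)
    moreover note nat[of "Suc k"] source_01[of 0 t]
    ultimately show ?thesis unfolding sc clamp d_def[symmetric] by (simp add: abs_le_iff)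
  qed
qed

end

end

section \<open>Comparison with the self-similar solution\<close>

context hysteresis_lattice
begin

context
  fixes x0 B T d K0 :: real
  assumes x0: "x0 > 0" and B: "B > 0" and T0: "T > 0" and d: "0 \<le> d" "d \<le> 1" and K0: "K0 \<ge> 0"
    and lip: "\<And>x y t. t > 0 \<Longrightarrow> \<bar>spread x0 x t - spread x0 y t\<bar> \<le> B * t * \<bar>x - y\<bar>"
    and lap: "\<And>x t. t > 0 \<Longrightarrow> \<bar>spread x0 (x + 1) t - 2 * spread x0 x t + spread x0 (x - 1) t 
                - sqrt t * profile'' x0 (x / sqrt t)\<bar> \<le> 2 * B"
    and window: "\<And>x r t. t > 0 \<Longrightarrow> r \<ge> 0 \<Longrightarrow> 
       \<bar>spread x0 (x + r) t - spread x0 x t - r * (t * profile' x0 (x / sqrt t))\<bar> \<le> B * r\<^sup>2 * sqrt t"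
    and count: "\<And>t m. 0 \<le> t \<Longrightarrow> t \<le> T \<Longrightarrow> 
        \<bar>source_count t m - d * max (- (x0 * sqrt t)) (min (real_of_int m) (x0 * sqrt t))\<bar> \<le> K0"
begin

text \<open>Summing over a window turns the source into a difference of counting functions, which is
  close to that of the continuous problem although the individual sources are not.\<close>
lemma window_comparison:
  "\<bar>window r n T - (h1 + h2) * d * (spread x0 (real_of_int n + real r) T - spread x0 (real_of_int n) T)\<bar>
     \<le> (h1 + h2) * (2 * K0 + 4 * B) * T"
proof -
  define S0 where "S0 = h1 + h2"
  have S0: "S0 > 0" using h12_pos by (simp add: S0_def)
  define D where "D n t = spread x0 (real_of_int n + real r) t - spread x0 (real_of_int n) t" for n t
  define E where "E n t = window r n t - S0 * d * D n t" for n t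
  define \<kappa> where "\<kappa> = S0 * (2 * K0 + 4 * B)"
  have "\<kappa> \<ge> 0" using S0 K0 B by (simp add: \<kappa>_def)
  (* the factor t in spread makes the value of the profile at x / 0 irrelevant *)
  have D0: "D n 0 = 0" for n by (simp add: D_def spread_def)
  have D_bound: "\<bar>D n t\<bar> \<le> B * t * real r" if "t \<ge> 0" for n t
  proof (cases "t = 0")
    case False
    then show ?thesis
      using lip[of t "real_of_int n + real r" "real_of_int n"] that by (simp add: D_def)
  qed (simp add: D0)
  have D_deriv: "(D n has_real_derivative 
      (sqrt t * profile'' x0 ((real_of_int n + real r) / sqrt t) 
        + max (- (x0 * sqrt t)) (min (real_of_int n + real r) (x0 * sqrt t)))
      - (sqrt t * profile'' x0 (real_of_int n / sqrt t) 
        + max (- (x0 * sqrt t)) (min (real_of_int n) (x0 * sqrt t)))) (at t)" if "t > 0" for n t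
    unfolding D_def by (rule DERIV_diff[OF spread_time_deriv[OF x0 that] spread_time_deriv[OF x0 that]])
  have D_cont: "continuous_on {0..T} (D n)" for n
    unfolding continuous_on_eq_continuous_within
  proof
    fix t assume t: "t \<in> {0..T}"
    show "continuous (at t within {0..T}) (D n)"
    proof (cases "t = 0")
      case True
      have "((\<lambda>t. B * t * real r) \<longlongrightarrow> B * 0 * real r) (at 0 within {0..T})"
        by (intro tendsto_intros)
      then have lim: "((\<lambda>t. B * t * real r) \<longlongrightarrow> 0) (at 0 within {0..T})"
        by (simp only: mult_zero_right mult_zero_left)
      have "eventually (\<lambda>t. t \<in> {0..T}) (at 0 within {0..T})"
        by (simp add: eventually_at_filter)
      then have "eventually (\<lambda>t. norm (D n t) \<le> B * t * real r) (at 0 within {0..T})"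
      proof eventually_elim
        case (elim t)
        then show ?case using D_bound[of t n] by simp
      qed
      from Lim_null_comparison[OF this lim] have "(D n \<longlongrightarrow> 0) (at 0 within {0..T})" .
      then show ?thesis using True D0 by (simp add: continuous_within)
    next
      case False
      then have "isCont (D n) t" using t by (intro DERIV_isCont[OF D_deriv]) simp
      then show ?thesis by (rule continuous_at_imp_continuous_at_within)
    qed
  qed
  define F where "F = exceptional_times T"
  note F = u_deriv(1)[OF T0, folded F_def] window_deriv[OF T0, where r = r, folded F_def]
  have E_deriv: "\<exists>D. (E n has_real_derivative D) (at t) \<and> \<bar>D - lattice_laplacian (\<lambda>m. E m t) n\<bar> \<le> \<kappa>"
    if t: "t \<in> {0<..<T} - F" for n t
  proof -
    have "t > 0" "t \<le> T" using t by auto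
    define lap where "lap x = spread x0 (x + 1) t - 2 * spread x0 x t + spread x0 (x - 1) t" for x
    define a where "a x = sqrt t * profile'' x0 (x / sqrt t)" for x
    define cl where "cl x = max (- (x0 * sqrt t)) (min x (x0 * sqrt t))" for x
    define y where "y = real_of_int n + real r"
    define p where "p = lattice_laplacian (\<lambda>m. window r m t) n"
    define s1 s0 where "s1 = source_count t (n + int r)" and "s0 = source_count t n"
    have 1: "(window r n has_real_derivative p + S0 * (s1 - s0)) (at t)"
      using F(2)[OF t, of n] unfolding sum_source p_def S0_def s1_def s0_def .
    have 2: "(D n has_real_derivative (a y + cl y) - (a (real_of_int n) + cl (real_of_int n))) (at t)"
      using D_deriv[OF \<open>t > 0\<close>, of n] unfolding a_def cl_def y_def .
    have der: "(E n has_real_derivative p + S0 * (s1 - s0) - 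
        S0 * d * ((a y + cl y) - (a (real_of_int n) + cl (real_of_int n)))) (at t)"
      unfolding E_def by (rule DERIV_diff[OF 1 DERIV_cmult[OF 2]])
    have lapD: "lattice_laplacian (\<lambda>m. D m t) n = lap y - lap (real_of_int n)"
      by (simp add: lattice_laplacian_def D_def lap_def y_def algebra_simps)
    have "lattice_laplacian (\<lambda>m. E m t) n = p - S0 * d * lattice_laplacian (\<lambda>m. D m t) n"
      by (simp add: lattice_laplacian_def E_def p_def algebra_simps)
    then have E: "lattice_laplacian (\<lambda>m. E m t) n = p - S0 * d * (lap y - lap (real_of_int n))"
      unfolding lapD .
    have diff: "p + S0 * (s1 - s0) - S0 * d * ((a y + cl y) - (a (real_of_int n) + cl (real_of_int n)))
        - lattice_laplacian (\<lambda>m. E m t) n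
      = S0 * ((s1 - d * cl y) - (s0 - d * cl (real_of_int n)) 
         + d * ((lap y - a y) - (lap (real_of_int n) - a (real_of_int n))))"
      unfolding E by (simp add: algebra_simps)
    have "\<bar>s1 - d * cl y\<bar> \<le> K0" "\<bar>s0 - d * cl (real_of_int n)\<bar> \<le> K0"
      using count[of t "n + int r"] count[of t n] \<open>t > 0\<close> \<open>t \<le> T\<close>
      by (simp_all add: s1_def s0_def cl_def y_def)
    moreover have "\<bar>lap y - a y\<bar> \<le> 2 * B" "\<bar>lap (real_of_int n) - a (real_of_int n)\<bar> \<le> 2 * B"
      using lap[OF \<open>t > 0\<close>] by (simp_all add: lap_def a_def)
    then have "\<bar>d * ((lap y - a y) - (lap (real_of_int n) - a (real_of_int n)))\<bar> \<le> 1 * (4 * B)"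
      unfolding abs_mult using d by (intro mult_mono) auto
    ultimately have "\<bar>(s1 - d * cl y) - (s0 - d * cl (real_of_int n)) 
         + d * ((lap y - a y) - (lap (real_of_int n) - a (real_of_int n)))\<bar> \<le> 2 * K0 + 4 * B"
      by linarith
    then have "\<bar>p + S0 * (s1 - s0) - S0 * d * ((a y + cl y) - (a (real_of_int n) + cl (real_of_int n)))
        - lattice_laplacian (\<lambda>m. E m t) n\<bar> \<le> \<kappa>"
      unfolding diff \<kappa>_def abs_mult using S0 by (intro mult_mono) auto
    then show ?thesis using der by blast
  qed
  define A where "A = real r * (S0 * T) + S0 * d * (B * T * real r)"
  have A: "A \<ge> 0" using S0 B d T0 by (simp add: A_def)
  have E_bound: "\<bar>E n t\<bar> \<le> A" if t: "t \<in> {0..T}" for n t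
  proof -
    have "0 \<le> window r n t" "window r n t \<le> real r * (S0 * t)"
      using window_bounds[of t r n] t by (simp_all add: S0_def)
    moreover have "real r * (S0 * t) \<le> real r * (S0 * T)"
      using t S0 by (intro mult_left_mono) auto
    moreover have "\<bar>S0 * d * D n t\<bar> \<le> S0 * d * (B * T * real r)"
    proof -
      have "B * t * real r \<le> B * T * real r"
        using t B by (intro mult_right_mono mult_left_mono) auto
      then have "\<bar>D n t\<bar> \<le> B * T * real r" using D_bound[of t n] t by simp
      then show ?thesis
        using S0 \<open>0 \<le> d\<close> by (simp add: abs_mult mult_left_mono)
    qed
    ultimately show ?thesis unfolding E_def A_def by linarith
  qed
  have E_cont: "continuous_on {0..T} (E n)" for n
    unfolding E_def by (intro continuous_intros window_cont D_cont)
  have E_init: "E n 0 = 0" for n by (simp add: E_def window_init D0)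
  have T: "T \<in> {0..T}" using T0 by simp
  have "E n T \<le> \<kappa> * (T - 0)"
  proof (rule lattice_comparison[OF F(1) E_cont _ _ _ A order_refl \<open>\<kappa> \<ge> 0\<close> T])
    show "\<exists>D. (E n has_real_derivative D) (at t) \<and> D \<le> lattice_laplacian (\<lambda>m. E m t) n + \<kappa>" 
      if "t \<in> {0<..<T} - F" for n t
      using E_deriv[OF that, of n] by (elim exE conjE) (intro exI conjI, assumption, linarith)
    show "E n t \<le> A * exp (0 * real_of_int \<bar>n\<bar>)" if "t \<in> {0..T}" for n t
      using E_bound[OF that, of n] by simp
  qed (simp add: E_init)
  moreover have "- E n T \<le> \<kappa> * (T - 0)"
  proof (rule lattice_comparison[where w = "\<lambda>n t. - E n t", OF F(1) _ _ _ _ A order_refl \<open>\<kappa> \<ge> 0\<close> T])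
    show "continuous_on {0..T} (\<lambda>t. - E n t)" for n by (intro continuous_intros E_cont)
    show "\<exists>D. ((\<lambda>t. - E n t) has_real_derivative D) (at t) \<and> D \<le> lattice_laplacian (\<lambda>m. - E m t) n + \<kappa>" 
      if t: "t \<in> {0<..<T} - F" for n t
    proof -
      obtain D where D: "(E n has_real_derivative D) (at t)" "\<bar>D - lattice_laplacian (\<lambda>m. E m t) n\<bar> \<le> \<kappa>"
        using E_deriv[OF t, of n] by blast
      have "lattice_laplacian (\<lambda>m. - E m t) n = - lattice_laplacian (\<lambda>m. E m t) n"
        by (simp add: lattice_laplacian_def)
      then have "- D \<le> lattice_laplacian (\<lambda>m. - E m t) n + \<kappa>" using D(2) by linarith
      then show ?thesis using DERIV_minus[OF D(1)] by blast
    qed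
    show "- E n t \<le> A * exp (0 * real_of_int \<bar>n\<bar>)" if "t \<in> {0..T}" for n t
      using E_bound[OF that, of n] by simp
  qed (simp add: E_init)
  ultimately have "\<bar>E n T\<bar> \<le> \<kappa> * T" by (simp add: abs_le_iff)
  then show ?thesis unfolding E_def D_def \<kappa>_def S0_def .
qed

text \<open>Three errors: the comparison of the windows, and the replacement of both window averages by
  point values, which is possible since both functions are Lipschitz in space.  The first
  decreases and the other two increase with the window length \<open>r\<close>.\<close>
lemma deficit_comparison:
  assumes "r \<ge> 1"
  shows "\<bar>deficit n T - (h1 + h2) * d * (T * profile' x0 (real_of_int n / sqrt T))\<bar>
     \<le> (h1 + h2) * ((2 * K0 + 4 * B) * T / real r + (2 * sqrt T + 1) * real r + B * real r * sqrt T)"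
proof -
  define S0 q x where "S0 = h1 + h2" and "q = T * profile' x0 (real_of_int n / sqrt T)" and "x = real r"
  have S0: "S0 > 0" using h12_pos by (simp add: S0_def)
  have x: "x > 0" using \<open>r \<ge> 1\<close> by (simp add: x_def)
  define W where "W = spread x0 (real_of_int n + x) T - spread x0 (real_of_int n) T"
  have 1: "\<bar>window r n T - S0 * d * W\<bar> \<le> S0 * (2 * K0 + 4 * B) * T"
    using window_comparison[of r n] unfolding S0_def W_def x_def .
  have 2: "\<bar>window r n T - x * deficit n T\<bar> \<le> S0 * (2 * sqrt T + 1) * x\<^sup>2"
    using window_approx[OF T0] unfolding S0_def x_def .
  have "\<bar>W - x * q\<bar> \<le> B * x\<^sup>2 * sqrt T"
    using window[OF T0, of x] x unfolding W_def q_def by simp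
  then have 3: "\<bar>S0 * d * W - S0 * d * (x * q)\<bar> \<le> S0 * 1 * (B * x\<^sup>2 * sqrt T)"
    unfolding right_diff_distrib[symmetric] abs_mult using S0 d
    by (intro mult_mono) auto
  have "x * \<bar>deficit n T - S0 * d * q\<bar> = \<bar>x * deficit n T - S0 * d * (x * q)\<bar>"
  proof -
    have "x * \<bar>deficit n T - S0 * d * q\<bar> = \<bar>x * (deficit n T - S0 * d * q)\<bar>"
      using x by (simp add: abs_mult)
    also have "x * (deficit n T - S0 * d * q) = x * deficit n T - S0 * d * (x * q)"
      by (simp add: algebra_simps)
    finally show ?thesis .
  qed
  also have "\<dots> \<le> S0 * (2 * K0 + 4 * B) * T + S0 * (2 * sqrt T + 1) * x\<^sup>2 + S0 * 1 * (B * x\<^sup>2 * sqrt T)"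
    using 1 2 3 by linarith
  also have "\<dots> = x * (S0 * ((2 * K0 + 4 * B) * T / x + (2 * sqrt T + 1) * x + B * x * sqrt T))"
  proof -
    have "S0 * P * T + S0 * Q * x\<^sup>2 + S0 * 1 * (B * x\<^sup>2 * w) = x * (S0 * (P * T / x + Q * x + B * x * w))" for P Q w
      using x by (simp add: field_simps power2_eq_square)
    then show ?thesis .
  qed
  finally have "\<bar>deficit n T - S0 * d * q\<bar> \<le> S0 * ((2 * K0 + 4 * B) * T / x + (2 * sqrt T + 1) * x + B * x * sqrt T)"
    using x by (rule mult_left_le_imp_le)
  then show ?thesis unfolding S0_def q_def x_def .
qed

end

end

section \<open>Asymptotics along the switching nodes\<close>

context quadratic_hysteresis_lattice
begin

definition moment :: "nat \<Rightarrow> real" where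
  "moment i = switching_moment u (int (node i))"

definition density :: "nat \<Rightarrow> real" where
  "density i = real i / real (node i)"

text \<open>The position of the switching front in the similarity variable \<open>n / \<surd>t\<close>.\<close>
definition front :: real where
  "front = 1 / sqrt a"

lemma front_pos: "front > 0" and front_sq: "front\<^sup>2 = 1 / a"
  using a_pos by (auto simp: front_def power_divide)

lemma node_pos: "node i \<ge> 1"
  unfolding node_def by (rule enumerate_switching_pos)

lemma node_switching: "int (node i) \<in> switching_nodes u"
  by (simp add: node_def enumerate_switching_in)

lemma strict_mono_node: "strict_mono node"
  unfolding node_def using infinite_switching_nats by (intro strict_monoI) simp

lemma density_bounds: "0 \<le> density i" "density i \<le> 1"
proof -
  have "i \<le> node i" by (rule seq_suble[OF strict_mono_node])
  then show "0 \<le> density i" "density i \<le> 1"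
    using node_pos[of i] by (auto simp: density_def)
qed

lemma node_at_top: "filterlim (\<lambda>i. real (node i)) at_top sequentially"
  by (rule filterlim_compose[OF filterlim_real_sequentially filterlim_subseq[OF strict_mono_node]])

lemma moment_bound: "\<bar>moment i - a * (real (node i))\<^sup>2\<bar> \<le> A * real (node i)"
  using growth[OF node_switching[of i]] by (simp add: moment_def)

lemma moment_ratio: "(\<lambda>i. moment i / (real (node i))\<^sup>2) \<longlonglongrightarrow> a"
proof -
  have "(\<lambda>i. moment i / (real (node i))\<^sup>2 - a) \<longlonglongrightarrow> 0"
  proof (rule Lim_null_comparison)
    show "eventually (\<lambda>i. norm (moment i / (real (node i))\<^sup>2 - a) \<le> A / real (node i)) sequentially"
    proof (intro always_eventually allI)
      fix i
      define x where "x = real (node i)"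
      have x: "x > 0" using node_pos[of i] by (simp add: x_def)
      have "moment i / x\<^sup>2 - a = (moment i - a * x\<^sup>2) / x\<^sup>2" using x by (simp add: field_simps)
      then have "\<bar>moment i / x\<^sup>2 - a\<bar> = \<bar>moment i - a * x\<^sup>2\<bar> / x\<^sup>2" by (simp add: abs_divide)
      also have "\<dots> \<le> A * x / x\<^sup>2"
        using moment_bound[of i] by (intro divide_right_mono) (auto simp: x_def)
      also have "\<dots> = A / x" using x by (simp add: power2_eq_square)
      finally show "norm (moment i / (real (node i))\<^sup>2 - a) \<le> A / real (node i)" by (simp add: x_def)
    qed
    show "(\<lambda>i. A / real (node i)) \<longlonglongrightarrow> 0"
      by (rule real_tendsto_divide_at_top[OF tendsto_const node_at_top])
  qed
  then show ?thesis by (simp add: LIM_zero_iff)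
qed

lemma moment_at_top: "filterlim moment at_top sequentially"
proof -
  have "filterlim (\<lambda>i. moment i / (real (node i))\<^sup>2 * (real (node i))\<^sup>2) at_top sequentially"
    by (rule filterlim_tendsto_pos_mult_at_top[OF moment_ratio a_pos])
       (intro filterlim_pow_at_top node_at_top, simp)
  moreover have "moment i / (real (node i))\<^sup>2 * (real (node i))\<^sup>2 = moment i" for i
    using node_pos[of i] by simp
  ultimately show ?thesis by simp
qed

lemma sqrt_moment_at_top: "filterlim (\<lambda>i. sqrt (moment i)) at_top sequentially"
  by (rule filterlim_compose[OF sqrt_at_top moment_at_top])

lemma node_ratio: "(\<lambda>i. real (node i) / sqrt (moment i)) \<longlonglongrightarrow> front"
proof -
  have "(\<lambda>i. 1 / sqrt (moment i / (real (node i))\<^sup>2)) \<longlonglongrightarrow> 1 / sqrt a"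
    using a_pos by (intro tendsto_intros moment_ratio) auto
  moreover have "1 / sqrt (moment i / (real (node i))\<^sup>2) = real (node i) / sqrt (moment i)" for i
    by (simp add: real_sqrt_divide)
  ultimately show ?thesis by (simp add: front_def)
qed

text \<open>The window length is a small multiple of \<open>\<surd>t\<close>: long enough to average out the
  irregularity of the sources, short enough for the Lipschitz bounds.\<close>
lemma deficit_uniform_asymptotics:
  assumes "\<epsilon> > 0"
  shows "eventually (\<lambda>i. \<forall>n. \<bar>deficit n (moment i) / moment i 
      - (h1 + h2) * density i * profile' front (real_of_int n / sqrt (moment i))\<bar> \<le> \<epsilon>) sequentially"
proof -
  define S0 where "S0 = h1 + h2"
  have S0: "S0 > 0" using h12_pos by (simp add: S0_def)
  obtain B where B: "B > 0" 
    "\<And>x y t. t > 0 \<Longrightarrow> \<bar>spread front x t - spread front y t\<bar> \<le> B * t * \<bar>x - y\<bar>"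
    "\<And>x t. t > 0 \<Longrightarrow> \<bar>spread front (x + 1) t - 2 * spread front x t + spread front (x - 1) t 
                - sqrt t * profile'' front (x / sqrt t)\<bar> \<le> 2 * B"
    "\<And>x r t. t > 0 \<Longrightarrow> r \<ge> 0 \<Longrightarrow> \<bar>spread front (x + r) t - spread front x t - r * (t * profile' front (x / sqrt t))\<bar>
                 \<le> B * r\<^sup>2 * sqrt t"
    by (rule spread_bounds[OF front_pos], rule that; blast)
  obtain \<delta> :: "nat \<Rightarrow> real" where \<delta>: "\<delta> \<longlonglongrightarrow> 0" "\<And>i. \<delta> i \<ge> 0"
    "\<And>i j. j \<le> i \<Longrightarrow> \<bar>real (enumerate switching_nats j) / real (enumerate switching_nats (Suc i))
        - real j / real i\<bar> \<le> \<delta> i"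
    using quasi_uniform_sequence[OF quasi_uniform] by blast
  define C where "C = 3 * (A / a) + 6"
  define K0 where "K0 i = \<delta> i * real (node i) + C" for i
  have K0: "K0 i \<ge> 0" for i
    using \<delta>(2)[of i] a_pos A_pos by (simp add: K0_def C_def)
  define \<eta> where "\<eta> = \<epsilon> / (S0 * (4 + B))"
  have \<eta>: "\<eta> > 0" using assms S0 B(1) by (simp add: \<eta>_def)
  define w where "w i = sqrt (moment i)" for i
  define b where "b i = S0 * ((2 * (K0 i / w i) + 4 * B / w i) / \<eta> + (3 + B) * (\<eta> + 1 / w i))" for i
  have w_top: "filterlim w at_top sequentially" unfolding w_def by (rule sqrt_moment_at_top)
  have "(\<lambda>i. \<delta> i * (real (node i) / w i) + C / w i) \<longlonglongrightarrow> 0 * front + 0"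
    unfolding w_def
    by (intro tendsto_add tendsto_mult \<delta>(1) node_ratio real_tendsto_divide_at_top[OF tendsto_const sqrt_moment_at_top])
  then have K0_lim: "(\<lambda>i. K0 i / w i) \<longlonglongrightarrow> 0"
    by (simp add: K0_def add_divide_distrib)
  have "b \<longlonglongrightarrow> S0 * ((2 * 0 + 0) / \<eta> + (3 + B) * (\<eta> + 0))"
    unfolding b_def
    by (intro tendsto_mult tendsto_add tendsto_divide tendsto_const K0_lim 
          real_tendsto_divide_at_top[OF tendsto_const w_top]) (use \<eta> in auto)
  moreover have "S0 * ((2 * 0 + 0) / \<eta> + (3 + B) * (\<eta> + 0)) < \<epsilon>"
  proof -
    have "S0 * (3 + B) * \<eta> < S0 * (4 + B) * \<eta>"
      using S0 \<eta> by (intro mult_strict_right_mono mult_strict_left_mono) simp_all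
    also have "\<dots> = \<epsilon>" using S0 B(1) by (simp add: \<eta>_def)
    finally show ?thesis by simp
  qed
  ultimately have "eventually (\<lambda>i. b i < \<epsilon>) sequentially" by (rule order_tendstoD(2))
  moreover have "eventually (\<lambda>i. w i \<ge> 1) sequentially"
    by (rule w_top[unfolded filterlim_at_top, rule_format])
  ultimately show ?thesis
  proof eventually_elim
    case (elim i)
    define T where "T = moment i"
    have "T \<ge> 1" using elim(2) by (simp add: w_def T_def)
    then have T: "T \<ge> 1" "w i = sqrt T" "T = w i * w i"
      by (simp_all add: w_def flip: T_def)
    have T0: "T > 0" using T(1) by simp
    define r where "r = nat \<lceil>\<eta> * w i\<rceil>"
    have "\<eta> * w i > 0" using \<eta> elim(2) by (intro mult_pos_pos) auto
    moreover have "1 \<le> nat \<lceil>v\<rceil>" "v \<le> real (nat \<lceil>v\<rceil>)" "real (nat \<lceil>v\<rceil>) \<le> v + 1" if "v > 0" for v :: real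
      using that by linarith+
    ultimately have r: "r \<ge> 1" "\<eta> * w i \<le> real r" "real r \<le> \<eta> * w i + 1" and "\<eta> * w i > 0"
      unfolding r_def by blast+
    have count: "\<bar>source_count t m - density i * max (- (front * sqrt t)) (min (real_of_int m) (front * sqrt t))\<bar> \<le> K0 i"
      if "0 \<le> t" "t \<le> T" for t m
      using source_count_linear[OF \<delta>(3) refl \<delta>(2) that(1), of i m] that(2)
      by (simp add: node_def density_def front_def K0_def C_def T_def moment_def)
    show ?case
    proof
      fix n
      have "\<bar>deficit n T - S0 * density i * (T * profile' front (real_of_int n / sqrt T))\<bar>
        \<le> S0 * ((2 * K0 i + 4 * B) * T / real r + (2 * sqrt T + 1) * real r + B * real r * sqrt T)"
        unfolding S0_def
        by (rule deficit_comparison[OF front_pos B(1) T0 density_bounds K0 B(2) B(3) B(4) count r(1)])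
      also have "\<dots> \<le> T * b i"
      proof -
        have 1: "(2 * K0 i + 4 * B) * T / real r \<le> T * ((2 * (K0 i / w i) + 4 * B / w i) / \<eta>)"
        proof -
          have "(2 * K0 i + 4 * B) * T / real r \<le> (2 * K0 i + 4 * B) * T / (\<eta> * w i)"
            using r(2) \<open>\<eta> * w i > 0\<close> K0[of i] B(1) T0 by (intro divide_left_mono) auto
          also have "\<dots> = T * ((2 * (K0 i / w i) + 4 * B / w i) / \<eta>)"
            using \<eta> elim(2) by (simp add: field_simps)
          finally show ?thesis .
        qed
        have 2: "(2 * sqrt T + 1) * real r + B * real r * sqrt T \<le> T * ((3 + B) * (\<eta> + 1 / w i))"
        proof -
          have "(2 * w i + 1) * real r + B * real r * w i \<le> (3 * w i) * real r + B * real r * w i"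
            using elim(2) by (intro add_right_mono mult_right_mono) auto
          also have "\<dots> = (3 + B) * w i * real r" by (simp add: algebra_simps)
          also have "\<dots> \<le> (3 + B) * w i * (\<eta> * w i + 1)"
            using r(3) B(1) elim(2) by (intro mult_left_mono) auto
          also have "\<dots> = T * ((3 + B) * (\<eta> + 1 / w i))"
            unfolding T(3) using elim(2) by (simp add: field_simps)
          finally show ?thesis unfolding T(2) .
        qed
        have "T * b i = S0 * (T * ((2 * (K0 i / w i) + 4 * B / w i) / \<eta>) + T * ((3 + B) * (\<eta> + 1 / w i)))"
          unfolding b_def by (simp only: distrib_left mult.left_commute)
        then show ?thesis using 1 2 S0 by (simp only:) (intro mult_left_mono, auto)
      qed
      also have "\<dots> \<le> T * \<epsilon>" using elim(1) T0 by simp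
      finally have *: "\<bar>deficit n T - S0 * density i * (T * profile' front (real_of_int n / sqrt T))\<bar> \<le> T * \<epsilon>" .
      define p where "p = profile' front (real_of_int n / sqrt T)"
      have "\<bar>deficit n T / T - S0 * density i * p\<bar> = \<bar>deficit n T - S0 * density i * (T * p)\<bar> / T"
      proof -
        have "deficit n T / T - S0 * density i * p = (deficit n T - S0 * density i * (T * p)) / T"
          using T0 by (simp add: diff_divide_distrib)
        then show ?thesis using T0 by (simp add: abs_divide)
      qed
      also have "\<dots> \<le> \<epsilon>" using * T0 unfolding p_def by (simp add: pos_divide_le_eq mult.commute)
      finally show "\<bar>deficit n (moment i) / moment i 
        - (h1 + h2) * density i * profile' front (real_of_int n / sqrt (moment i))\<bar> \<le> \<epsilon>"
        unfolding p_def T_def S0_def .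
    qed
  qed
qed

lemma deficit_along:
  fixes \<nu> :: "nat \<Rightarrow> int"
  assumes \<nu>: "(\<lambda>i. real_of_int (\<nu> i) / sqrt (moment i)) \<longlonglongrightarrow> \<xi>"
  shows "(\<lambda>i. deficit (\<nu> i) (moment i) / moment i - (h1 + h2) * density i * profile' front \<xi>) \<longlonglongrightarrow> 0"
proof -
  define x where "x i = real_of_int (\<nu> i) / sqrt (moment i)" for i
  have 1: "(\<lambda>i. deficit (\<nu> i) (moment i) / moment i - (h1 + h2) * density i * profile' front (x i)) \<longlonglongrightarrow> 0"
  proof (rule tendstoI)
    fix e :: real assume "e > 0"
    then have "eventually (\<lambda>i. \<forall>n. \<bar>deficit n (moment i) / moment i 
      - (h1 + h2) * density i * profile' front (real_of_int n / sqrt (moment i))\<bar> \<le> e / 2) sequentially"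
      by (intro deficit_uniform_asymptotics) simp
    then show "eventually (\<lambda>i. dist (deficit (\<nu> i) (moment i) / moment i 
        - (h1 + h2) * density i * profile' front (x i)) 0 < e) sequentially"
    proof eventually_elim
      case (elim i)
      then have "\<bar>deficit (\<nu> i) (moment i) / moment i 
        - (h1 + h2) * density i * profile' front (x i)\<bar> \<le> e / 2"
        unfolding x_def by blast
      then show ?case using \<open>e > 0\<close> by (simp add: dist_real_def)
    qed
  qed
  have "isCont (profile' front) \<xi>"
    by (rule DERIV_isCont[OF profile'_deriv[OF front_pos]])
  then have "(\<lambda>i. profile' front (x i)) \<longlonglongrightarrow> profile' front \<xi>"
    using \<nu> unfolding x_def by (rule isCont_tendsto_compose)
  then have 2: "(\<lambda>i. profile' front (x i) - profile' front \<xi>) \<longlonglongrightarrow> 0"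
    by (simp add: LIM_zero_iff)
  have 3: "(\<lambda>i. (h1 + h2) * density i * (profile' front (x i) - profile' front \<xi>)) \<longlonglongrightarrow> 0"
  proof (rule Lim_null_comparison)
    show "eventually (\<lambda>i. norm ((h1 + h2) * density i * (profile' front (x i) - profile' front \<xi>))
       \<le> (h1 + h2) * \<bar>profile' front (x i) - profile' front \<xi>\<bar>) sequentially"
    proof (intro always_eventually allI)
      fix i
      have "norm ((h1 + h2) * density i * (profile' front (x i) - profile' front \<xi>))
        = (h1 + h2) * density i * \<bar>profile' front (x i) - profile' front \<xi>\<bar>"
        using h12_pos density_bounds[of i] by (simp add: abs_mult)
      also have "\<dots> \<le> (h1 + h2) * 1 * \<bar>profile' front (x i) - profile' front \<xi>\<bar>"
        using h12_pos density_bounds[of i] by (intro mult_right_mono mult_left_mono) auto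
      finally show "norm ((h1 + h2) * density i * (profile' front (x i) - profile' front \<xi>))
       \<le> (h1 + h2) * \<bar>profile' front (x i) - profile' front \<xi>\<bar>" by simp
    qed
    have "(\<lambda>i. (h1 + h2) * \<bar>profile' front (x i) - profile' front \<xi>\<bar>) \<longlonglongrightarrow> (h1 + h2) * \<bar>0\<bar>"
      by (intro tendsto_mult tendsto_const tendsto_rabs 2)
    then show "(\<lambda>i. (h1 + h2) * \<bar>profile' front (x i) - profile' front \<xi>\<bar>) \<longlonglongrightarrow> 0" by simp
  qed
  show ?thesis
    using tendsto_add[OF 1 3] by (simp add: algebra_simps)
qed

text \<open>At its switching moment the solution vanishes; this forces the density to converge.\<close>
lemma density_converges:
  "(\<lambda>i. (h1 + h2) * density i) \<longlonglongrightarrow> (h1 - 2 * c - c * front\<^sup>2) / profile' front front"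
proof -
  define P where "P = profile' front front"
  have P: "P > 0" using profile'_front_pos[OF front_pos] by (simp add: P_def)
  have 1: "(\<lambda>i. deficit (int (node i)) (moment i) / moment i - (h1 + h2) * density i * P) \<longlonglongrightarrow> 0"
    unfolding P_def using node_ratio by (intro deficit_along) simp
  have "(\<lambda>i. - c * (real (node i) / sqrt (moment i))\<^sup>2 + (h1 - 2 * c)) \<longlonglongrightarrow> - c * front\<^sup>2 + (h1 - 2 * c)"
    by (intro tendsto_intros node_ratio)
  moreover have "eventually (\<lambda>i. - c * (real (node i) / sqrt (moment i))\<^sup>2 + (h1 - 2 * c) 
      = deficit (int (node i)) (moment i) / moment i) sequentially"
    using moment_at_top[unfolded filterlim_at_top_dense, rule_format, of 0]
  proof eventually_elim
    case (elim i)
    have "u (int (node i)) (moment i) = 0"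
      unfolding moment_def by (rule u_switching_moment[OF node_switching])
    then have "deficit (int (node i)) (moment i) = - c * (real (node i))\<^sup>2 + (h1 - 2 * c) * moment i"
      by (simp add: deficit_def)
    then show ?case using elim by (simp add: power_divide add_divide_distrib diff_divide_distrib)
  qed
  ultimately have 2: "(\<lambda>i. deficit (int (node i)) (moment i) / moment i) \<longlonglongrightarrow> - c * front\<^sup>2 + (h1 - 2 * c)"
    by (rule Lim_transform_eventually)
  have "(\<lambda>i. (deficit (int (node i)) (moment i) / moment i
      - (deficit (int (node i)) (moment i) / moment i - (h1 + h2) * density i * P)) / P) 
      \<longlonglongrightarrow> (- c * front\<^sup>2 + (h1 - 2 * c) - 0) / P"
    using P by (intro tendsto_divide tendsto_diff 1 2 tendsto_const) auto
  moreover have "(\<lambda>i. (deficit (int (node i)) (moment i) / moment i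
      - (deficit (int (node i)) (moment i) / moment i - (h1 + h2) * density i * P)) / P)
      = (\<lambda>i. (h1 + h2) * density i)"
    using P by (simp add: fun_eq_iff)
  moreover have "(- c * front\<^sup>2 + (h1 - 2 * c) - 0) / P = (h1 - 2 * c - c * front\<^sup>2) / P"
    by simp
  ultimately show ?thesis by (simp only: P_def)
qed

text \<open>The limiting density of the source \<open>(h1 + h2) p(n) / n\<close>.\<close>
definition strength :: real where
  "strength = (h1 - 2 * c - c * front\<^sup>2) / profile' front front"

text \<open>The limit of \<open>u\<^sub>n(t) / t\<close> as a function of \<open>n / \<surd>t\<close>.\<close>
definition limit_profile :: "real \<Rightarrow> real" where
  "limit_profile \<xi> = - c * \<xi>\<^sup>2 + (h1 - 2 * c) - strength * profile' front \<xi>"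

lemma u_along:
  fixes \<nu> :: "nat \<Rightarrow> int"
  assumes \<nu>: "(\<lambda>i. real_of_int (\<nu> i) / sqrt (moment i)) \<longlonglongrightarrow> \<xi>"
  shows "(\<lambda>i. u (\<nu> i) (moment i) / moment i) \<longlonglongrightarrow> limit_profile \<xi>"
proof -
  have 1: "(\<lambda>i. - c * (real_of_int (\<nu> i) / sqrt (moment i))\<^sup>2 + (h1 - 2 * c) 
      - (h1 + h2) * density i * profile' front \<xi>
      - (deficit (\<nu> i) (moment i) / moment i - (h1 + h2) * density i * profile' front \<xi>))
     \<longlonglongrightarrow> - c * \<xi>\<^sup>2 + (h1 - 2 * c) - strength * profile' front \<xi> - 0"
    unfolding strength_def by (intro tendsto_intros \<nu> density_converges deficit_along)
  have 2: "eventually (\<lambda>i. - c * (real_of_int (\<nu> i) / sqrt (moment i))\<^sup>2 + (h1 - 2 * c) 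
      - (h1 + h2) * density i * profile' front \<xi>
      - (deficit (\<nu> i) (moment i) / moment i - (h1 + h2) * density i * profile' front \<xi>)
     = u (\<nu> i) (moment i) / moment i) sequentially"
    using moment_at_top[unfolded filterlim_at_top_dense, rule_format, of 0]
  proof eventually_elim
    case (elim i)
    have "u (\<nu> i) (moment i) = - c * (real_of_int (\<nu> i))\<^sup>2 + (h1 - 2 * c) * moment i - deficit (\<nu> i) (moment i)"
      by (simp add: deficit_def)
    then show ?case using elim by (simp add: power_divide add_divide_distrib diff_divide_distrib)
  qed
  show ?thesis
    using Lim_transform_eventually[OF 1 2] by (simp add: limit_profile_def)
qed

lemma switching_if_limit_profile_pos:
  fixes \<nu> :: "nat \<Rightarrow> int"
  assumes \<nu>: "(\<lambda>i. real_of_int (\<nu> i) / sqrt (moment i)) \<longlonglongrightarrow> \<xi>" and "limit_profile \<xi> > 0"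
  shows "eventually (\<lambda>i. \<nu> i \<in> switching_nodes u \<and> switching_moment u (\<nu> i) \<le> moment i) sequentially"
  using order_tendstoD(1)[OF u_along[OF \<nu>] assms(2)] 
    moment_at_top[unfolded filterlim_at_top_dense, rule_format, of 0]
proof eventually_elim
  case (elim i)
  then have "u (\<nu> i) (moment i) \<ge> 0" by (simp add: zero_less_divide_iff)
  then have "\<nu> i \<in> switching_nodes u" unfolding switching_nodes_def using elim(2) by (auto intro: less_imp_le)
  then show ?case using switching_moment(3) \<open>u (\<nu> i) (moment i) \<ge> 0\<close> elim(2) by simp
qed

lemma strength_relation: "h1 - strength = (c - strength * inner_coeff front) * (front\<^sup>2 + 2)"
proof -
  have P: "profile' front front = 1 - inner_coeff front * (front\<^sup>2 + 2)" "profile' front front > 0"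
    using profile'_inner[OF front_pos, of front] profile'_front_pos[OF front_pos] front_pos by auto
  then have "strength * (1 - inner_coeff front * (front\<^sup>2 + 2)) = h1 - 2 * c - c * front\<^sup>2"
    by (simp add: strength_def)
  then show ?thesis by (simp add: algebra_simps)
qed

text \<open>If the limit profile were positive behind the front, every node would switch; but then the
  source is strong enough to make the profile negative at the origin.\<close>
lemma strength_lower: "c \<le> strength * inner_coeff front"
proof (rule ccontr)
  assume "\<not> ?thesis"
  then have neg: "c - strength * inner_coeff front > 0" by simp
  have P0: "profile' front 0 = 1 - inner_coeff front * 2"
    using profile'_inner[OF front_pos, of 0] front_pos by simp
  have lp0: "limit_profile 0 = h1 - strength - 2 * (c - strength * inner_coeff front)"
    unfolding limit_profile_def P0 by (simp add: algebra_simps)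
  also have "\<dots> = (c - strength * inner_coeff front) * front\<^sup>2"
    unfolding strength_relation by (simp add: algebra_simps)
  also have "\<dots> > 0" using neg front_pos by simp
  finally have pos: "limit_profile 0 > 0" .
  have all: "int m \<in> switching_nodes u" for m :: nat
  proof -
    have "(\<lambda>i. real_of_int (int m) / sqrt (moment i)) \<longlonglongrightarrow> 0"
      by (rule real_tendsto_divide_at_top[OF tendsto_const sqrt_moment_at_top])
    from switching_if_limit_profile_pos[OF this pos]
    have "eventually (\<lambda>i. int m \<in> switching_nodes u) sequentially"
      by (rule eventually_mono) simp
    then show ?thesis by simp
  qed
  have node: "node i = Suc i" for i
  proof -
    have "switching_nodes u \<inter> {1..int (node i) - 1} = int ` {1..<node i}"
    proof
      show "switching_nodes u \<inter> {1..int (node i) - 1} \<subseteq> int ` {1..<node i}"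
      proof
        fix k assume k: "k \<in> switching_nodes u \<inter> {1..int (node i) - 1}"
        show "k \<in> int ` {1..<node i}"
          by (rule image_eqI[of _ _ "nat k"]) (use k in auto)
      qed
    qed (use all in auto)
    then have "switch_count u (node i) = node i - 1" by (simp add: switch_count_def card_image)
    then show ?thesis using switch_count_enumerate[of i] node_pos[of i] by (simp add: node_def)
  qed
  have "(\<lambda>i. (h1 + h2) * (real i / real (Suc i))) \<longlonglongrightarrow> (h1 + h2) * 1"
    by (intro tendsto_intros LIMSEQ_n_over_Suc_n)
  moreover have "(\<lambda>i. (h1 + h2) * (real i / real (Suc i))) \<longlonglongrightarrow> strength"
    using density_converges by (simp add: density_def node strength_def)
  ultimately have "strength = h1 + h2" using LIMSEQ_unique by fastforce
  then have "h1 - strength \<le> 0" using h2 by simp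
  moreover have "h1 - strength > 0"
    unfolding strength_relation using neg by (intro mult_pos_pos add_nonneg_pos) auto
  ultimately show False by simp
qed

text \<open>Ahead of the front no node has switched yet, so the limit profile cannot increase through it.\<close>
lemma strength_upper: "strength * inner_coeff front \<le> c"
proof (rule ccontr)
  assume "\<not> ?thesis"
  then have neg: "strength * inner_coeff front - c > 0" by simp
  have P: "profile' front front > 0" by (rule profile'_front_pos[OF front_pos])
  have zero: "limit_profile front = 0"
    using P by (simp add: limit_profile_def strength_def)
  have "(limit_profile has_real_derivative - c * (2 * front) - strength * profile'' front front) (at front)"
    unfolding limit_profile_def
    by (rule derivative_eq_intros profile'_deriv[OF front_pos] refl | simp)+
  moreover have "- c * (2 * front) - strength * profile'' front front = (strength * inner_coeff front - c) * (2 * front)"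
    using profile''_inner[OF front_pos, of front] front_pos by (simp add: algebra_simps)
  ultimately have der: "(limit_profile has_real_derivative (strength * inner_coeff front - c) * (2 * front)) (at front)"
    by (rule DERIV_cong)
  have "(strength * inner_coeff front - c) * (2 * front) > 0" using neg front_pos by simp
  from DERIV_pos_inc_right[OF der this]
  obtain d where d: "d > 0" "\<And>h. h > 0 \<Longrightarrow> h < d \<Longrightarrow> limit_profile front < limit_profile (front + h)"
    by blast
  define \<xi> where "\<xi> = front + d / 2"
  have \<xi>: "\<xi> > front" "limit_profile \<xi> > 0" "\<xi> > 0"
    using d(2)[of "d / 2"] d(1) zero front_pos by (auto simp: \<xi>_def)
  define \<nu> where "\<nu> i = \<lceil>\<xi> * sqrt (moment i)\<rceil>" for i
  have inv0: "(\<lambda>i. 1 / sqrt (moment i)) \<longlonglongrightarrow> 0"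
    by (rule real_tendsto_divide_at_top[OF tendsto_const sqrt_moment_at_top])
  have ev_pos: "eventually (\<lambda>i. moment i > 0) sequentially"
    using moment_at_top by (simp add: filterlim_at_top_dense)
  have \<nu>: "(\<lambda>i. real_of_int (\<nu> i) / sqrt (moment i)) \<longlonglongrightarrow> \<xi>"
  proof (rule tendsto_sandwich)
    show "eventually (\<lambda>i. \<xi> \<le> real_of_int (\<nu> i) / sqrt (moment i)) sequentially"
      using ev_pos by eventually_elim (simp add: \<nu>_def pos_le_divide_eq)
    show "eventually (\<lambda>i. real_of_int (\<nu> i) / sqrt (moment i) \<le> \<xi> + 1 / sqrt (moment i)) sequentially"
      using ev_pos
    proof eventually_elim
      case (elim i)
      have "real_of_int (\<nu> i) / sqrt (moment i) \<le> (\<xi> * sqrt (moment i) + 1) / sqrt (moment i)"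
        using elim by (intro divide_right_mono) (auto simp: \<nu>_def)
      also have "\<dots> = \<xi> + 1 / sqrt (moment i)" using elim by (simp add: add_divide_distrib)
      finally show ?case .
    qed
    show "(\<lambda>i. \<xi> + 1 / sqrt (moment i)) \<longlonglongrightarrow> \<xi>"
      using tendsto_add[OF tendsto_const[of \<xi>] inv0] by simp
  qed simp
  define x where "x i = real_of_int (\<nu> i) / sqrt (moment i)" for i
  have "eventually (\<lambda>i. a * (x i)\<^sup>2 - A * x i * (1 / sqrt (moment i)) \<le> 1) sequentially"
    using switching_if_limit_profile_pos[OF \<nu> \<xi>(2)] ev_pos
  proof eventually_elim
    case (elim i)
    define w where "w = sqrt (moment i)"
    have w: "w > 0" "moment i = w * w" using elim(2) by (auto simp: w_def)
    have "\<xi> * sqrt (moment i) > 0" using \<xi>(3) elim(2) by simp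
    then have "\<nu> i \<ge> 0" unfolding \<nu>_def by linarith
    then have "a * (real_of_int (\<nu> i))\<^sup>2 - A * real_of_int (\<nu> i) \<le> switching_moment u (\<nu> i)"
      using growth[of "\<nu> i"] elim(1) by (simp add: abs_le_iff)
    also have "\<dots> \<le> w * w" using elim(1) w(2) by simp
    finally have "(a * (real_of_int (\<nu> i))\<^sup>2 - A * real_of_int (\<nu> i)) / (w * w) \<le> 1"
      using w(1) by simp
    moreover have "(a * (real_of_int (\<nu> i))\<^sup>2 - A * real_of_int (\<nu> i)) / (w * w)
       = a * (real_of_int (\<nu> i) / w)\<^sup>2 - A * (real_of_int (\<nu> i) / w) * (1 / w)"
      by (simp add: diff_divide_distrib power_divide power2_eq_square)
    ultimately show ?case by (simp only: x_def w_def)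
  qed
  moreover have "(\<lambda>i. a * (x i)\<^sup>2 - A * x i * (1 / sqrt (moment i))) \<longlonglongrightarrow> a * \<xi>\<^sup>2 - A * \<xi> * 0"
    unfolding x_def by (intro tendsto_diff tendsto_mult tendsto_power tendsto_const \<nu> inv0)
  ultimately have "a * \<xi>\<^sup>2 - A * \<xi> * 0 \<le> 1"
    by (intro tendsto_upperbound[of _ _ sequentially]) auto
  moreover have "front\<^sup>2 < \<xi>\<^sup>2" using \<xi>(1) front_pos by (intro power_strict_mono) auto
  then have "a * \<xi>\<^sup>2 > 1" using a_pos unfolding front_sq by (simp add: field_simps)
  ultimately show False by simp
qed

lemma strength_eq: "strength * inner_coeff front = c" "strength = h1"
  using strength_lower strength_upper strength_relation by auto

theorem switching_coeff_eq: "a = switching_coeff (h1 / c)"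
proof -
  have "h1 * inner_coeff front = c" using strength_eq by simp
  then have "inner_coeff front = c / h1" using h1_pos by (simp add: field_simps)
  then have "tail_ratio front = 1 - 2 / (h1 / c)"
    unfolding inner_coeff_eq using h1_pos c by (simp add: field_simps)
  then show ?thesis using switching_coeff_eqI[OF a_pos] by (simp add: front_def)
qed

lemma density_limit: "density \<longlonglongrightarrow> h1 / (h1 + h2)"
proof -
  have "(\<lambda>i. (h1 + h2) * density i / (h1 + h2)) \<longlonglongrightarrow> strength / (h1 + h2)"
    using density_converges h12_pos unfolding strength_def by (intro tendsto_divide tendsto_const) auto
  then show ?thesis using h12_pos by (simp add: strength_eq)
qed

text \<open>Between consecutive switching nodes the count is constant, which squeezes the ratio at an
  arbitrary node between its values at the neighbouring switching nodes.\<close>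
theorem switch_count_limit: "(\<lambda>n. real (switch_count u n) / real n) \<longlonglongrightarrow> h1 / (h1 + h2)"
proof -
  define f where "f = switch_count u"
  have less: "enumerate switching_nats j < n \<longleftrightarrow> j \<le> f n" if "n \<ge> 1" for j n
    using enumerate_less_switch_count[OF that] by (simp add: f_def)
  have f_top: "filterlim f at_top sequentially"
    unfolding filterlim_at_top
  proof
    fix j :: nat
    show "eventually (\<lambda>n. j \<le> f n) sequentially"
      using eventually_gt_at_top[of "enumerate switching_nats j"]
    proof eventually_elim
      case (elim n)
      then show ?case using less[of n j] by simp
    qed
  qed
  define lo hi where "lo i = real i / real (enumerate switching_nats (Suc i))" 
    and "hi i = real i / real (enumerate switching_nats i)" for i
  have lo: "lo \<longlonglongrightarrow> h1 / (h1 + h2)"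
    using density_limit unfolding lo_def density_def node_def .
  have hi: "hi \<longlonglongrightarrow> h1 / (h1 + h2)"
  proof (rule LIMSEQ_imp_Suc)
    have "(\<lambda>i. density i + 1 / real (node i)) \<longlonglongrightarrow> h1 / (h1 + h2) + 0"
      by (intro tendsto_add density_limit real_tendsto_divide_at_top[OF tendsto_const node_at_top])
    moreover have "density i + 1 / real (node i) = hi (Suc i)" for i
      by (simp add: density_def node_def hi_def add_divide_distrib)
    ultimately show "(\<lambda>i. hi (Suc i)) \<longlonglongrightarrow> h1 / (h1 + h2)" by simp
  qed
  show ?thesis
  proof (rule tendsto_sandwich)
    show "eventually (\<lambda>n. lo (f n) \<le> real (switch_count u n) / real n) sequentially"
      using eventually_ge_at_top[of 1]
    proof eventually_elim
      case (elim n)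
      have "n \<le> enumerate switching_nats (Suc (f n))" using less[OF elim, of "Suc (f n)"] by simp
      then show ?case unfolding lo_def f_def[symmetric] using elim by (intro divide_left_mono) auto
    qed
    show "eventually (\<lambda>n. real (switch_count u n) / real n \<le> hi (f n)) sequentially"
      using eventually_ge_at_top[of 1] filterlim_at_top[THEN iffD1, OF f_top, rule_format, of 1]
    proof eventually_elim
      case (elim n)
      have "enumerate switching_nats (f n) \<le> n" using less[OF elim(1), of "f n"] by simp
      moreover have "enumerate switching_nats (f n) \<ge> 1"
        using enumerate_switching_pos[of "f n - 1"] elim(2) by simp
      ultimately show ?case unfolding hi_def f_def[symmetric] by (intro divide_left_mono) auto
    qed
    show "(\<lambda>n. lo (f n)) \<longlonglongrightarrow> h1 / (h1 + h2)" by (rule filterlim_compose[OF lo f_top])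
    show "(\<lambda>n. hi (f n)) \<longlonglongrightarrow> h1 / (h1 + h2)" by (rule filterlim_compose[OF hi f_top])
  qed
qed

end

theorem theorem3p1:
  shows "\<exists>a_star :: real \<Rightarrow> real.
    infinitely_differentiable_on a_star {2<..} \<and>
    (\<forall>x>2. a_star x > 0) \<and>
    strict_antimono_on {2<..} a_star \<and>
    filterlim a_star at_top (at_right 2) \<and>
    (a_star \<longlongrightarrow> 0) at_top \<and>
    (\<forall>(h1::real) (h2::real) (c::real) (u :: int \<Rightarrow> real \<Rightarrow> real) (a::real).
       - h2 \<le> 0 \<and> 0 < 2 * c \<and> 2 * c < h1 \<and>
       global_solution h1 h2 c u \<and> quasi_uniform u \<and> quadratic_growth u a \<longrightarrow>
       (\<exists>p_star q_star :: real.
          (\<lambda>n. real (switch_count u n) / real n) \<longlonglongrightarrow> p_star \<and>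
          (\<lambda>n. real_of_int (nonswitch_count u n) / real n) \<longlonglongrightarrow> q_star \<and>
          p_star = h1 / (h1 + h2) \<and> q_star = h2 / (h1 + h2) \<and> q_star / p_star = h2 / h1) \<and>
       a = a_star (h1 / c))"
proof (intro exI[of _ switching_coeff] conjI switching_coeff_smooth switching_coeff_strict_antimono
    switching_coeff_at_right_2 switching_coeff_at_top allI impI switching_coeff_pos)
  fix h1 h2 c a :: real and u :: "int \<Rightarrow> real \<Rightarrow> real"
  assume prems: "- h2 \<le> 0 \<and> 0 < 2 * c \<and> 2 * c < h1 \<and>
    global_solution h1 h2 c u \<and> quasi_uniform u \<and> quadratic_growth u a"
  then have "a > 0" unfolding quadratic_growth_def by blast
  obtain A \<omega> where A: "A > 0" and \<omega>: "\<forall>k\<in>switching_nodes u.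
      switching_moment u k = a * (real_of_int k)\<^sup>2 + \<omega> k \<and> \<bar>\<omega> k\<bar> \<le> A * real_of_int \<bar>k\<bar>"
    using prems unfolding quadratic_growth_def by blast
  interpret quadratic_hysteresis_lattice h1 h2 c u a A
  proof
    show "\<bar>switching_moment u k - a * (real_of_int k)\<^sup>2\<bar> \<le> A * real_of_int \<bar>k\<bar>"
      if "k \<in> switching_nodes u" for k
      using bspec[OF \<omega> that] by simp
  qed (use prems A \<open>a > 0\<close> in simp_all)
  show "a = switching_coeff (h1 / c)" by (rule switching_coeff_eq)
  have "(\<lambda>n. 1 - real (switch_count u n) / real n) \<longlonglongrightarrow> 1 - h1 / (h1 + h2)"
    by (intro tendsto_diff tendsto_const switch_count_limit)
  moreover have "1 - h1 / (h1 + h2) = h2 / (h1 + h2)"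
    using h12_pos by (simp add: field_simps)
  moreover have "eventually (\<lambda>n. 1 - real (switch_count u n) / real n 
      = real_of_int (nonswitch_count u n) / real n) sequentially"
    using eventually_gt_at_top[of 0]
    by eventually_elim (simp add: nonswitch_count_def diff_divide_distrib)
  ultimately have q: "(\<lambda>n. real_of_int (nonswitch_count u n) / real n) \<longlonglongrightarrow> h2 / (h1 + h2)"
    using Lim_transform_eventually by metis
  have "(h2 / (h1 + h2)) / (h1 / (h1 + h2)) = h2 / h1"
    using h12_pos by simp
  then show "\<exists>p_star q_star :: real.
      (\<lambda>n. real (switch_count u n) / real n) \<longlonglongrightarrow> p_star \<and>
      (\<lambda>n. real_of_int (nonswitch_count u n) / real n) \<longlonglongrightarrow> q_star \<and>
      p_star = h1 / (h1 + h2) \<and> q_star = h2 / (h1 + h2) \<and> q_star / p_star = h2 / h1"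
    using q switch_count_limit by blast
qed

end
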